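(* Let $d\ge1$, $\gamma\in\mathbb{R}\setminus\{0\}$, and let $Z$ be the interacting branching diffusion in $\mathbb{R}^d$ with drift parameter $b$ and interaction parameter $\gamma$. Assume that $b>0$ and $b+\gamma=0$. Then, for any bounded Borel set $B\subset\mathbb{R}^d$, $$\lim_{n\to\infty}C\,n^{d/2}\,2^{-n}Z_n(B)=\mathrm{Leb}(B)\quad\text{almost surely},$$ where $C:=(2\pi)^{d/2}$, $\mathrm{Leb}$ is $d$-dimensional Lebesgue measure, and $n$ runs through the positive integers.
   Context: Model. Fix $d\ge1$, $b\in\mathbb{R}$ and $\gamma\neq 0$. The process $Z$ starts at time $0$ with one particle at the origin of $\mathbb{R}^d$. For each $m=0,1,2,\dots$, during the time interval $[m,m+1)$ there are exactly $2^m$ particles, with positions $Z_t^i$, $1\le i\le 2^m$; at each integer time $m\ge 1$ every particle is replaced by exactly two offspring, located at the parent's position (labels are arbitrary but independent of the spatial motion). On $[m,m+1)$ the positions satisfy $$\mathrm{d}Z_t^i = \mathrm{d}W_t^{i,m} - bZ_t^i\,\mathrm{d}t + \frac{1}{2^m}\sum_{j=1}^{2^m}\gamma\,(Z_t^j-Z_t^i)\,\mathrm{d}t,\qquad 1\le i\le 2^m,$$ where $\{W^{i,m}\}_{1\le i\le 2^m}$ are independent standard $d$-dimensional Brownian motions on $[m,m+1)$, also independent of the past up to time $m$. The associated discrete measure-valued process is $Z_t(\mathrm{d}y):=\sum_{i=1}^{2^{\lfloor t\rfloor}}\delta_{Z_t^i}(\mathrm{d}y)$, so $Z_n(B)$ is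 the number of particles in $B$ at time $n$. *)

theory Defs
  imports "HOL-Probability.Probability"
begin

definition generated_events ::
    "'w measure \<Rightarrow> 'i set \<Rightarrow> ('i \<Rightarrow> 'w \<Rightarrow> 'b::topological_space) \<Rightarrow> 'w set set" where
  "generated_events M I X =
     sigma_sets (space M) (\<Union>i\<in>I. {X i -` A \<inter> space M | A. A \<in> sets borel})"

text \<open>Density of the centred Gaussian law on \<open>\<real>\<^sup>d\<close> with covariance matrix \<open>v\<close> times the identity.\<close>

definition gaussian_density :: "real \<Rightarrow> real ^ 'd \<Rightarrow> real" where
  "gaussian_density v x = (\<Prod>k\<in>UNIV. normal_density 0 (sqrt v) (x $ k))"

text \<open>Standard \<open>d\<close>-dimensional Brownian motion on the time interval \<open>[a, c)\<close>, started from the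
  origin at time \<open>a\<close>.\<close>

definition (in prob_space) standard_brownian_motion ::
    "real \<Rightarrow> real \<Rightarrow> (real \<Rightarrow> 'a \<Rightarrow> real ^ 'd) \<Rightarrow> bool" where
  "standard_brownian_motion a c X \<longleftrightarrow>
     (\<forall>t\<in>{a..<c}. X t \<in> borel_measurable M) \<and>
     (AE \<omega> in M. X a \<omega> = 0) \<and>
     (\<forall>s t. a \<le> s \<longrightarrow> s < t \<longrightarrow> t < c \<longrightarrow>
        distributed M lborel (\<lambda>\<omega>. X t \<omega> - X s \<omega>) (\<lambda>x. ennreal (gaussian_density (t - s) x))) \<and>
     (\<forall>n (\<tau> :: nat \<Rightarrow> real). strict_mono_on {..n} \<tau> \<longrightarrow> \<tau> ` {..n} \<subseteq> {a..<c} \<longrightarrow>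
        indep_vars (\<lambda>_. borel) (\<lambda>k \<omega>. X (\<tau> (Suc k)) \<omega> - X (\<tau> k) \<omega>) {..<n}) \<and>
     (AE \<omega> in M. continuous_on {a..<c} (\<lambda>t. X t \<omega>))"

text \<open>Drift of particle \<open>i\<close> in a configuration \<open>x 1, \<dots>, x N\<close>.\<close>

definition drift :: "real \<Rightarrow> real \<Rightarrow> nat \<Rightarrow> (nat \<Rightarrow> real ^ 'd) \<Rightarrow> nat \<Rightarrow> real ^ 'd" where
  "drift b \<gamma> N x i =
     - b *\<^sub>R x i + (1 / real N) *\<^sub>R (\<Sum>j=1..N. \<gamma> *\<^sub>R (x j - x i))"

definition labels :: "real \<Rightarrow> nat set" where
  "labels t = {1..2 ^ nat \<lfloor>t\<rfloor>}"

text \<open>\<open>Z t i\<close> is the position at time \<open>t\<close> of the particle labelled \<open>i \<in> labels t\<close>; values outside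
  these ranges are irrelevant. \<open>W m i\<close> is the Brownian motion driving particle \<open>i\<close> on \<open>[m, m+1)\<close>.
  \<open>parent m i\<close> is the (possibly random) label, among the particles alive on \<open>[m, m+1)\<close>, of the
  parent of the particle which carries label \<open>i\<close> on \<open>[m+1, m+2)\<close>.\<close>

definition driving_index :: "(nat \<times> nat \<times> real) set" where
  "driving_index = {(m, i, t). i \<in> {1..2 ^ m} \<and> t \<in> {real m..<real m + 1}}"

definition parent_index :: "(nat \<times> nat) set" where
  "parent_index = {(m, i). i \<in> {1..2 ^ Suc m}}"

text \<open>The past up to time \<open>m\<close>, including the branching at time \<open>m\<close> itself.\<close>

definition past ::
    "'w measure \<Rightarrow> (nat \<Rightarrow> nat \<Rightarrow> 'w \<Rightarrow> nat) \<Rightarrow> (nat \<Rightarrow> nat \<Rightarrow> real \<Rightarrow> 'w \<Rightarrow> real ^ 'd) \<Rightarrow>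
     (real \<Rightarrow> nat \<Rightarrow> 'w \<Rightarrow> real ^ 'd) \<Rightarrow> nat \<Rightarrow> 'w set set" where
  "past M parent W Z m = sigma_sets (space M)
     (generated_events M {(s, i). s \<in> {0..real m} \<and> i \<in> labels s} (\<lambda>(s, i). Z s i) \<union>
      generated_events M {(k, i, s) \<in> driving_index. k < m} (\<lambda>(k, i, s). W k i s) \<union>
      generated_events M {(k, i) \<in> parent_index. k < m} (\<lambda>(k, i). parent k i))"

locale interacting_branching_diffusion = prob_space M
  for M :: "'w measure" +
  fixes b \<gamma> :: real
    and parent :: "nat \<Rightarrow> nat \<Rightarrow> 'w \<Rightarrow> nat"
    and W :: "nat \<Rightarrow> nat \<Rightarrow> real \<Rightarrow> 'w \<Rightarrow> real ^ 'd"
    and Z :: "real \<Rightarrow> nat \<Rightarrow> 'w \<Rightarrow> real ^ 'd"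
  assumes interaction_nonzero: "\<gamma> \<noteq> 0"
    and Z_measurable: "\<And>t i. 0 \<le> t \<Longrightarrow> i \<in> labels t \<Longrightarrow> Z t i \<in> borel_measurable M"
    and parent_measurable:
      "\<And>m i. i \<in> {1..2 ^ Suc m} \<Longrightarrow> parent m i \<in> measurable M (count_space UNIV)"
    and brownian:
      "\<And>m i. i \<in> {1..2 ^ m} \<Longrightarrow> standard_brownian_motion (real m) (real m + 1) (W m i)"
    \<comment> \<open>for each \<open>m\<close>, the motions \<open>W m i\<close> and the past up to time \<open>m\<close> are jointly independent\<close>
    and independent_of_past:
      "\<And>m. indep_sets
         (case_option (past M parent W Z m)
            (\<lambda>i. generated_events M {real m..<real m + 1} (W m i)))
         (insert None (Some ` {1..2 ^ m}))"
    \<comment> \<open>the labelling is independent of the spatial motion\<close>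
    and labelling_independent:
      "indep_set (generated_events M parent_index (\<lambda>(m, i). parent m i))
                 (generated_events M driving_index (\<lambda>(m, i, t). W m i t))"
    and start: "AE \<omega> in M. Z 0 1 \<omega> = 0"
    and two_offspring:
      "AE \<omega> in M. \<forall>m. (\<forall>i\<in>{1..2 ^ Suc m}. parent m i \<omega> \<in> {1..2 ^ m}) \<and>
                      (\<forall>j\<in>{1..2 ^ m}. card {i \<in> {1..2 ^ Suc m}. parent m i \<omega> = j} = 2)"
    \<comment> \<open>positions at a branching time are the left limits of the parents' positions\<close>
    and born_at_parent:
      "AE \<omega> in M. \<forall>m. \<forall>i\<in>{1..2 ^ Suc m}.
         ((\<lambda>t. Z t (parent m i \<omega>) \<omega>) \<longlongrightarrow> Z (real (Suc m)) i \<omega>) (at_left (real (Suc m)))"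
    and continuous_paths:
      "AE \<omega> in M. \<forall>m. \<forall>i\<in>{1..2 ^ m}. continuous_on {real m..<real m + 1} (\<lambda>t. Z t i \<omega>)"
    \<comment> \<open>the stochastic differential equation in integrated form; the noise is additive\<close>
    and sde:
      "AE \<omega> in M. \<forall>m. \<forall>i\<in>{1..2 ^ m}. \<forall>t\<in>{real m..<real m + 1}.
         Z t i \<omega> = Z (real m) i \<omega> + (W m i t \<omega> - W m i (real m) \<omega>)
           + integral {real m..t} (\<lambda>s. drift b \<gamma> (2 ^ m) (\<lambda>j. Z s j \<omega>) i)"

text \<open>The measure \<open>\<Sum>\<^sub>i \<delta>(Z t i)\<close>, as the image of counting measure on the labels.\<close>

definition particle_measure ::
    "(real \<Rightarrow> nat \<Rightarrow> 'w \<Rightarrow> real ^ 'd) \<Rightarrow> real \<Rightarrow> 'w \<Rightarrow> (real ^ 'd) measure" where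
  "particle_measure Z t \<omega> = distr (count_space (labels t)) borel (\<lambda>i. Z t i \<omega>)"

lemma emeasure_particle_measure:
  assumes "B \<in> sets borel"
  shows "emeasure (particle_measure Z t \<omega>) B
       = (\<Sum>i\<in>labels t. emeasure (return borel (Z t i \<omega>)) B)"
proof -
  have fin: "finite (labels t)" by (simp add: labels_def)
  have "emeasure (particle_measure Z t \<omega>) B
      = emeasure (count_space (labels t)) ((\<lambda>i. Z t i \<omega>) -` B \<inter> labels t)"
    unfolding particle_measure_def using assms by (subst emeasure_distr) auto
  also have "\<dots> = of_nat (card ((\<lambda>i. Z t i \<omega>) -` B \<inter> labels t))"
    using fin by (subst emeasure_count_space_finite) auto
  also have "\<dots> = (\<Sum>i\<in>labels t. indicator B (Z t i \<omega>))"
    using fin by (simp add: indicator_def sum.If_cases vimage_def Int_def conj_commute)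
  also have "\<dots> = (\<Sum>i\<in>labels t. emeasure (return borel (Z t i \<omega>)) B)"
    using assms by simp
  finally show ?thesis .
qed

end

theory Submission
  imports Defs
begin

text \<open>When \<open>b + \<gamma> = 0\<close> every particle has the same drift \<open>- b\<close> times the centre of mass. Conditionally on
  the genealogy, which is independent of the driving motions, the positions at time \<open>n\<close> are
  therefore a centred Gaussian vector: two particles which share \<open>s\<close> unit intervals of ancestry have
  coordinatewise covariance \<open>s + \<delta>\<close> and variance \<open>n + \<delta>\<close>, with one bounded correction \<open>\<delta>\<close> depending
  on \<open>n\<close> only. For the pair, the probability of both lying in \<open>B\<close> exceeds the product of the
  probabilities by a relative error \<open>O(s\<^sup>2 / n\<^sup>2)\<close>, and a proportion of at most \<open>2\<^sup>1\<^sup>-\<^sup>s\<close> of the pairs shares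
  exactly \<open>s\<close> intervals. Hence the rescaled count has variance \<open>O(1 / n\<^sup>2)\<close>, which is summable, and its
  mean is asymptotically \<open>(2\<pi>)\<close> to the power \<open>- d / 2\<close> times the Lebesgue measure of \<open>B\<close>.\<close>

section \<open>Characteristic functions determine measures on Euclidean spaces\<close>

text \<open>The positions are given only through a pathwise integral equation, and the driving
  motions only through the laws of their increments. Gaussianity therefore has to pass through a
  limit: for a fixed genealogy each position is an almost sure limit of finite weighted sums of
  increments. The characteristic functions of these sums are explicit, and a uniqueness theorem
  identifies the limit law, for one particle and for a pair. Displacements from the centre of mass
  feel no drift, while the centre of mass is damped at rate b > 0 and driven by an average of 2^m
  motions; this keeps \<delta> bounded. Its value is never computed: for each n a limit point of the
  discretised correction serves. The correlation is linear in s / n but the relative error is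
  quadratic: the determinant contributes the square of the correlation, and the cross term in the
  exponent gains a factor 1 / n because B is bounded. Given the genealogy the mean depends on n
  alone, so the randomness of the genealogy adds no variance.\<close>

definition gauss_density :: "real \<Rightarrow> 'e::euclidean_space \<Rightarrow> real" where
  "gauss_density v x = (\<Prod>b\<in>Basis. normal_density 0 (sqrt v) (x \<bullet> b))"

lemma gauss_density_nonneg [simp]: "0 \<le> gauss_density v x"
  by (simp add: gauss_density_def prod_nonneg)

lemma gauss_density_measurable [measurable]: "gauss_density v \<in> borel_measurable borel"
  unfolding gauss_density_def by measurable

text \<open>A density written over \<open>Basis\<close> makes sense in every Euclidean space. That
  generality is used: the uniqueness theorem for characteristic functions is applied to one position
  and also to a pair of positions, whose type is a product.\<close>

lemma gaussian_density_eq_gauss_density: "gaussian_density v x = gauss_density v x"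
proof -
  have "(\<Prod>b\<in>(Basis :: (real^'a) set). normal_density 0 (sqrt v) (x \<bullet> b))
      = (\<Prod>b\<in>(\<lambda>k. axis k (1::real)) ` UNIV. normal_density 0 (sqrt v) (x \<bullet> b))"
    by (rule prod.cong) (auto simp: Basis_vec_def)
  also have "\<dots> = (\<Prod>k\<in>UNIV. normal_density 0 (sqrt v) (x $ k))"
    by (subst prod.reindex) (auto simp: inj_on_def axis_eq_axis cart_eq_inner_axis)
  finally show ?thesis
    by (simp add: gauss_density_def gaussian_density_def)
qed

lemma gauss_density_eq:
  fixes x :: "'e::euclidean_space"
  assumes "v > 0"
  shows "gauss_density v x
    = (2 * pi * v) powr (- real DIM('e) / 2) * exp (- (norm x)\<^sup>2 / (2 * v))"
proof -
  have "gauss_density v x = (\<Prod>b\<in>(Basis :: 'e set). 1 / sqrt (2 * pi * v)) * (\<Prod>b\<in>(Basis :: 'e set). exp (- (x \<bullet> b)\<^sup>2 / (2 * v)))"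
    using assms by (simp add: gauss_density_def normal_density_def prod_dividef power_one_over)
  also have "(\<Prod>b\<in>(Basis :: 'e set). exp (- (x \<bullet> b)\<^sup>2 / (2 * v))) = exp (- (\<Sum>b\<in>Basis. (x \<bullet> b)\<^sup>2) / (2 * v))"
    by (simp add: exp_sum[symmetric] sum_divide_distrib sum_negf)
  also have "(\<Sum>b\<in>Basis. (x \<bullet> b)\<^sup>2) = (norm x)\<^sup>2"
    by (subst power2_norm_eq_inner, subst euclidean_inner) (simp add: power2_eq_square)
  also have "(\<Prod>b\<in>(Basis :: 'e set). 1 / sqrt (2 * pi * v)) = (2 * pi * v) powr (- real DIM('e) / 2)"
  proof -
    have "1 / sqrt (2 * pi * v) = (2 * pi * v) powr (- (1/2))"
      using assms by (simp add: powr_minus powr_half_sqrt inverse_eq_divide)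
    then show ?thesis using assms
      by (simp add: powr_realpow[symmetric] powr_powr del: powr_realpow)
  qed
  finally show ?thesis .
qed

lemma nn_integral_gauss_density:
  assumes "v > 0"
  shows "(\<integral>\<^sup>+x. gauss_density v (x::'e::euclidean_space) \<partial>lborel) = 1"
proof -
  have "(\<integral>\<^sup>+x. gauss_density v (x::'e) \<partial>lborel)
      = (\<integral>\<^sup>+x. (\<Prod>b\<in>(Basis::'e set). ennreal (normal_density 0 (sqrt v) (x \<bullet> b))) \<partial>lborel)"
    by (simp add: gauss_density_def prod_ennreal)
  also have "\<dots> = (\<Prod>b\<in>(Basis::'e set). \<integral>\<^sup>+x. ennreal (normal_density 0 (sqrt v) x) \<partial>lborel)"
    by (rule nn_integral_lborel_prod) auto
  also have "\<dots> = 1"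
    using assms by (simp add: nn_integral_eq_integral)
  finally show ?thesis .
qed

abbreviation gauss :: "real \<Rightarrow> 'e::euclidean_space measure" where
  "gauss v \<equiv> density lborel (\<lambda>x. ennreal (gauss_density v x))"

lemma prob_space_gauss: "v > 0 \<Longrightarrow> prob_space (gauss v)"
  by (rule prob_spaceI) (simp add: emeasure_density nn_integral_gauss_density)

lemma char_normal:
  assumes "\<sigma> > 0"
  shows "(CLINT x|lborel. normal_density 0 \<sigma> x *\<^sub>R iexp (s * x)) = exp (- (\<sigma> * s)\<^sup>2 / 2)"
proof -
  have "(CLINT x|lborel. normal_density 0 \<sigma> x *\<^sub>R iexp (s * x))
      = \<bar>\<sigma>\<bar> *\<^sub>R (CLINT x|lborel. normal_density 0 \<sigma> (0 + \<sigma> * x) *\<^sub>R iexp (s * (0 + \<sigma> * x)))"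
    by (rule lborel_integral_real_affine) (use assms in auto)
  also have "\<dots> = (CLINT x|lborel. (\<sigma> * normal_density 0 \<sigma> (\<sigma> * x)) *\<^sub>R iexp (s * \<sigma> * x))"
    using assms by (simp add: ac_simps flip: integral_scaleR_right)
  also have "(\<lambda>x. \<sigma> * normal_density 0 \<sigma> (\<sigma> * x)) = std_normal_density"
    using assms by (auto simp: normal_density_def fun_eq_iff real_sqrt_mult power_mult_distrib)
  also have "(CLINT x|lborel. std_normal_density x *\<^sub>R iexp (s * \<sigma> * x)) = char std_normal_distribution (s * \<sigma>)"
    unfolding char_def by (subst integral_density) auto
  also have "\<dots> = exp (- (\<sigma> * s)\<^sup>2 / 2)"
    by (simp add: char_std_normal_distribution exp_of_real[symmetric] mult.commute)
  finally show ?thesis .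
qed

lemma integral_lborel_prod:
  fixes f :: "'e::euclidean_space \<Rightarrow> real \<Rightarrow> complex"
  assumes "\<And>b. b \<in> Basis \<Longrightarrow> integrable lborel (f b)"
  shows "(\<integral>x. (\<Prod>b\<in>Basis. f b (x \<bullet> b)) \<partial>lborel) = (\<Prod>b\<in>Basis. \<integral>x. f b x \<partial>lborel)"
proof -
  interpret product_sigma_finite "\<lambda>b::'e. lborel :: real measure" ..
  have [measurable]: "f b \<in> borel_measurable borel" if "b \<in> Basis" for b
    using assms[OF that] by auto
  have "(\<integral>x. (\<Prod>b\<in>Basis. f b (x \<bullet> b)) \<partial>lborel)
    = (\<integral>x. (\<Prod>b\<in>(Basis::'e set). f b ((\<Sum>c\<in>Basis. x c *\<^sub>R c) \<bullet> b)) \<partial>(\<Pi>\<^sub>M b\<in>(Basis::'e set). lborel))"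
    by (subst lborel_eq, subst integral_distr) auto
  also have "\<dots> = (\<integral>x. (\<Prod>b\<in>(Basis::'e set). f b (x b)) \<partial>(\<Pi>\<^sub>M b\<in>(Basis::'e set). lborel))"
    by (intro Bochner_Integration.integral_cong prod.cong) auto
  also have "\<dots> = (\<Prod>b\<in>Basis. \<integral>x. f b x \<partial>lborel)"
    by (rule product_integral_prod) (use assms in auto)
  finally show ?thesis .
qed

lemma char_gauss:
  assumes "v > 0"
  shows "(\<integral>x. iexp (t \<bullet> x) \<partial>gauss v) = exp (- v * (norm (t::'e::euclidean_space))\<^sup>2 / 2)"
proof -
  have "(\<integral>x. iexp (t \<bullet> x) \<partial>gauss v) = (\<integral>x. gauss_density v x *\<^sub>R iexp (t \<bullet> x) \<partial>lborel)"
    by (subst integral_density) auto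
  also have "\<dots> = (\<integral>x. (\<Prod>b\<in>(Basis::'e set). normal_density 0 (sqrt v) (x \<bullet> b) *\<^sub>R iexp ((t \<bullet> b) * (x \<bullet> b))) \<partial>lborel)"
  proof (intro Bochner_Integration.integral_cong refl)
    fix x :: 'e
    have "iexp (t \<bullet> x) = (\<Prod>b\<in>(Basis::'e set). iexp ((t \<bullet> b) * (x \<bullet> b)))"
      by (subst euclidean_inner) (simp add: exp_sum sum_distrib_left)
    then show "gauss_density v x *\<^sub>R iexp (t \<bullet> x)
        = (\<Prod>b\<in>(Basis::'e set). normal_density 0 (sqrt v) (x \<bullet> b) *\<^sub>R iexp ((t \<bullet> b) * (x \<bullet> b)))"
      by (simp add: gauss_density_def scaleR_conv_of_real prod.distrib)
  qed
  also have "\<dots> = (\<Prod>b\<in>(Basis::'e set). \<integral>x. normal_density 0 (sqrt v) x *\<^sub>R iexp ((t \<bullet> b) * x) \<partial>lborel)"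
  proof (rule integral_lborel_prod)
    fix b :: 'e
    show "integrable lborel (\<lambda>x. normal_density 0 (sqrt v) x *\<^sub>R iexp ((t \<bullet> b) * x))"
      by (rule Bochner_Integration.integrable_bound[of _ "normal_density 0 (sqrt v)"]) (use assms in auto)
  qed
  also have "\<dots> = (\<Prod>b\<in>(Basis::'e set). exp (- (sqrt v * (t \<bullet> b))\<^sup>2 / 2))"
    unfolding of_real_prod by (intro prod.cong refl char_normal) (use assms in auto)
  also have "\<dots> = exp (of_real (\<Sum>b\<in>(Basis::'e set). - (sqrt v * (t \<bullet> b))\<^sup>2 / 2))"
    by (simp only: exp_of_real exp_sum[OF finite_Basis])
  also have "(\<Sum>b\<in>(Basis::'e set). - (sqrt v * (t \<bullet> b))\<^sup>2 / 2) = - v * (\<Sum>b\<in>Basis. (t \<bullet> b)\<^sup>2) / 2"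
    using assms by (simp add: power_mult_distrib sum_distrib_left sum_negf sum_divide_distrib)
  also have "(\<Sum>b\<in>Basis. (t \<bullet> b)\<^sup>2) = (norm t)\<^sup>2"
    by (subst power2_norm_eq_inner, subst (2) euclidean_inner) (simp add: power2_eq_square)
  finally show ?thesis by (simp only: exp_of_real)
qed

text \<open>The unnormalised Gaussian kernel of variance v is the characteristic function of
  \<open>gauss (1 / v)\<close>. By Fubini its average against \<mu> becomes an integral of the
  characteristic function of \<mu>, so Gaussian smoothings of \<mu> depend on \<mu> only through
  that function.\<close>

lemma gauss_transform_eq_char_integral:
  fixes \<mu> :: "'e::euclidean_space measure"
  assumes "prob_space \<mu>" and sets [measurable_cong]: "sets \<mu> = sets borel" and "v > 0"
  shows "complex_of_real (\<integral>x. exp (- (norm (x - y))\<^sup>2 / (2 * v)) \<partial>\<mu>)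
       = (\<integral>t. iexp (- (t \<bullet> y)) * (\<integral>x. iexp (t \<bullet> x) \<partial>\<mu>) \<partial>gauss (1 / v))"
proof -
  interpret \<mu>: prob_space \<mu> by fact
  interpret \<Gamma>: prob_space "gauss (1 / v) :: 'e measure"
    by (rule prob_space_gauss) (use assms in auto)
  interpret pair_prob_space \<mu> "gauss (1 / v) :: 'e measure" ..
  have "(\<integral>t. iexp (- (t \<bullet> y)) * (\<integral>x. iexp (t \<bullet> x) \<partial>\<mu>) \<partial>gauss (1 / v))
      = (\<integral>t. (\<integral>x. iexp (t \<bullet> (x - y)) \<partial>\<mu>) \<partial>gauss (1 / v))"
    by (intro Bochner_Integration.integral_cong refl)
      (simp add: inner_diff_right exp_diff right_diff_distrib exp_minus field_simps
        flip: integral_mult_right_zero integral_divide_zero)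
  also have "\<dots> = (\<integral>x. (\<integral>t. iexp (t \<bullet> (x - y)) \<partial>gauss (1 / v)) \<partial>\<mu>)"
  proof (rule Fubini_integral)
    show "integrable (\<mu> \<Otimes>\<^sub>M gauss (1 / v)) (\<lambda>(x, t). iexp (t \<bullet> (x - y)))"
      by (rule P.integrable_const_bound[where B=1]) (auto split: prod.split)
  qed
  also have "\<dots> = (\<integral>x. complex_of_real (exp (- (norm (x - y))\<^sup>2 / (2 * v))) \<partial>\<mu>)"
    using assms by (intro Bochner_Integration.integral_cong refl)
      (subst inner_commute, subst char_gauss, auto)
  finally show ?thesis by simp
qed

text \<open>The substitution y = x + sqrt v z moves the variance from the measure into the argument
  of f. All smoothings then live on one probability space, and v -> 0 becomes a limit inside the
  integrand.\<close>

lemma nn_integral_gauss_translate: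
  fixes f :: "'e::euclidean_space \<Rightarrow> ennreal"
  assumes [measurable]: "f \<in> borel_measurable borel" and v: "v > 0"
  shows "(\<integral>\<^sup>+y. f y * gauss_density v (y - x) \<partial>lborel) = (\<integral>\<^sup>+z. f (x + sqrt v *\<^sub>R z) \<partial>gauss 1)"
proof -
  have *: "ennreal (sqrt v ^ DIM('e)) * gauss_density v (sqrt v *\<^sub>R z) = gauss_density 1 z" for z :: 'e
  proof -
    have "sqrt v ^ DIM('e) * gauss_density v (sqrt v *\<^sub>R z)
        = (\<Prod>b\<in>(Basis::'e set). sqrt v * normal_density 0 (sqrt v) (sqrt v * (z \<bullet> b)))"
      by (simp add: gauss_density_def prod.distrib)
    also have "\<dots> = gauss_density 1 z"
      unfolding gauss_density_def using v
      by (intro prod.cong refl) (simp add: normal_density_def real_sqrt_mult power_mult_distrib)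
    finally show ?thesis using v by (simp add: ennreal_mult[symmetric])
  qed
  have "(\<integral>\<^sup>+y. f y * gauss_density v (y - x) \<partial>lborel)
      = (\<integral>\<^sup>+z. ennreal (sqrt v ^ DIM('e)) * (f (x + sqrt v *\<^sub>R z) * gauss_density v (sqrt v *\<^sub>R z)) \<partial>lborel)"
    using v by (subst lborel_affine[of "sqrt v" x])
      (auto simp: nn_integral_density nn_integral_distr)
  also have "\<dots> = (\<integral>\<^sup>+z. gauss_density 1 z * f (x + sqrt v *\<^sub>R z) \<partial>lborel)"
    by (simp add: *[symmetric] ac_simps)
  also have "\<dots> = (\<integral>\<^sup>+z. f (x + sqrt v *\<^sub>R z) \<partial>gauss 1)"
    by (subst nn_integral_density) auto
  finally show ?thesis .
qed

text \<open>The left side is the expectation of f (X + s Y) with X of law \<mu>, Y an independent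
  standard Gaussian and s^2 = 1 / (k + 1). As s tends to 0, dominated convergence applies.\<close>

lemma gauss_smoothing_tendsto:
  fixes \<mu> :: "'e::euclidean_space measure" and f :: "'e \<Rightarrow> real"
  assumes "prob_space \<mu>" and sets [measurable_cong]: "sets \<mu> = sets borel"
    and f: "continuous_on UNIV f" "\<And>x. 0 \<le> f x" "\<And>x. f x \<le> 1"
  shows "(\<lambda>k. \<integral>\<^sup>+y. f y * (\<integral>\<^sup>+x. gauss_density (1 / real (Suc k)) (y - x) \<partial>\<mu>) \<partial>lborel)
           \<longlonglongrightarrow> (\<integral>\<^sup>+x. f x \<partial>\<mu>)"
proof -
  interpret \<mu>: prob_space \<mu> by fact
  interpret \<Gamma>: prob_space "gauss 1 :: 'e measure"
    by (rule prob_space_gauss) auto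
  interpret pair_prob_space \<mu> "gauss 1 :: 'e measure" ..
  interpret L: pair_sigma_finite \<mu> "lborel :: 'e measure" ..
  have [measurable]: "f \<in> borel_measurable borel"
    using f(1) by (rule borel_measurable_continuous_onI)
  define s where "s k = sqrt (1 / real (Suc k))" for k
  have eq: "(\<integral>\<^sup>+y. f y * (\<integral>\<^sup>+x. gauss_density (1 / real (Suc k)) (y - x) \<partial>\<mu>) \<partial>lborel)
      = (\<integral>\<^sup>+p. f (fst p + s k *\<^sub>R snd p) \<partial>(\<mu> \<Otimes>\<^sub>M gauss 1))" for k
  proof -
    have "(\<integral>\<^sup>+y. f y * (\<integral>\<^sup>+x. gauss_density (1 / real (Suc k)) (y - x) \<partial>\<mu>) \<partial>lborel)
        = (\<integral>\<^sup>+y. (\<integral>\<^sup>+x. f y * gauss_density (1 / real (Suc k)) (y - x) \<partial>\<mu>) \<partial>lborel)"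
      using f(2) by (simp add: nn_integral_cmult ennreal_mult)
    also have "\<dots> = (\<integral>\<^sup>+x. (\<integral>\<^sup>+y. f y * gauss_density (1 / real (Suc k)) (y - x) \<partial>lborel) \<partial>\<mu>)"
      by (rule L.Fubini') measurable
    also have "\<dots> = (\<integral>\<^sup>+x. (\<integral>\<^sup>+z. f (x + s k *\<^sub>R z) \<partial>gauss 1) \<partial>\<mu>)"
      using f(2) by (simp add: ennreal_mult nn_integral_gauss_translate s_def del: of_nat_Suc)
    also have "\<dots> = (\<integral>\<^sup>+p. f (fst p + s k *\<^sub>R snd p) \<partial>(\<mu> \<Otimes>\<^sub>M gauss 1))"
      by (subst \<Gamma>.nn_integral_fst[symmetric]) auto
    finally show ?thesis .
  qed
  have "(\<lambda>k. \<integral>\<^sup>+p. f (fst p + s k *\<^sub>R snd p) \<partial>(\<mu> \<Otimes>\<^sub>M gauss 1)) \<longlonglongrightarrow> (\<integral>\<^sup>+p. f (fst p) \<partial>(\<mu> \<Otimes>\<^sub>M (gauss 1 :: 'e measure)))"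
  proof (rule nn_integral_dominated_convergence[where w="\<lambda>_. 1"
        and u="\<lambda>k p. ennreal (f (fst p + s k *\<^sub>R snd p))" and u'="\<lambda>p. ennreal (f (fst p))"])
    have "(\<lambda>k. 1 / real (Suc k)) \<longlonglongrightarrow> 0" using LIMSEQ_inverse_real_of_nat by (simp add: inverse_eq_divide)
    then have s: "s \<longlonglongrightarrow> 0" unfolding s_def using tendsto_real_sqrt by fastforce
    show "AE p in \<mu> \<Otimes>\<^sub>M gauss 1. (\<lambda>k. ennreal (f (fst p + s k *\<^sub>R snd p))) \<longlonglongrightarrow> ennreal (f (fst p))"
    proof (intro AE_I2 tendsto_ennrealI)
      fix p :: "'e \<times> 'e"
      have "(\<lambda>k. fst p + s k *\<^sub>R snd p) \<longlonglongrightarrow> fst p + 0 *\<^sub>R snd p"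
        by (intro tendsto_intros s)
      then show "(\<lambda>k. f (fst p + s k *\<^sub>R snd p)) \<longlonglongrightarrow> f (fst p)"
        using continuous_on_tendsto_compose[OF f(1)] by simp
    qed
  qed (use f in \<open>auto simp: P.emeasure_space_1\<close>)
  also have "(\<integral>\<^sup>+p. f (fst p) \<partial>(\<mu> \<Otimes>\<^sub>M (gauss 1 :: 'e measure))) = (\<integral>\<^sup>+x. f x \<partial>\<mu>)"
    using \<Gamma>.emeasure_space_1 by (subst \<Gamma>.nn_integral_fst[symmetric]) auto
  finally show ?thesis unfolding eq .
qed

text \<open>Equal characteristic functions give equal Gaussian smoothings for every variance.
  Letting the variance tend to 0 gives equal integrals of continuous functions with values in
  [0, 1]; these approximate indicators of open sets, which generate the Borel sets.\<close>

theorem measure_eqI_char: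
  fixes \<mu> \<nu> :: "'e::euclidean_space measure"
  assumes \<mu>: "prob_space \<mu>" "sets \<mu> = sets borel" and \<nu>: "prob_space \<nu>" "sets \<nu> = sets borel"
    and char: "\<And>t. (\<integral>x. iexp (t \<bullet> x) \<partial>\<mu>) = (\<integral>x. iexp (t \<bullet> x) \<partial>\<nu>)"
  shows "\<mu> = \<nu>"
proof -
  have conv: "(\<integral>\<^sup>+x. gauss_density v (y - x) \<partial>\<mu>) = (\<integral>\<^sup>+x. gauss_density v (y - x) \<partial>\<nu>)"
    if v: "v > 0" for v y
  proof -
    have *: "(\<integral>\<^sup>+x. gauss_density v (y - x) \<partial>\<rho>)
        = ennreal ((2 * pi * v) powr (- real DIM('e) / 2) * (\<integral>x. exp (- (norm (x - y))\<^sup>2 / (2 * v)) \<partial>\<rho>))"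
      if "prob_space \<rho>" and [measurable_cong]: "sets \<rho> = sets borel" for \<rho> :: "'e measure"
    proof -
      interpret prob_space \<rho> by fact
      have int: "integrable \<rho> (\<lambda>x. exp (- (norm (x - y))\<^sup>2 / (2 * v)))"
        by (rule integrable_const_bound[where B=1]) (use v in auto)
      have "(\<integral>\<^sup>+x. gauss_density v (y - x) \<partial>\<rho>)
          = (\<integral>\<^sup>+x. ennreal ((2 * pi * v) powr (- real DIM('e) / 2) * exp (- (norm (x - y))\<^sup>2 / (2 * v))) \<partial>\<rho>)"
        using v by (simp add: gauss_density_eq norm_minus_commute)
      also have "\<dots> = ennreal (\<integral>x. (2 * pi * v) powr (- real DIM('e) / 2) * exp (- (norm (x - y))\<^sup>2 / (2 * v)) \<partial>\<rho>)"
        by (rule nn_integral_eq_integral) (use int in auto)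
      finally show ?thesis by simp
    qed
    have "(\<integral>x. exp (- (norm (x - y))\<^sup>2 / (2 * v)) \<partial>\<mu>) = (\<integral>x. exp (- (norm (x - y))\<^sup>2 / (2 * v)) \<partial>\<nu>)"
      using gauss_transform_eq_char_integral[OF \<mu> v, of y] gauss_transform_eq_char_integral[OF \<nu> v, of y]
      unfolding char by (simp flip: of_real_eq_iff[where 'a=complex])
    then show ?thesis by (simp add: *[OF \<mu>] *[OF \<nu>])
  qed
  have cont: "(\<integral>\<^sup>+x. f x \<partial>\<mu>) = (\<integral>\<^sup>+x. f x \<partial>\<nu>)"
    if f: "continuous_on UNIV f" "\<And>x. 0 \<le> f x" "\<And>x. f x \<le> 1" for f :: "'e \<Rightarrow> real"
    using gauss_smoothing_tendsto[OF \<mu> f] gauss_smoothing_tendsto[OF \<nu> f]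
    by (simp add: conv del: of_nat_Suc) (rule LIMSEQ_unique)
  have op: "emeasure \<mu> U = emeasure \<nu> U" if U: "open U" for U
  \<comment> \<open>The whole space is split off because \<open>infdist\<close> to an empty
    complement is 0 by convention, which would make all the approximating functions
    \<open>f k\<close> vanish.\<close>
  proof (cases "U = UNIV")
    case True
    then show ?thesis
      using prob_space.emeasure_space_1[OF \<mu>(1)] prob_space.emeasure_space_1[OF \<nu>(1)]
        sets_eq_imp_space_eq[OF \<mu>(2)] sets_eq_imp_space_eq[OF \<nu>(2)] by simp
  next
    case False
    define f where "f k x = min 1 (real k * infdist x (- U))" for k x
    have c: "continuous_on UNIV (f k)" for k
      unfolding f_def by (intro continuous_intros)
    have fb: "0 \<le> f k x" "f k x \<le> 1" for k x
      by (auto simp: f_def infdist_nonneg)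
    have *: "(\<lambda>k. \<integral>\<^sup>+x. f k x \<partial>\<rho>) \<longlonglongrightarrow> emeasure \<rho> U"
      if "prob_space \<rho>" and [measurable_cong]: "sets \<rho> = sets borel" for \<rho> :: "'e measure"
    proof -
      interpret prob_space \<rho> by fact
      have [measurable]: "f k \<in> borel_measurable borel" for k
        using c by (rule borel_measurable_continuous_onI)
      have [measurable]: "U \<in> sets borel" using U by simp
      have "(\<lambda>k. \<integral>\<^sup>+x. f k x \<partial>\<rho>) \<longlonglongrightarrow> (\<integral>\<^sup>+x. indicator U x \<partial>\<rho>)"
      proof (rule nn_integral_dominated_convergence[where w="\<lambda>_. 1"])
        show "AE x in \<rho>. (\<lambda>k. ennreal (f k x)) \<longlonglongrightarrow> indicator U x"
        proof (intro AE_I2)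
          fix x :: 'e
          have cl: "closed (- U)" "- U \<noteq> {}" using U False by auto
          show "(\<lambda>k. ennreal (f k x)) \<longlonglongrightarrow> indicator U x"
          proof (cases "x \<in> U")
            case True
            then have pos: "infdist x (- U) > 0"
              using in_closed_iff_infdist_zero[OF cl, of x] infdist_nonneg[of x "- U"] by fastforce
            obtain K :: nat where K: "real K > 1 / infdist x (- U)"
              using reals_Archimedean2 by blast
            have "eventually (\<lambda>k. f k x = 1) sequentially"
              using eventually_ge_at_top[of K]
            proof eventually_elim
              case (elim k)
              have "real k > 1 / infdist x (- U)" using K elim by linarith
              then show ?case using pos by (simp add: f_def field_simps)
            qed
            then have "eventually (\<lambda>k. ennreal (f k x) = 1) sequentially"
              by eventually_elim simp
            then show ?thesis using True by (simp add: tendsto_eventually)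
          next
            case False
            then have "infdist x (- U) = 0" using in_closed_iff_infdist_zero[OF cl, of x] by simp
            then show ?thesis using False by (simp add: f_def)
          qed
        qed
      qed (use fb in \<open>auto simp: emeasure_space_1\<close>)
      then show ?thesis using that by simp
    qed
    have "(\<integral>\<^sup>+x. f k x \<partial>\<mu>) = (\<integral>\<^sup>+x. f k x \<partial>\<nu>)" for k
      by (rule cont[OF c fb])
    then show ?thesis
      using *[OF \<mu>] *[OF \<nu>] by (auto intro: LIMSEQ_unique)
  qed
  interpret \<mu>: prob_space \<mu> by fact
  show ?thesis
  proof (rule measure_eqI_generator_eq[where E="{U. open U}" and \<Omega>=UNIV and A="\<lambda>_. UNIV"])
    show "Int_stable {U::'e set. open U}" by (auto simp: Int_stable_def)
    show "sets \<mu> = sigma_sets UNIV {U. open U}" "sets \<nu> = sigma_sets UNIV {U. open U}"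
      using \<mu> \<nu> by (simp_all add: borel_def)
  qed (use op[symmetric] \<mu>.emeasure_finite in auto)
qed

section \<open>Correlated Gaussian pairs\<close>

text \<open>Regression form of the pair with coordinatewise variance a and correlation r. Given the
  first entry x, the second has an explicit density centred at \<open>r *\<^sub>R x\<close>, so no
  covariance matrix has to be inverted.\<close>

definition gauss_pair :: "real \<Rightarrow> real \<Rightarrow> ('e::euclidean_space \<times> 'e) measure" where
  "gauss_pair a r = distr (gauss a \<Otimes>\<^sub>M gauss (a * (1 - r\<^sup>2))) borel (\<lambda>(x, z). (x, r *\<^sub>R x + z))"

lemma
  assumes "a > 0" "\<bar>r\<bar> < 1"
  shows prob_space_gauss_pair: "prob_space (gauss_pair a r :: ('e::euclidean_space \<times> 'e) measure)"
    and char_gauss_pair: "(\<integral>p. iexp ((t, u) \<bullet> p) \<partial>(gauss_pair a r :: ('e \<times> 'e) measure))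
      = exp (- (a * ((norm t)\<^sup>2 + (norm u)\<^sup>2) + 2 * (a * r) * (t \<bullet> u)) / 2)"
proof -
  have r: "r\<^sup>2 < 1" using assms(2) by (simp add: abs_square_less_1)
  define v where "v = a * (1 - r\<^sup>2)"
  have v: "v > 0" unfolding v_def using assms r by auto
  interpret A: prob_space "gauss a :: 'e measure" by (rule prob_space_gauss) fact
  interpret V: prob_space "gauss v :: 'e measure" by (rule prob_space_gauss) fact
  interpret pair_prob_space "gauss a :: 'e measure" "gauss v :: 'e measure" ..
  have [measurable]: "(\<lambda>(x, z). (x, r *\<^sub>R x + z)) \<in> (gauss a \<Otimes>\<^sub>M gauss v) \<rightarrow>\<^sub>M (borel :: ('e \<times> 'e) measure)"
    by (simp add: borel_prod[symmetric] split_beta')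
  show "prob_space (gauss_pair a r :: ('e \<times> 'e) measure)"
    unfolding gauss_pair_def v_def[symmetric] by (rule P.prob_space_distr) measurable
  have "(\<integral>p. iexp ((t, u) \<bullet> p) \<partial>(gauss_pair a r :: ('e \<times> 'e) measure))
      = (\<integral>(x, z). iexp ((t + r *\<^sub>R u) \<bullet> x) * iexp (u \<bullet> z) \<partial>(gauss a \<Otimes>\<^sub>M gauss v))"
    unfolding gauss_pair_def v_def[symmetric]
    by (subst integral_distr)
      (auto intro!: Bochner_Integration.integral_cong
        simp: inner_add_left inner_add_right exp_add algebra_simps split_beta')
  also have "\<dots> = (\<integral>z. (\<integral>x. iexp ((t + r *\<^sub>R u) \<bullet> x) * iexp (u \<bullet> z) \<partial>gauss a) \<partial>gauss v)"
    by (subst integral_snd[symmetric])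
      (auto intro!: P.integrable_const_bound[where B=1] simp: split_beta' norm_mult)
  also have "\<dots> = exp (- a * (norm (t + r *\<^sub>R u))\<^sup>2 / 2) * exp (- v * (norm u)\<^sup>2 / 2)"
    using assms v by (simp add: char_gauss)
  also have "\<dots> = exp (- (a * ((norm t)\<^sup>2 + (norm u)\<^sup>2) + 2 * (a * r) * (t \<bullet> u)) / 2)"
    unfolding v_def of_real_mult[symmetric] exp_add[symmetric] power2_norm_eq_inner
    by (intro arg_cong[where f=of_real] arg_cong[where f=exp])
      (simp add: inner_add_left inner_add_right inner_commute field_simps power2_eq_square)
  finally show "(\<integral>p. iexp ((t, u) \<bullet> p) \<partial>(gauss_pair a r :: ('e \<times> 'e) measure))
      = exp (- (a * ((norm t)\<^sup>2 + (norm u)\<^sup>2) + 2 * (a * r) * (t \<bullet> u)) / 2)" .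
qed

text \<open>On the ball of radius \<open>R\<close>, bounds the ratio of the density of \<^const>\<open>gauss_pair\<close> to the product
  density.\<close>

definition corr_factor :: "nat \<Rightarrow> real \<Rightarrow> real \<Rightarrow> real \<Rightarrow> real" where
  "corr_factor d R a r = (1 - r\<^sup>2) powr (- real d / 2) * exp (\<bar>r\<bar> * R\<^sup>2 / (a * (1 - r\<^sup>2)))"

text \<open>Compare exponents: passing from variance a (1 - r^2) to a costs the power of 1 - r^2 in
  the normalisation, and the shift by \<open>r *\<^sub>R x\<close> costs the exponential of the
  cross term, which is bounded on a ball.\<close>

lemma gauss_density_shift_le:
  fixes x y :: "'e::euclidean_space"
  assumes a: "a > 0" and r: "\<bar>r\<bar> < 1" and xy: "norm x \<le> R" "norm y \<le> R"
  shows "gauss_density (a * (1 - r\<^sup>2)) (y - r *\<^sub>R x) \<le> corr_factor DIM('e) R a r * gauss_density a y"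
proof -
  have r2: "r\<^sup>2 < 1" using r by (simp add: abs_square_less_1)
  define w where "w = 1 - r\<^sup>2"
  have w: "w > 0" unfolding w_def using r2 by auto
  have "\<bar>x \<bullet> y\<bar> \<le> R * R"
    using Cauchy_Schwarz_ineq2[of x y] mult_mono'[OF xy] by (auto intro: order_trans)
  then have "\<bar>r * (x \<bullet> y)\<bar> \<le> \<bar>r\<bar> * R\<^sup>2"
    unfolding abs_mult power2_eq_square by (intro mult_left_mono) auto
  \<comment> \<open>Only the cross term 2 r (x \<bullet> y) is estimated; the terms r^2 |x|^2 and
    r^2 |y|^2 both have the favourable sign.\<close>
  then have "w * (norm y)\<^sup>2 \<le> (norm (y - r *\<^sub>R x))\<^sup>2 + 2 * \<bar>r\<bar> * R\<^sup>2"
    unfolding w_def power2_norm_eq_inner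
    using mult_nonneg_nonneg[of "r\<^sup>2" "x \<bullet> x"] mult_nonneg_nonneg[of "r\<^sup>2" "y \<bullet> y"]
    by (simp add: inner_diff_left inner_diff_right inner_commute algebra_simps power2_eq_square abs_le_iff)
  then have "- (norm (y - r *\<^sub>R x))\<^sup>2 / (2 * (a * w)) \<le> \<bar>r\<bar> * R\<^sup>2 / (a * w) + - (norm y)\<^sup>2 / (2 * a)"
    using a w by (simp add: field_simps)
  then have "exp (- (norm (y - r *\<^sub>R x))\<^sup>2 / (2 * (a * w))) \<le> exp (\<bar>r\<bar> * R\<^sup>2 / (a * w)) * exp (- (norm y)\<^sup>2 / (2 * a))"
    by (simp flip: exp_add)
  moreover have "(2 * pi * (a * w)) powr (- real DIM('e) / 2) = w powr (- real DIM('e) / 2) * (2 * pi * a) powr (- real DIM('e) / 2)"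
    using a w by (subst powr_mult[symmetric]) (auto simp: ac_simps)
  ultimately show ?thesis
    using a w unfolding corr_factor_def w_def[symmetric]
    by (simp add: gauss_density_eq mult_left_mono ac_simps)
qed

text \<open>Condition on the first entry: for every x in B the conditional probability of B is at
  most the same factor times the unconditional one. An upper bound is all that a variance estimate
  asks for.\<close>

lemma emeasure_gauss_pair_le:
  fixes B :: "'e::euclidean_space set"
  assumes a: "a > 0" and r: "\<bar>r\<bar> < 1" and [measurable]: "B \<in> sets borel"
    and R: "\<And>x. x \<in> B \<Longrightarrow> norm x \<le> R"
  shows "emeasure (gauss_pair a r) (B \<times> B) \<le> ennreal (corr_factor DIM('e) R a r) * (emeasure (gauss a) B)\<^sup>2"
proof -
  have r2: "r\<^sup>2 < 1" using r by (simp add: abs_square_less_1)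
  define v where "v = a * (1 - r\<^sup>2)"
  have v: "v > 0" unfolding v_def using a r2 by auto
  interpret A: prob_space "gauss a :: 'e measure" by (rule prob_space_gauss) fact
  interpret V: prob_space "gauss v :: 'e measure" by (rule prob_space_gauss) fact
  have [measurable]: "(\<lambda>(x, z). (x, r *\<^sub>R x + z)) \<in> (gauss a \<Otimes>\<^sub>M gauss v) \<rightarrow>\<^sub>M (borel :: ('e \<times> 'e) measure)"
    by (simp add: borel_prod[symmetric] split_beta')
  have BB [measurable]: "B \<times> B \<in> sets borel" by (simp add: borel_prod[symmetric])
  have "emeasure (gauss_pair a r) (B \<times> B)
      = (\<integral>\<^sup>+p. indicator (B \<times> B) p \<partial>gauss_pair a r)"
    by (simp add: gauss_pair_def BB)
  also have "\<dots> = (\<integral>\<^sup>+p. indicator B (fst p) * indicator B (r *\<^sub>R fst p + snd p) \<partial>(gauss a \<Otimes>\<^sub>M gauss v))"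
    unfolding gauss_pair_def v_def[symmetric]
    by (subst nn_integral_distr) (auto intro!: nn_integral_cong simp: indicator_def)
  also have "\<dots> = (\<integral>\<^sup>+x. indicator B x * (\<integral>\<^sup>+z. indicator B (r *\<^sub>R x + z) \<partial>gauss v) \<partial>gauss a)"
    by (subst V.nn_integral_fst[symmetric]) (auto simp: nn_integral_cmult)
  also have "\<dots> \<le> (\<integral>\<^sup>+x. indicator B x * (ennreal (corr_factor DIM('e) R a r) * emeasure (gauss a) B) \<partial>gauss a)"
  proof (intro nn_integral_mono)
    fix x :: 'e
    show "indicator B x * (\<integral>\<^sup>+z. indicator B (r *\<^sub>R x + z) \<partial>gauss v)
       \<le> indicator B x * (ennreal (corr_factor DIM('e) R a r) * emeasure (gauss a) B)"
    proof (cases "x \<in> B")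
      case True
      have "(\<integral>\<^sup>+z. indicator B (r *\<^sub>R x + z) \<partial>gauss v) = (\<integral>\<^sup>+z. ennreal (gauss_density v z) * indicator B (r *\<^sub>R x + z) \<partial>lborel)"
        by (subst nn_integral_density) auto
      also have "\<dots> = (\<integral>\<^sup>+y. ennreal (gauss_density v (y - r *\<^sub>R x)) * indicator B y \<partial>lborel)"
        by (subst (2) lborel_affine[of 1 "r *\<^sub>R x"]) (simp_all add: nn_integral_density nn_integral_distr)
      also have "\<dots> \<le> (\<integral>\<^sup>+y. ennreal (corr_factor DIM('e) R a r) * (ennreal (gauss_density a y) * indicator B y) \<partial>lborel)"
      proof (intro nn_integral_mono)
        fix y :: 'e
        show "ennreal (gauss_density v (y - r *\<^sub>R x)) * indicator B y
            \<le> ennreal (corr_factor DIM('e) R a r) * (ennreal (gauss_density a y) * indicator B y)"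
        proof (cases "y \<in> B")
          case True
          then show ?thesis
            using gauss_density_shift_le[OF a r R[OF \<open>x \<in> B\<close>] R[OF True]] unfolding v_def
            by (simp add: ennreal_mult''[symmetric] ennreal_leI)
        qed simp
      qed
      also have "\<dots> = ennreal (corr_factor DIM('e) R a r) * emeasure (gauss a) B"
        by (simp add: nn_integral_cmult emeasure_density)
      finally show ?thesis by (rule mult_left_mono) simp
    qed simp
  qed
  also have "\<dots> = ennreal (corr_factor DIM('e) R a r) * (emeasure (gauss a) B)\<^sup>2"
    by (simp add: nn_integral_multc power2_eq_square ac_simps)
  finally show ?thesis .
qed

section \<open>Size of the correlation factor\<close>

lemma exp_minus_1_le: "exp x - 1 \<le> x * exp (x::real)"
proof -
  have "(1 - x) * exp x \<le> exp (-x) * exp x"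
    using exp_ge_add_one_self[of "-x"] by (intro mult_right_mono) auto
  then show ?thesis by (simp add: algebra_simps flip: exp_add)
qed

text \<open>The threshold 3/4 keeps 1 - r^2 above 1/4, so 1 / (1 - r^2) may be replaced by 4. With w
  = 1 - r^2 one has - ln w <= 1 / w - 1 = r^2 / w <= 4 r^2, and half the dimension times this is the
  term 2 d r^2.\<close>

lemma corr_factor_le:
  assumes "a > 0" "r\<^sup>2 \<le> 3/4"
  shows "corr_factor d R a r \<le> exp (2 * real d * r\<^sup>2 + 4 * \<bar>r\<bar> * R\<^sup>2 / a)"
proof -
  define w where "w = 1 - r\<^sup>2"
  have w: "w \<ge> 1/4" unfolding w_def using assms by auto
  have "- ln w \<le> 1 / w - 1"
    using ln_le_minus_one[of "1 / w"] w by (simp add: ln_div)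
  also have "\<dots> \<le> 4 * r\<^sup>2"
  proof -
    have "1 / w - 1 = r\<^sup>2 * (1 / w)" using w by (simp add: w_def field_simps)
    also have "\<dots> \<le> r\<^sup>2 * 4" using w by (intro mult_left_mono) (auto simp: field_simps)
    finally show ?thesis by simp
  qed
  finally have 1: "w powr (- real d / 2) \<le> exp (2 * real d * r\<^sup>2)"
    using w mult_left_mono[of "- ln w" "4 * r\<^sup>2" "real d / 2"] by (simp add: powr_def)
  have "1 / w \<le> 4" using w by (simp add: field_simps)
  then have "\<bar>r\<bar> * R\<^sup>2 / a * (1 / w) \<le> \<bar>r\<bar> * R\<^sup>2 / a * 4"
    using assms by (intro mult_left_mono) auto
  then have 2: "exp (\<bar>r\<bar> * R\<^sup>2 / (a * w)) \<le> exp (4 * \<bar>r\<bar> * R\<^sup>2 / a)"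
    by (simp add: ac_simps)
  show ?thesis
    unfolding corr_factor_def w_def[symmetric] exp_add by (intro mult_mono 1 2) auto
qed

text \<open>Here r = O(s / n). The square of r is O(s^2 / n^2), and the term linear in r carries a
  factor 1 / a, hence is O(s / n^2), which s >= 1 absorbs into s^2 / n^2. The bound on n keeps
  \<delta> below n / 8, and 2 s <= n keeps r away from 1. In A, the first summand is 2 d times the
  constant 4 (1 + C)^2 for r^2; the second is 4 R^2 times 2 (1 + C) for r and 2 for n / a.\<close>

lemma corr_factor_asymptotics:
  fixes R C :: real and d :: nat
  assumes C: "C \<ge> 0"
  defines "A \<equiv> 8 * real d * (1 + C)\<^sup>2 + 16 * (1 + C) * R\<^sup>2"
  assumes n: "real n \<ge> 8 * (C + 1)" and s: "1 \<le> s" "2 * s \<le> n" and \<delta>: "\<bar>\<delta>\<bar> \<le> C"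
  shows "\<bar>real s + \<delta>\<bar> < real n + \<delta>"
    and "corr_factor d R (real n + \<delta>) ((real s + \<delta>) / (real n + \<delta>)) \<le> 1 + A * exp A * (real s)\<^sup>2 / (real n)\<^sup>2"
proof -
  define a where "a = real n + \<delta>"
  define r where "r = (real s + \<delta>) / a"
  have n8: "8 * C + 8 \<le> real n" using n by (simp add: algebra_simps)
  then have n0: "real n > 0" using C by linarith
  have s': "2 * real s \<le> real n" using s by linarith
  have a: "a \<ge> 7/8 * real n" unfolding a_def using n8 \<delta> by linarith
  have a0: "a > 0" using a n0 by linarith
  have sd: "\<bar>real s + \<delta>\<bar> \<le> 5/8 * real n" using n8 \<delta> s' by linarith
  show "\<bar>real s + \<delta>\<bar> < real n + \<delta>" using sd a n0 unfolding a_def by linarith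
  \<comment> \<open>The quotient of 5/8 and 7/8; its square 25/49 stays below the threshold
    3/4.\<close>
  have "\<bar>real s + \<delta>\<bar> \<le> 5/7 * a" using sd a by linarith
  then have r1: "\<bar>r\<bar> \<le> 5/7" using a0 unfolding r_def abs_divide by (simp add: field_simps)
  have r2: "r\<^sup>2 \<le> 3/4"
    using power_mono[OF r1, of 2] by (simp add: power2_eq_square)
  have s1: "\<bar>real s + \<delta>\<bar> \<le> (1 + C) * real s"
  proof -
    have "C * 1 \<le> C * real s" using s C by (intro mult_left_mono) auto
    then show ?thesis using \<delta> s by (simp add: algebra_simps)
  qed
  have r3: "\<bar>r\<bar> \<le> 2 * (1 + C) * (real s / real n)"
  proof -
    have "\<bar>r\<bar> = \<bar>real s + \<delta>\<bar> / a" using a0 by (simp add: r_def)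
    also have "\<dots> \<le> ((1 + C) * real s) / (real n / 2)"
      using s1 a n0 C by (intro frac_le) auto
    finally show ?thesis by (simp add: field_simps)
  qed
  have r4: "r\<^sup>2 \<le> 4 * (1 + C)\<^sup>2 * ((real s)\<^sup>2 / (real n)\<^sup>2)"
    using power_mono[OF r3, of 2] by (simp only: power_mult_distrib power_divide abs_ge_zero power2_abs) simp
  have "4 * \<bar>r\<bar> * R\<^sup>2 / a \<le> (4 * (2 * (1 + C) * (real s / real n)) * R\<^sup>2) / (real n / 2)"
    using r3 a n0 C by (intro frac_le mult_mono) auto
  also have "\<dots> = 16 * (1 + C) * R\<^sup>2 * (real s / (real n)\<^sup>2)"
    by (simp add: power2_eq_square)
  also have "\<dots> \<le> 16 * (1 + C) * R\<^sup>2 * ((real s)\<^sup>2 / (real n)\<^sup>2)"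
    using s C by (intro mult_left_mono divide_right_mono self_le_power) auto
  finally have E: "2 * real d * r\<^sup>2 + 4 * \<bar>r\<bar> * R\<^sup>2 / a \<le> A * ((real s)\<^sup>2 / (real n)\<^sup>2)"
    using mult_left_mono[OF r4, of "2 * real d"] by (simp add: A_def algebra_simps)
  have A: "A \<ge> 0" unfolding A_def using C by auto
  have sn: "(real s)\<^sup>2 / (real n)\<^sup>2 \<le> 1"
    using n0 s' by (simp add: power_mono)
  have "corr_factor d R a r \<le> exp (A * ((real s)\<^sup>2 / (real n)\<^sup>2))"
    using corr_factor_le[OF a0 r2, of d R] E by (auto intro: order_trans)
  \<comment> \<open>Linearise by exp x <= 1 + x exp x. Since s <= n, the argument is at most A, so
    the remaining exponential is at most exp A.\<close>
  also have "\<dots> \<le> 1 + A * ((real s)\<^sup>2 / (real n)\<^sup>2) * exp (A * ((real s)\<^sup>2 / (real n)\<^sup>2))"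
    using exp_minus_1_le[of "A * ((real s)\<^sup>2 / (real n)\<^sup>2)"] by linarith
  also have "\<dots> \<le> 1 + A * ((real s)\<^sup>2 / (real n)\<^sup>2) * exp A"
    using A sn mult_left_mono[OF sn A] by (intro add_left_mono mult_left_mono) auto
  finally show "corr_factor d R (real n + \<delta>) ((real s + \<delta>) / (real n + \<delta>)) \<le> 1 + A * exp A * (real s)\<^sup>2 / (real n)\<^sup>2"
    by (simp add: a_def r_def ac_simps)
qed

section \<open>Genealogies\<close>

text \<open>\<open>g m\<close> sends a label of generation m + 1 to that of its parent, and
  \<open>anc g n i m\<close> traces particle i of generation n back to generation m. It is meant for
  m <= n; larger m fall through to generation 0.\<close>

fun anc :: "(nat \<Rightarrow> nat \<Rightarrow> nat) \<Rightarrow> nat \<Rightarrow> nat \<Rightarrow> nat \<Rightarrow> nat" where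
  "anc g 0 i m = i"
| "anc g (Suc n) i m = (if m = Suc n then i else anc g n (g n i) m)"

definition genealogy :: "nat \<Rightarrow> (nat \<Rightarrow> nat \<Rightarrow> nat) \<Rightarrow> bool" where
  "genealogy n g \<longleftrightarrow> (\<forall>m<n. (\<forall>i\<in>{1..2 ^ Suc m}. g m i \<in> {1..2 ^ m}) \<and>
     (\<forall>j\<in>{1..2 ^ m}. card {i \<in> {1..2 ^ Suc m}. g m i = j} = 2))"

lemma genealogyD:
  assumes "genealogy n g" "m < n"
  shows "i \<in> {1..2 ^ Suc m} \<Longrightarrow> g m i \<in> {1..2 ^ m}"
    and "j \<in> {1..2 ^ m} \<Longrightarrow> card {i \<in> {1..2 ^ Suc m}. g m i = j} = 2"
  using assms unfolding genealogy_def by blast+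

lemma genealogy_le: "genealogy n g \<Longrightarrow> m \<le> n \<Longrightarrow> genealogy m g"
  unfolding genealogy_def by (meson less_le_trans)

lemma anc_self [simp]: "anc g n i n = i"
  by (cases n) auto

lemma anc_in:
  assumes "genealogy n g" "i \<in> {1..2 ^ n}" "m \<le> n"
  shows "anc g n i m \<in> {1..2 ^ m}"
  using assms
proof (induction n arbitrary: i)
  case (Suc n)
  have "g n i \<in> {1..2 ^ n}" using genealogyD(1)[OF Suc.prems(1), of n i] Suc.prems(2) by auto
  moreover have "genealogy n g" using Suc.prems(1) by (rule genealogy_le) simp
  ultimately show ?case using Suc.IH[of "g n i"] Suc.prems by (cases "m = Suc n") auto
qed simp

lemma anc_coalesced:
  assumes "anc g n i m = anc g n j m" "k \<le> m" "m \<le> n"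
  shows "anc g n i k = anc g n j k"
  using assms
proof (induction n arbitrary: i j)
  case (Suc n)
  show ?case
  proof (cases "m = Suc n")
    case False
    then have "m \<le> n" using Suc.prems(3) by simp
    then show ?thesis using False Suc.IH[of "g n i" "g n j"] Suc.prems by auto
  qed (use Suc.prems in auto)
qed simp

text \<open>Group the offspring by parent; every group has two members. Vector values are allowed
  because the lemma serves both to count descendants and to show that branching preserves the centre
  of mass.\<close>

lemma sum_offspring:
  fixes f :: "nat \<Rightarrow> 'v::real_vector"
  assumes "genealogy n g" "m < n"
  shows "(\<Sum>i=1..2 ^ Suc m. f (g m i)) = 2 *\<^sub>R (\<Sum>j=1..2 ^ m. f j)"
proof -
  have "(\<Sum>i=1..2 ^ Suc m. f (g m i)) = (\<Sum>j=1..2 ^ m. \<Sum>i | i \<in> {1..2 ^ Suc m} \<and> g m i = j. f (g m i))"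
    by (rule sum.group[symmetric]) (use genealogyD(1)[OF assms] in auto)
  also have "\<dots> = (\<Sum>j=1..2 ^ m. \<Sum>i | i \<in> {1..2 ^ Suc m} \<and> g m i = j. f j)"
    by (intro sum.cong) auto
  also have "\<dots> = (\<Sum>j=1..2 ^ m. 2 *\<^sub>R f j)"
    using genealogyD(2)[OF assms] by (intro sum.cong refl) (simp add: sum_constant_scaleR)
  finally show ?thesis by (simp add: scaleR_sum_right)
qed

lemma card_anc:
  assumes "genealogy n g" "m \<le> n" "c \<in> {1..2 ^ m}"
  shows "card {i \<in> {1..2 ^ n}. anc g n i m = c} = 2 ^ (n - m)"
  using assms
proof (induction n)
  case 0
  then have "{i \<in> {1..2 ^ 0}. anc g 0 i m = c} = {c}" by auto
  then show ?case by simp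
next
  case (Suc n)
  show ?case
  proof (cases "m = Suc n")
    case True
    then have "{i \<in> {1..2 ^ Suc n}. anc g (Suc n) i m = c} = {c}" using Suc.prems by auto
    then show ?thesis using True by simp
  next
    case False
    then have m: "m \<le> n" using Suc.prems by auto
    have gen: "genealogy n g" using Suc.prems(1) by (rule genealogy_le) simp
    have "real (card {i \<in> {1..2 ^ Suc n}. anc g (Suc n) i m = c})
        = (\<Sum>i=1..2 ^ Suc n. of_bool (anc g n (g n i) m = c))"
      using False by (simp add: sum_of_bool_eq Int_def conj_commute)
    also have "\<dots> = 2 * (\<Sum>j=1..2 ^ n. of_bool (anc g n j m = c))"
      using sum_offspring[OF Suc.prems(1), of n "\<lambda>j. of_bool (anc g n j m = c) :: real"] by simp
    also have "\<dots> = 2 * real (card {i \<in> {1..2 ^ n}. anc g n i m = c})"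
      by (simp add: sum_of_bool_eq Int_def conj_commute)
    also have "\<dots> = real (2 ^ (Suc n - m))"
      using Suc.IH[OF gen m Suc.prems(3)] m by (simp add: Suc_diff_le)
    finally show ?thesis by (simp only: of_nat_eq_iff)
  qed
qed

text \<open>A count of common generations rather than a coalescence time, since it enters the
  covariance as a sum of indicators over m. Generation n itself is excluded: the motions on [n, n+1)
  have not yet acted at time n.\<close>

definition share :: "(nat \<Rightarrow> nat \<Rightarrow> nat) \<Rightarrow> nat \<Rightarrow> nat \<Rightarrow> nat \<Rightarrow> nat" where
  "share g n i j = card {m. m < n \<and> anc g n i m = anc g n j m}"

text \<open>Generation 0 has the single label 1, so all ancestral lines meet there.\<close>

lemma share_pos:
  assumes "genealogy n g" "i \<in> {1..2 ^ n}" "j \<in> {1..2 ^ n}" "n > 0"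
  shows "share g n i j \<ge> 1"
proof -
  have "anc g n i 0 = anc g n j 0" using anc_in[OF assms(1,2), of 0] anc_in[OF assms(1,3), of 0] by auto
  then have "{m. m < n \<and> anc g n i m = anc g n j m} \<noteq> {}" using assms by auto
  then show ?thesis unfolding share_def by (simp add: Suc_le_eq card_gt_0_iff)
qed

text \<open>k + 1 common generations cannot all lie below k, and lines that agree in some generation
  from k on have coalesced by generation k.\<close>

lemma share_SucD:
  assumes "share g n i j = Suc k"
  shows "k < n" "anc g n i k = anc g n j k"
proof -
  let ?S = "{m. m < n \<and> anc g n i m = anc g n j m}"
  have "\<exists>m\<in>?S. k \<le> m"
  proof (rule ccontr)
    assume "\<not> ?thesis"
    then have "?S \<subseteq> {..<k}" by auto
    from card_mono[OF _ this] show False using assms unfolding share_def by simp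
  qed
  then show "k < n" "anc g n i k = anc g n j k" using anc_coalesced[of g n i _ j k] by auto
qed

text \<open>A pair with share k + 1 has a common ancestor in generation k. Weakening the former
  property to the latter makes the count exact: 2^n choices of i and 2^(n-k) of j. The off-by-one
  explains why f (k + 1) is weighted by 2^(-k).\<close>

lemma sum_share_le:
  fixes f :: "nat \<Rightarrow> real"
  assumes g: "genealogy n g" and n: "n > 0" and f: "\<And>s. 0 \<le> f s"
  shows "(\<Sum>i=1..2 ^ n. \<Sum>j=1..2 ^ n. f (share g n i j)) \<le> 4 ^ n * (\<Sum>k<n. f (Suc k) / 2 ^ k)"
proof -
  let ?L = "{1..2 ^ n :: nat}"
  have "(\<Sum>i\<in>?L. \<Sum>j\<in>?L. f (share g n i j)) \<le> (\<Sum>i\<in>?L. \<Sum>j\<in>?L. \<Sum>k<n. f (Suc k) * of_bool (anc g n j k = anc g n i k))"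
  proof (intro sum_mono)
    fix i j assume ij: "i \<in> ?L" "j \<in> ?L"
    obtain k where k: "share g n i j = Suc k"
      using share_pos[OF g ij n] by (cases "share g n i j") auto
    have "f (share g n i j) = f (Suc k) * of_bool (anc g n j k = anc g n i k)"
      using share_SucD(2)[OF k] k by simp
    also have "\<dots> \<le> (\<Sum>k<n. f (Suc k) * of_bool (anc g n j k = anc g n i k))"
      by (rule member_le_sum[where f="\<lambda>k. f (Suc k) * of_bool (anc g n j k = anc g n i k)"])
        (use f share_SucD(1)[OF k] in auto)
    finally show "f (share g n i j) \<le> (\<Sum>k<n. f (Suc k) * of_bool (anc g n j k = anc g n i k))" .
  qed
  also have "\<dots> = (\<Sum>k<n. \<Sum>i\<in>?L. f (Suc k) * (\<Sum>j\<in>?L. of_bool (anc g n j k = anc g n i k)))"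
    unfolding sum_distrib_left by (subst sum.swap[of _ "{..<n}"]) (intro sum.cong refl sum.swap)
  also have "\<dots> = (\<Sum>k<n. \<Sum>i\<in>?L. f (Suc k) * 2 ^ (n - k))"
  proof (intro sum.cong refl arg_cong2[where f="(*)"])
    fix k i assume "k \<in> {..<n}" "i \<in> ?L"
    then have "anc g n i k \<in> {1..2 ^ k}" by (intro anc_in[OF g]) auto
    from card_anc[OF g _ this] have "card {j \<in> ?L. anc g n j k = anc g n i k} = 2 ^ (n - k)"
      using \<open>k \<in> {..<n}\<close> by auto
    then show "(\<Sum>j\<in>?L. of_bool (anc g n j k = anc g n i k)) = (2 ^ (n - k) :: real)"
      by (simp add: sum_of_bool_eq Int_def conj_commute)
  qed
  also have "\<dots> = (\<Sum>k<n. 4 ^ n * (f (Suc k) / 2 ^ k))"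
    by (intro sum.cong refl) (auto simp: power_diff power_mult_distrib[symmetric] field_simps)
  finally show ?thesis by (simp add: sum_distrib_left)
qed

section \<open>Pathwise representation\<close>

text \<open>Left endpoints r / (K + 1) with r <= K never reach 1. This matters because a driving
  motion is not specified at the right end of its time interval.\<close>

lemma riemann_sum_tendsto:
  fixes f :: "real \<Rightarrow> 'v::euclidean_space"
  assumes f: "continuous_on {0..1} f"
  shows "(\<lambda>K. \<Sum>r<Suc K. (1 / real (Suc K)) *\<^sub>R f (real r / real (Suc K))) \<longlonglongrightarrow> integral {0..1} f"
proof (rule LIMSEQ_I)
  fix e :: real assume "e > 0"
  have "uniformly_continuous_on {0..1} f"
    using f by (rule compact_uniformly_continuous) simp
  then obtain \<delta> where \<delta>: "\<delta> > 0"
    "\<And>x y. x \<in> {0..1} \<Longrightarrow> y \<in> {0..1} \<Longrightarrow> dist x y < \<delta> \<Longrightarrow> dist (f x) (f y) < e / 2"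
    unfolding uniformly_continuous_on_def using \<open>e > 0\<close> by (metis half_gt_zero)
  obtain N :: nat where N: "real N > 1 / \<delta>" using reals_Archimedean2 by blast
  have "norm ((\<Sum>r<Suc K. (1 / real (Suc K)) *\<^sub>R f (real r / real (Suc K))) - integral {0..1} f) < e"
    if "K \<ge> N" for K
  proof -
    define n where "n = Suc K"
    have n: "n > 0" "1 / real n < \<delta>"
    proof -
      have "real n > 1 / \<delta>" using N that by (simp add: n_def)
      then show "n > 0" "1 / real n < \<delta>" using \<delta>(1) by (auto simp: n_def field_simps)
    qed
    \<comment> \<open>Cell by cell: each cell adds an error of at most e / 2 times its length 1 / n,
      by uniform continuity.\<close>
    have "norm ((\<Sum>r<k. (1 / real n) *\<^sub>R f (real r / real n)) - integral {0..real k / real n} f) \<le> real k * (e / 2 / real n)"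
      if "k \<le> n" for k
      using that
    proof (induction k)
      case (Suc k)
      let ?a = "real k / real n" and ?b = "real (Suc k) / real n"
      have ab: "0 \<le> ?a" "?a \<le> ?b" "?b \<le> 1" "?b - ?a = 1 / real n"
        using Suc.prems n by (auto simp: divide_right_mono field_simps)
      have int: "f integrable_on {0..?b}"
        by (rule integrable_continuous_real, rule continuous_on_subset[OF f]) (use ab in auto)
      have c: "continuous_on {?a..?b} f"
        by (rule continuous_on_subset[OF f]) (use ab in auto)
      have e1: "integral {?a..?b} (\<lambda>x. f x - f ?a) = integral {?a..?b} f - (1 / real n) *\<^sub>R f ?a"
        using ab integrable_continuous_real[OF c] by (subst integral_diff) auto
      have "norm (integral {?a..?b} (\<lambda>x. f x - f ?a)) \<le> e / 2 * (?b - ?a)"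
      proof (rule integral_bound)
        show "\<And>t. t \<in> {?a..?b} \<Longrightarrow> norm (f t - f ?a) \<le> e / 2"
        proof -
          fix t assume t: "t \<in> {?a..?b}"
          then have "dist t ?a < \<delta>" using ab n(2) by (auto simp: dist_real_def)
          moreover have "t \<in> {0..1}" "?a \<in> {0..1}"
            using t ab unfolding atLeastAtMost_iff by linarith+
          ultimately have "dist (f t) (f ?a) < e / 2" by (intro \<delta>(2))
          then show "norm (f t - f ?a) \<le> e / 2" by (simp add: dist_norm)
        qed
      qed (use ab c in \<open>auto intro!: continuous_intros\<close>)
      moreover have e2: "integral {0..?b} f = integral {0..?a} f + integral {?a..?b} f"
        using ab int by (intro Henstock_Kurzweil_Integration.integral_combine[symmetric]) auto
      moreover have "norm ((\<Sum>r<k. (1 / real n) *\<^sub>R f (real r / real n)) - integral {0..?a} f) \<le> real k * (e / 2 / real n)"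
        using Suc by simp
      ultimately have "norm (((\<Sum>r<k. (1 / real n) *\<^sub>R f (real r / real n)) - integral {0..?a} f)
           - integral {?a..?b} (\<lambda>x. f x - f ?a)) \<le> real k * (e / 2 / real n) + e / 2 * (?b - ?a)"
        by (intro norm_triangle_le_diff) linarith
      moreover have "(\<Sum>r<Suc k. (1 / real n) *\<^sub>R f (real r / real n)) - integral {0..?b} f
          = ((\<Sum>r<k. (1 / real n) *\<^sub>R f (real r / real n)) - integral {0..?a} f) - integral {?a..?b} (\<lambda>x. f x - f ?a)"
        unfolding e1 e2 by simp
      moreover have "real k * (e / 2 / real n) + e / 2 * (?b - ?a) = real (Suc k) * (e / 2 / real n)"
        unfolding ab(4) by (simp add: algebra_simps add_divide_distrib)
      ultimately show ?case by (simp only:)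
    qed simp
    from this[of n] show ?thesis using n \<open>e > 0\<close> by (simp add: n_def del: of_nat_Suc)
  qed
  then show "\<exists>no. \<forall>K\<ge>no. norm ((\<Sum>r<Suc K. (1 / real (Suc K)) *\<^sub>R f (real r / real (Suc K))) - integral {0..1} f) < e"
    by blast
qed

text \<open>Summation by parts: the increment D q occurs in the partial sum up to r exactly when r >
  q.\<close>

lemma sum_tail_weights:
  fixes D :: "nat \<Rightarrow> 'v::real_vector"
  shows "(\<Sum>q<K. (\<Sum>r\<in>{q<..K}. c r) *\<^sub>R D q) = (\<Sum>r<Suc K. c r *\<^sub>R (\<Sum>q<r. D q))"
proof (induction K)
  case (Suc K)
  have "(\<Sum>q<Suc K. (\<Sum>r\<in>{q<..Suc K}. c r) *\<^sub>R D q)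
      = (\<Sum>q<Suc K. (\<Sum>r\<in>{q<..K}. c r) *\<^sub>R D q + c (Suc K) *\<^sub>R D q)"
  proof (intro sum.cong refl)
    fix q assume "q \<in> {..<Suc K}"
    then have "{q<..Suc K} = insert (Suc K) {q<..K}" by auto
    then show "(\<Sum>r\<in>{q<..Suc K}. c r) *\<^sub>R D q = (\<Sum>r\<in>{q<..K}. c r) *\<^sub>R D q + c (Suc K) *\<^sub>R D q"
      by (simp add: scaleR_add_left add.commute)
  qed
  also have "\<dots> = (\<Sum>q<K. (\<Sum>r\<in>{q<..K}. c r) *\<^sub>R D q) + c (Suc K) *\<^sub>R (\<Sum>q<Suc K. D q)"
    by (simp add: sum.distrib scaleR_sum_right scaleR_add_right)
  finally show ?case using Suc by simp
qed simp

text \<open>Discrete form of exp (- b (1 - u)) at u = q / (K + 1), written as 1 minus the integral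
  of b exp (- b (1 - s)) over s from u to 1, with the integral replaced by a Riemann sum. Keeping
  the sum makes summation by parts an exact identity.\<close>

definition hcoef :: "real \<Rightarrow> nat \<Rightarrow> nat \<Rightarrow> real" where
  "hcoef b K q = 1 - b / real (Suc K) * (\<Sum>r\<in>{q<..K}. exp (- b * (1 - real r / real (Suc K))))"

lemma hcoef_bounds:
  assumes "b \<ge> 0"
  shows "1 - b \<le> hcoef b K q" "hcoef b K q \<le> 1"
proof -
  let ?S = "\<Sum>r\<in>{q<..K}. exp (- b * (1 - real r / real (Suc K)))"
  have "?S \<le> (\<Sum>r\<in>{q<..K}. 1)"
    using assms by (intro sum_mono) (auto intro!: mult_nonneg_nonneg)
  also have "\<dots> \<le> real (Suc K)" by simp
  finally have "?S \<le> real (Suc K)" .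
  then have "b / real (Suc K) * ?S \<le> b / real (Suc K) * real (Suc K)"
    using assms by (intro mult_left_mono) auto
  then show "1 - b \<le> hcoef b K q" by (simp add: hcoef_def)
  have "?S \<ge> 0" by (intro sum_nonneg) auto
  then show "hcoef b K q \<le> 1" using assms by (simp add: hcoef_def)
qed

text \<open>Variation of constants: \<open>hcoef b K q\<close> is what summation by parts makes of a Riemann sum for
  \<open>\<integral> b exp (- b (a + 1 - t)) v t dt\<close>, written in the increments of the noise \<open>v\<close>.\<close>

lemma averaged_slot:
  fixes y v :: "real \<Rightarrow> 'v::euclidean_space"
  assumes cont: "continuous_on {a..<a + 1} y" and lim: "(y \<longlongrightarrow> l) (at_left (a + 1))"
    and eq: "\<And>t. t \<in> {a..<a + 1} \<Longrightarrow> y t = y a + (v t - v a) - b *\<^sub>R integral {a..t} y"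
  defines "x \<equiv> \<lambda>K r. a + real r / real (Suc K)"
  obtains J where "((\<lambda>t. integral {a..t} y) \<longlongrightarrow> J) (at_left (a + 1))"
    and "(\<lambda>K. v (x K K) - v a) \<longlonglongrightarrow> l - y a + b *\<^sub>R J"
    and "(\<lambda>K. \<Sum>q<K. hcoef b K q *\<^sub>R (v (x K (Suc q)) - v (x K q))) \<longlonglongrightarrow> l - exp (- b) *\<^sub>R y a"
proof -
  \<comment> \<open>Extending y by its left limit gives a continuous function on a closed interval,
    where integrability and the fundamental theorem of calculus are at hand.\<close>
  define Y where "Y t = (if t < a + 1 then y t else l)" for t
  have contY: "continuous_on {a..a + 1} Y"
  proof -
    have "(Y \<longlongrightarrow> Y t) (at t within {a..a+1})" if "t \<in> {a..a+1}" for t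
    proof (cases "t < a + 1")
      case True
      have "(y \<longlongrightarrow> y t) (at t within {a..<a+1})" using cont that True by (auto simp: continuous_on_def)
      moreover have "at t within {a..<a+1} = at t within {a..a+1}"
        by (rule at_within_nhd[of t "{..<a+1}"]) (use True in auto)
      ultimately have "(y \<longlongrightarrow> y t) (at t within {a..a+1})" by simp
      moreover have "eventually (\<lambda>s. y s = Y s) (at t within {a..a+1})"
        using eventually_at_in_open'[of "{..<a+1}" t] True
        by (auto simp: Y_def eventually_at_filter elim!: eventually_mono)
      ultimately have "(Y \<longlongrightarrow> y t) (at t within {a..a+1})" by (rule Lim_transform_eventually)
      moreover have "Y t = y t" using True by (simp add: Y_def)
      ultimately show ?thesis by simp
    next
      case False
      then have t: "t = a + 1" using that by auto
      have "eventually (\<lambda>s. y s = Y s) (at_left (a + 1))"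
        by (auto simp: Y_def eventually_at_filter)
      then have "(Y \<longlongrightarrow> l) (at_left (a + 1))" by (rule Lim_transform_eventually[OF lim])
      moreover have "at t within {a..a+1} \<le> at_left (a + 1)"
        unfolding t at_within_def by (intro inf_mono) auto
      ultimately show ?thesis using t tendsto_mono by (auto simp: Y_def)
    qed
    then show ?thesis by (auto simp: continuous_on_def)
  qed
  define I where "I t = integral {a..t} Y" for t
  have I: "I t = integral {a..t} y" if "t < a + 1" for t
    unfolding I_def using that by (intro integral_cong) (auto simp: Y_def)
  have intY: "Y integrable_on {a..a+1}" using contY by (rule integrable_continuous_real)
  have contI: "continuous_on {a..a+1} I"
    unfolding I_def by (rule indefinite_integral_continuous_1) (rule intY)
  have [simp]: "I a = 0" by (simp add: I_def)
  \<comment> \<open>The noise \<open>v t - v a\<close>, read off from the equation. This expression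
    also has a value at a + 1, which v itself need not have.\<close>
  define V where "V t = Y t - Y a + b *\<^sub>R I t" for t
  have contV: "continuous_on {a..a+1} V"
    unfolding V_def by (intro continuous_intros contY contI)
  have [simp]: "V a = 0" by (simp add: V_def)
  have V: "V t = v t - v a" if "a \<le> t" "t < a + 1" for t
    using eq[of t] that I[of t] by (simp add: V_def Y_def)
  have xK: "x K r \<ge> a" "x K r \<le> a + 1" "r \<le> K \<Longrightarrow> x K r < a + 1" if "r \<le> Suc K" for K r
    using that by (auto simp: x_def)
  show ?thesis
  proof (rule that[of "I (a + 1)"])
    have "(I \<longlongrightarrow> I (a + 1)) (at_left (a + 1))"
    proof -
      have "(I \<longlongrightarrow> I (a + 1)) (at (a+1) within {a..a+1})" using contI by (auto simp: continuous_on_def)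
      moreover have "at (a + 1) within {a..a+1} = at_left (a + 1)"
        using at_within_Icc_at_left[of a "a + 1"] by simp
      ultimately show ?thesis by simp
    qed
    moreover have "eventually (\<lambda>t. I t = integral {a..t} y) (at_left (a + 1))"
      by (auto simp: eventually_at_filter I)
    ultimately show "((\<lambda>t. integral {a..t} y) \<longlongrightarrow> I (a + 1)) (at_left (a + 1))"
      by (rule Lim_transform_eventually)
    have "(\<lambda>K. real K / real (Suc K)) \<longlonglongrightarrow> 1" by (rule LIMSEQ_n_over_Suc_n)
    then have "(\<lambda>K. x K K) \<longlonglongrightarrow> a + 1" unfolding x_def by (intro tendsto_intros)
    then have "(\<lambda>K. V (x K K)) \<longlonglongrightarrow> V (a + 1)"
      by (rule continuous_on_tendsto_compose[OF contV]) (auto simp: xK)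
    then have vK: "(\<lambda>K. v (x K K) - v a) \<longlonglongrightarrow> V (a + 1)"
      by (simp add: V xK)
    then show "(\<lambda>K. v (x K K) - v a) \<longlonglongrightarrow> l - y a + b *\<^sub>R I (a + 1)"
      by (simp add: V_def Y_def)
    define f where "f u = (b * exp (- b * (1 - u))) *\<^sub>R V (a + u)" for u
    have "continuous_on {0..1} (\<lambda>u. V (a + u))"
      by (rule continuous_on_compose2[OF contV]) (auto intro!: continuous_intros)
    then have contf: "continuous_on {0..1} f"
      unfolding f_def by (intro continuous_intros)
    \<comment> \<open>The antiderivative is an exponential times b I - Y a. Differentiating the
      exponential gives b (b I - Y a), differentiating I gives b Y, and together these are b
      V.\<close>
    have "(f has_integral (exp (- b * (1 - 1)) *\<^sub>R (b *\<^sub>R I (a + 1) - Y a) - exp (- b * (1 - 0)) *\<^sub>R (b *\<^sub>R I (a + 0) - Y a))) {0..1}"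
    proof (rule fundamental_theorem_of_calculus)
      fix u :: real assume u: "u \<in> {0..1}"
      have "(I has_vector_derivative Y (a + u)) (at (a + u) within {a..a+1})"
        unfolding I_def using integral_has_vector_derivative[OF contY, of "a + u"] u by simp
      moreover have "(\<lambda>u. a + u) ` {0..1} = {a..a+1}" by (simp add: image_add_atLeastAtMost)
      ultimately have "((I \<circ> (\<lambda>u. a + u)) has_vector_derivative 1 *\<^sub>R Y (a + u)) (at u within {0..1})"
        by (intro vector_diff_chain_within) (auto intro!: derivative_eq_intros simp: add.commute)
      then have "((\<lambda>u. I (a + u)) has_vector_derivative Y (a + u)) (at u within {0..1})"
        by (simp add: o_def)
      then show "((\<lambda>u. exp (- b * (1 - u)) *\<^sub>R (b *\<^sub>R I (a + u) - Y a)) has_vector_derivative f u) (at u within {0..1})"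
        by (auto intro!: derivative_eq_intros simp: f_def V_def algebra_simps)
    qed auto
    then have intf: "integral {0..1} f = V (a + 1) - (l - exp (- b) *\<^sub>R y a)"
      by (simp add: integral_unique V_def Y_def algebra_simps)
    \<comment> \<open>Exact for every K. The increments telescope only up to \<open>x K K\<close>,
      the last grid point before a + 1; the missing cell disappears in the limit.\<close>
    have rep: "(\<Sum>q<K. hcoef b K q *\<^sub>R (v (x K (Suc q)) - v (x K q)))
        = (v (x K K) - v a) - (\<Sum>r<Suc K. (1 / real (Suc K)) *\<^sub>R f (real r / real (Suc K)))" for K
    proof -
      define D where "D q = v (x K (Suc q)) - v (x K q)" for q
      define c where "c r = b / real (Suc K) * exp (- b * (1 - real r / real (Suc K)))" for r
      have DV: "(\<Sum>q<r. D q) = v (x K r) - v a" for r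
        unfolding D_def by (subst sum_lessThan_telescope) (simp add: x_def)
      have "(\<Sum>q<K. hcoef b K q *\<^sub>R D q) = (\<Sum>q<K. D q) - (\<Sum>q<K. (\<Sum>r\<in>{q<..K}. c r) *\<^sub>R D q)"
        by (simp add: hcoef_def c_def sum_distrib_left scaleR_diff_left sum_subtractf)
      also have "\<dots> = (v (x K K) - v a) - (\<Sum>r<Suc K. c r *\<^sub>R (v (x K r) - v a))"
        unfolding sum_tail_weights DV ..
      also have "(\<Sum>r<Suc K. c r *\<^sub>R (v (x K r) - v a)) = (\<Sum>r<Suc K. (1 / real (Suc K)) *\<^sub>R f (real r / real (Suc K)))"
      proof (intro sum.cong refl)
        fix r assume "r \<in> {..<Suc K}"
        then have "v (x K r) - v a = V (x K r)" by (intro V[symmetric]) (auto simp: xK)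
        then show "c r *\<^sub>R (v (x K r) - v a) = (1 / real (Suc K)) *\<^sub>R f (real r / real (Suc K))"
          by (simp add: c_def f_def x_def)
      qed
      finally show ?thesis by (simp add: D_def)
    qed
    show "(\<lambda>K. \<Sum>q<K. hcoef b K q *\<^sub>R (v (x K (Suc q)) - v (x K q))) \<longlonglongrightarrow> l - exp (- b) *\<^sub>R y a"
      unfolding rep using tendsto_diff[OF vK riemann_sum_tendsto[OF contf]] by (simp add: intf)
  qed
qed

text \<open>Of the K + 1 cells of [m, m+1) only those with r < K enter the sums below, so that w is
  evaluated strictly before time m + 1.\<close>

definition incr :: "(nat \<Rightarrow> nat \<Rightarrow> real \<Rightarrow> 'v) \<Rightarrow> nat \<Rightarrow> nat \<Rightarrow> nat \<Rightarrow> nat \<Rightarrow> 'v::real_vector" where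
  "incr w K m j r = w m j (real m + real (Suc r) / real (Suc K)) - w m j (real m + real r / real (Suc K))"

definition mean :: "nat \<Rightarrow> (nat \<Rightarrow> 'v) \<Rightarrow> 'v::real_vector" where
  "mean m f = (1 / 2 ^ m) *\<^sub>R (\<Sum>j=1..2 ^ m. f j)"

text \<open>Up to discretisation, \<open>1 + theta b K n m r\<close> is the response of the centre of mass at time \<open>n\<close> to a
  unit impulse in cell \<open>r\<close> of the time interval \<open>[m, m+1)\<close>.\<close>

definition theta :: "real \<Rightarrow> nat \<Rightarrow> nat \<Rightarrow> nat \<Rightarrow> nat \<Rightarrow> real" where
  "theta b K n m r = exp (- b * (real n - 1 - real m)) * hcoef b K r - 1"

text \<open>The indicator is the increment along the ancestral line. Every particle of generation m
  also contributes through the population mean of the noise, which is subtracted once in the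
  recentring and returns with factor 1 + \<open>theta\<close> in the centre of mass; the net factor
  is \<open>theta\<close>, shared among 2^m particles.\<close>

definition weight :: "real \<Rightarrow> (nat \<Rightarrow> nat \<Rightarrow> nat) \<Rightarrow> nat \<Rightarrow> nat \<Rightarrow> nat \<Rightarrow> nat \<Rightarrow> nat \<Rightarrow> nat \<Rightarrow> real" where
  "weight b g n i K m j r = of_bool (anc g n i m = j) + theta b K n m r / 2 ^ m"

definition approx :: "real \<Rightarrow> (nat \<Rightarrow> nat \<Rightarrow> real \<Rightarrow> 'v) \<Rightarrow> (nat \<Rightarrow> nat \<Rightarrow> nat) \<Rightarrow> nat \<Rightarrow> nat \<Rightarrow> nat \<Rightarrow> 'v::real_vector" where
  "approx b w g n i K = (\<Sum>m<n. \<Sum>j=1..2 ^ m. \<Sum>r<K. weight b g n i K m j r *\<^sub>R incr w K m j r)"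

lemma mean_diff: "mean m (\<lambda>j. f j - h j) = mean m f - mean m h"
  by (simp add: mean_def sum_subtractf scaleR_diff_right)

lemma mean_add: "mean m (\<lambda>j. f j + h j) = mean m f + mean m h"
  by (simp add: mean_def sum.distrib scaleR_add_right)

lemma mean_const [simp]: "mean m (\<lambda>j. c) = c"
  by (simp add: mean_def sum_constant_scaleR)

lemma mean_sum: "mean m (\<lambda>j. \<Sum>r\<in>A. c r *\<^sub>R f j r) = (\<Sum>r\<in>A. c r *\<^sub>R mean m (\<lambda>j. f j r))"
  unfolding mean_def scaleR_sum_right by (subst sum.swap) (simp add: mult.commute)

lemma mean_cong: "(\<And>j. j \<in> {1..2 ^ m} \<Longrightarrow> f j = h j) \<Longrightarrow> mean m f = mean m h"
  by (simp add: mean_def)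

text \<open>Branching doubles both the sum and the number of particles, so the centre of mass does
  not jump.\<close>

lemma mean_offspring:
  assumes "genealogy n g" "m < n"
  shows "mean (Suc m) (\<lambda>i. f (g m i)) = mean m f"
  unfolding mean_def sum_offspring[OF assms] by simp

lemma tendsto_mean:
  fixes f :: "nat \<Rightarrow> 'x \<Rightarrow> 'v::real_normed_vector"
  shows "(\<And>j. j \<in> {1..2 ^ m} \<Longrightarrow> (f j \<longlongrightarrow> l j) F) \<Longrightarrow> ((\<lambda>t. mean m (\<lambda>j. f j t)) \<longlongrightarrow> mean m l) F"
  unfolding mean_def by (intro tendsto_intros) auto

text \<open>The terms - b x i and - \<gamma> x i, both proportional to the particle's own position,
  cancel. This is where b + \<gamma> = 0 enters.\<close>

lemma drift_eq_mean:
  fixes x :: "nat \<Rightarrow> real ^ 'd"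
  assumes "b + \<gamma> = 0"
  shows "drift b \<gamma> (2 ^ m) x i = - b *\<^sub>R mean m x"
proof -
  have \<gamma>: "\<gamma> = - b" using assms by simp
  have "(1 / real (2 ^ m)) *\<^sub>R (\<Sum>j=1..2 ^ m. \<gamma> *\<^sub>R (x j - x i)) = \<gamma> *\<^sub>R (mean m x - x i)"
    by (simp add: mean_def sum_subtractf scaleR_sum_right[symmetric] scaleR_diff_right sum_constant_scaleR del: sum_constant)
  then show ?thesis unfolding drift_def by (simp add: \<gamma> scaleR_diff_right)
qed

text \<open>Since the drift is common to all particles, a position is the sum of the driving
  increments along the ancestral line minus their population means, plus the population mean.\<close>

lemma approx_tendsto:
  fixes z :: "real \<Rightarrow> nat \<Rightarrow> 'v::euclidean_space"
  assumes gen: "genealogy N g" and start: "z 0 1 = 0"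
    and born: "\<And>m i. m < N \<Longrightarrow> i \<in> {1..2 ^ Suc m} \<Longrightarrow>
         ((\<lambda>t. z t (g m i)) \<longlongrightarrow> z (real (Suc m)) i) (at_left (real (Suc m)))"
    and cont: "\<And>m i. i \<in> {1..2 ^ m} \<Longrightarrow> continuous_on {real m..<real m + 1} (\<lambda>t. z t i)"
    and sde: "\<And>m i t. i \<in> {1..2 ^ m} \<Longrightarrow> t \<in> {real m..<real m + 1} \<Longrightarrow>
         z t i = z (real m) i + (w m i t - w m i (real m)) - b *\<^sub>R integral {real m..t} (\<lambda>s. mean m (z s))"
    and i: "i \<in> {1..2 ^ N}"
  shows "(\<lambda>K. approx b w g N i K) \<longlonglongrightarrow> z (real N) i"
proof -
  define S where "S K m j = (\<Sum>r<K. incr w K m j r)" for K m j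
  define H where "H K m = (\<Sum>r<K. hcoef b K r *\<^sub>R mean m (\<lambda>j. incr w K m j r))" for K m
  \<comment> \<open>\<open>\<zeta>\<close> approximates the centre of mass at time n and
    \<open>U\<close> the displacement of a particle from it. The noise of one slot enters
    \<open>\<zeta>\<close> through \<open>H\<close>, and older slots are damped by exp (- b) per
    unit of time.\<close>
  define \<zeta> where "\<zeta> K n = (\<Sum>m<n. exp (- b * (real n - 1 - real m)) *\<^sub>R H K m)" for K n
  define U where "U K n i = (\<Sum>m<n. S K m (anc g n i m) - mean m (S K m))" for K n i
  have S: "S K m j = w m j (real m + real K / real (Suc K)) - w m j (real m)" for K m j
    unfolding S_def incr_def by (subst sum_lessThan_telescope) simp
  have \<zeta>_Suc: "\<zeta> K (Suc n) = exp (- b) *\<^sub>R \<zeta> K n + H K n" for K n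
  proof -
    have "exp (- b * (real (Suc n) - 1 - real m)) = exp (- b) * exp (- b * (real n - 1 - real m))" for m
      by (simp add: exp_add[symmetric] algebra_simps)
    moreover have "exp (- b) * exp b = 1" by (simp flip: exp_add)
    ultimately show ?thesis by (simp add: \<zeta>_def scaleR_sum_right)
  qed
  have U_Suc: "U K (Suc n) i = U K n (g n i) + (S K n (g n i) - mean n (S K n))" for K n i
    by (simp add: U_def)
  have approx: "approx b w g N i K = U K N i + \<zeta> K N" for K
  proof -
    have "(\<Sum>j=1..2 ^ m. \<Sum>r<K. weight b g N i K m j r *\<^sub>R incr w K m j r)
        = (S K m (anc g N i m) - mean m (S K m)) + exp (- b * (real N - 1 - real m)) *\<^sub>R H K m" if "m < N" for m
    proof -
      have a: "anc g N i m \<in> {1..2 ^ m}" using anc_in[OF gen i] that by simp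
      have "(\<Sum>j=1..2 ^ m. \<Sum>r<K. weight b g N i K m j r *\<^sub>R incr w K m j r)
          = (\<Sum>j=1..2 ^ m. of_bool (anc g N i m = j) *\<^sub>R S K m j) + mean m (\<lambda>j. \<Sum>r<K. theta b K N m r *\<^sub>R incr w K m j r)"
        by (simp add: weight_def S_def mean_def scaleR_add_left sum.distrib scaleR_sum_right)
      also have "(\<Sum>j=1..2 ^ m. of_bool (anc g N i m = j) *\<^sub>R S K m j) = S K m (anc g N i m)"
        using a by (subst sum.remove[of _ "anc g N i m"]) (auto intro!: sum.neutral)
      also have "mean m (\<lambda>j. \<Sum>r<K. theta b K N m r *\<^sub>R incr w K m j r)
          = exp (- b * (real N - 1 - real m)) *\<^sub>R H K m - (\<Sum>r<K. mean m (\<lambda>j. incr w K m j r))"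
        unfolding mean_sum by (simp add: theta_def H_def scaleR_diff_left sum_subtractf scaleR_sum_right)
      also have "(\<Sum>r<K. mean m (\<lambda>j. incr w K m j r)) = mean m (S K m)"
        using mean_sum[of m "\<lambda>_. 1" "incr w K m" "{..<K}"] by (simp add: S_def[abs_def])
      finally show ?thesis by simp
    qed
    then show ?thesis by (simp add: approx_def U_def \<zeta>_def sum.distrib)
  qed
  \<comment> \<open>The induction treats all particles of generation n at once, because the
    ancestral line changes its label and the centre of mass involves the whole population.\<close>
  have "((\<lambda>K. \<zeta> K n) \<longlonglongrightarrow> mean n (z (real n))) \<and>
      (\<forall>i\<in>{1..2 ^ n}. (\<lambda>K. U K n i) \<longlonglongrightarrow> z (real n) i - mean n (z (real n)))" if "n \<le> N" for n
    using that
  proof (induction n)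
    case 0
    have "mean 0 (z 0) = 0" using start by (simp add: mean_def)
    then show ?case using start by (simp add: \<zeta>_def U_def)
  next
    case (Suc n)
    have n: "n < N" using Suc.prems by simp
    \<comment> \<open>The left limit of particle j at time n + 1, read off from the position of one
      of its offspring. Any choice gives the same point, since left limits are unique.\<close>
    define e where "e j = z (real (Suc n)) (SOME i. i \<in> {1..2 ^ Suc n} \<and> g n i = j)" for j
    have lim: "((\<lambda>t. z t j) \<longlongrightarrow> e j) (at_left (real n + 1))" if j: "j \<in> {1..2 ^ n}" for j
    proof -
      have "card {i \<in> {1..2 ^ Suc n}. g n i = j} = 2" by (rule genealogyD(2)[OF gen n j])
      then have "\<exists>i. i \<in> {1..2 ^ Suc n} \<and> g n i = j" by (metis (mono_tags, lifting) card.empty empty_Collect_eq zero_neq_numeral)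
      from someI_ex[OF this] show ?thesis
        using born[OF n, of "SOME i. i \<in> {1..2 ^ Suc n} \<and> g n i = j"] by (simp add: e_def add.commute)
    qed
    have e: "z (real (Suc n)) i = e (g n i)" if "i \<in> {1..2 ^ Suc n}" for i
    proof (rule tendsto_unique)
      show "((\<lambda>t. z t (g n i)) \<longlongrightarrow> z (real (Suc n)) i) (at_left (real (Suc n)))" by (rule born[OF n that])
      show "((\<lambda>t. z t (g n i)) \<longlongrightarrow> e (g n i)) (at_left (real (Suc n)))"
        using lim[OF genealogyD(1)[OF gen n that]] by (simp add: add.commute)
    qed (simp add: trivial_limit_at_left_real)
    have mean_e: "mean (Suc n) (z (real (Suc n))) = mean n e"
      using mean_offspring[OF gen n, of e] mean_cong[of "Suc n" "z (real (Suc n))" "\<lambda>i. e (g n i)"] e by simp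
    define y where "y t = mean n (z t)" for t
    define v where "v t = mean n (\<lambda>j. w n j t)" for t
    have conty: "continuous_on {real n..<real n + 1} y"
      unfolding y_def mean_def by (intro continuous_intros cont)
    have limy: "(y \<longlongrightarrow> mean n e) (at_left (real n + 1))"
      unfolding y_def by (intro tendsto_mean lim)
    have eqy: "y t = y (real n) + (v t - v (real n)) - b *\<^sub>R integral {real n..t} y"
      if "t \<in> {real n..<real n + 1}" for t
    proof -
      have "y t = mean n (\<lambda>j. z (real n) j + (w n j t - w n j (real n)) - b *\<^sub>R integral {real n..t} (\<lambda>s. mean n (z s)))"
        unfolding y_def by (intro mean_cong sde that)
      then show ?thesis by (simp add: y_def[abs_def] v_def mean_diff mean_add)
    qed
    obtain J where J: "((\<lambda>t. integral {real n..t} y) \<longlongrightarrow> J) (at_left (real n + 1))"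
      and J1: "(\<lambda>K. v (real n + real K / real (Suc K)) - v (real n)) \<longlonglongrightarrow> mean n e - y (real n) + b *\<^sub>R J"
      and J2: "(\<lambda>K. \<Sum>q<K. hcoef b K q *\<^sub>R (v (real n + real (Suc q) / real (Suc K)) - v (real n + real q / real (Suc K))))
          \<longlonglongrightarrow> mean n e - exp (- b) *\<^sub>R y (real n)"
      by (rule averaged_slot[OF conty limy eqy])
    have H: "(\<lambda>K. H K n) \<longlonglongrightarrow> mean n e - exp (- b) *\<^sub>R y (real n)"
      using J2 by (simp add: H_def v_def incr_def mean_diff)
    have mS: "(\<lambda>K. mean n (S K n)) \<longlonglongrightarrow> mean n e - y (real n) + b *\<^sub>R J"
      using J1 by (simp add: S[abs_def] v_def mean_diff)
    \<comment> \<open>The noise of one slot is the displacement plus b J, where J is the integral of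
      the centre of mass. The term b J is common to all particles and cancels against the one in
      \<open>mS\<close>.\<close>
    have Sj: "(\<lambda>K. S K n j) \<longlonglongrightarrow> e j - z (real n) j + b *\<^sub>R J" if j: "j \<in> {1..2 ^ n}" for j
    proof -
      have "((\<lambda>t. z t j - z (real n) j + b *\<^sub>R integral {real n..t} y) \<longlongrightarrow> e j - z (real n) j + b *\<^sub>R J) (at_left (real n + 1))"
        by (intro tendsto_intros lim J j)
      moreover have "eventually (\<lambda>t. z t j - z (real n) j + b *\<^sub>R integral {real n..t} y = w n j t - w n j (real n)) (at_left (real n + 1))"
        using eventually_at_left_real[of "real n" "real n + 1"]
      proof (rule eventually_mono)
        show "z t j - z (real n) j + b *\<^sub>R integral {real n..t} y = w n j t - w n j (real n)"
          if "t \<in> {real n<..<real n + 1}" for t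
          using sde[OF j, of t] that by (simp add: y_def[abs_def])
      qed simp
      ultimately have w: "((\<lambda>t. w n j t - w n j (real n)) \<longlongrightarrow> e j - z (real n) j + b *\<^sub>R J) (at_left (real n + 1))"
        by (rule Lim_transform_eventually)
      have "(\<lambda>K. real K / real (Suc K)) \<longlonglongrightarrow> 1" by (rule LIMSEQ_n_over_Suc_n)
      then have "(\<lambda>K. real n + real K / real (Suc K)) \<longlonglongrightarrow> real n + 1" by (intro tendsto_intros)
      then have "filterlim (\<lambda>K. real n + real K / real (Suc K)) (at_left (real n + 1)) sequentially"
        by (rule filterlim_at_withinI) auto
      from filterlim_compose[OF w this] show ?thesis by (simp add: S)
    qed
    have IH: "(\<lambda>K. \<zeta> K n) \<longlonglongrightarrow> y (real n)"
        "\<And>j. j \<in> {1..2 ^ n} \<Longrightarrow> (\<lambda>K. U K n j) \<longlonglongrightarrow> z (real n) j - y (real n)"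
      using Suc by (auto simp: y_def)
    have "(\<lambda>K. \<zeta> K (Suc n)) \<longlonglongrightarrow> exp (- b) *\<^sub>R y (real n) + (mean n e - exp (- b) *\<^sub>R y (real n))"
      unfolding \<zeta>_Suc by (intro tendsto_intros IH H)
    moreover have "(\<lambda>K. U K (Suc n) i) \<longlonglongrightarrow> z (real (Suc n)) i - mean n e" if i: "i \<in> {1..2 ^ Suc n}" for i
    proof -
      have j: "g n i \<in> {1..2 ^ n}" by (rule genealogyD(1)[OF gen n i])
      have "(\<lambda>K. U K (Suc n) i) \<longlonglongrightarrow> (z (real n) (g n i) - y (real n))
          + ((e (g n i) - z (real n) (g n i) + b *\<^sub>R J) - (mean n e - y (real n) + b *\<^sub>R J))"
        unfolding U_Suc by (intro tendsto_intros IH Sj mS j)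
      then show ?thesis using e[OF i] by simp
    qed
    ultimately show ?case unfolding mean_e by simp
  qed
  then have \<zeta>: "(\<lambda>K. \<zeta> K N) \<longlonglongrightarrow> mean N (z (real N))"
    and U: "(\<lambda>K. U K N i) \<longlonglongrightarrow> z (real N) i - mean N (z (real N))"
    using i by blast+
  show ?thesis unfolding approx using tendsto_add[OF U \<zeta>] by simp
qed

section \<open>Covariances of the discretised positions\<close>

lemma theta_bound:
  assumes "b > 0" "m < n"
  shows "\<bar>theta b K n m r\<bar> \<le> 2 + b"
proof -
  have "real m + 1 \<le> real n" using assms by linarith
  \<comment> \<open>The damping b > 0 makes the response to old noise bounded uniformly in
    n.\<close>
  then have "exp (- b * (real n - 1 - real m)) \<le> 1"
    using assms by (auto intro!: mult_nonneg_nonneg)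
  moreover have "\<bar>hcoef b K r\<bar> \<le> 1 + b"
    using hcoef_bounds[of b K r] assms by (auto simp: abs_le_iff)
  ultimately have "\<bar>exp (- b * (real n - 1 - real m)) * hcoef b K r\<bar> \<le> 1 * (1 + b)"
    unfolding abs_mult by (intro mult_mono) auto
  then show ?thesis
    unfolding theta_def using abs_triangle_ineq4[of "exp (- b * (real n - 1 - real m)) * hcoef b K r" 1] by simp
qed

text \<open>The discretised correction \<open>\<delta>\<close> to variances and covariances, common to all pairs.\<close>

definition excess :: "real \<Rightarrow> nat \<Rightarrow> nat \<Rightarrow> real" where
  "excess b n K = (\<Sum>m<n. \<Sum>r<K. (2 * theta b K n m r + (theta b K n m r)\<^sup>2) / 2 ^ m) / real (Suc K)"

text \<open>The mean over 2^m independent motions makes the contribution of slot m at most c 2^(-m),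
  with c from the bound 2 + b on \<open>theta\<close>. The geometric series is at most 2, so the
  bound is uniform in n and K.\<close>

lemma excess_bound:
  assumes "b > 0"
  shows "\<bar>excess b n K\<bar> \<le> 2 * (2 * (2 + b) + (2 + b)\<^sup>2)"
proof -
  define c where "c = 2 * (2 + b) + (2 + b)\<^sup>2"
  have c: "c \<ge> 0" using assms by (simp add: c_def)
  have "\<bar>\<Sum>m<n. \<Sum>r<K. (2 * theta b K n m r + (theta b K n m r)\<^sup>2) / 2 ^ m\<bar>
      \<le> (\<Sum>m<n. \<Sum>r<K. c * (1 / 2) ^ m)"
  proof (intro sum_norm_le[where 'a=real, unfolded real_norm_def])
    fix m r assume "m \<in> {..<n}" "r \<in> {..<K}"
    then have t: "\<bar>theta b K n m r\<bar> \<le> 2 + b" using assms by (intro theta_bound) auto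
    have "\<bar>2 * theta b K n m r + (theta b K n m r)\<^sup>2\<bar> \<le> 2 * \<bar>theta b K n m r\<bar> + \<bar>theta b K n m r\<bar>\<^sup>2"
      by (rule order_trans[OF abs_triangle_ineq]) (simp add: abs_mult)
    also have "\<dots> \<le> c" unfolding c_def using t assms by (intro add_mono mult_left_mono power_mono) auto
    finally show "\<bar>(2 * theta b K n m r + (theta b K n m r)\<^sup>2) / 2 ^ m\<bar> \<le> c * (1 / 2) ^ m"
      by (simp add: divide_right_mono power_one_over field_simps)
  qed
  also have "\<dots> = real K * c * (\<Sum>m<n. (1 / 2) ^ m)" by (simp add: sum_distrib_left ac_simps)
  also have "(\<Sum>m<n. (1 / 2 :: real) ^ m) \<le> 2"
    by (subst sum_gp_strict) auto
  finally have "\<bar>\<Sum>m<n. \<Sum>r<K. (2 * theta b K n m r + (theta b K n m r)\<^sup>2) / 2 ^ m\<bar> \<le> real K * c * 2"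
    using c by (simp add: mult_left_mono)
  also have "\<dots> \<le> 2 * c * real (Suc K)" using c by (simp add: algebra_simps)
  finally show ?thesis unfolding excess_def c_def[symmetric] abs_divide by (simp add: field_simps)
qed

text \<open>After division by K + 1, the inverse of the variance of an increment, this is the
  coordinatewise covariance of two discretised positions. Each ancestral line meets a generation in
  exactly one label, so the terms containing \<open>theta\<close> have the same sum for every pair;
  the pair itself enters only through its share.\<close>

lemma sum_weight_product:
  assumes "genealogy n g" "i \<in> {1..2 ^ n}" "i' \<in> {1..2 ^ n}"
  shows "(\<Sum>m<n. \<Sum>j=1..2 ^ m. \<Sum>r<K. weight b g n i K m j r * weight b g n i' K m j r) / real (Suc K)
    = real (share g n i i') * (real K / real (Suc K)) + excess b n K"
proof -
  have "(\<Sum>j=1..2 ^ m. \<Sum>r<K. weight b g n i K m j r * weight b g n i' K m j r)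
      = of_bool (anc g n i m = anc g n i' m) * real K + (\<Sum>r<K. (2 * theta b K n m r + (theta b K n m r)\<^sup>2) / 2 ^ m)"
    if m: "m < n" for m
  proof -
    have a: "anc g n i m \<in> {1..2 ^ m}" "anc g n i' m \<in> {1..2 ^ m}"
      using anc_in[OF assms(1,2)] anc_in[OF assms(1,3)] m by auto
    have "(\<Sum>j=1..2 ^ m. weight b g n i K m j r * weight b g n i' K m j r)
       = of_bool (anc g n i m = anc g n i' m) + (2 * theta b K n m r + (theta b K n m r)\<^sup>2) / 2 ^ m" for r
    proof -
      let ?t = "theta b K n m r / 2 ^ m"
      have "(\<Sum>j=1..2 ^ m. weight b g n i K m j r * weight b g n i' K m j r)
        = (\<Sum>j=1..2 ^ m. (if j = anc g n i m then of_bool (anc g n i m = anc g n i' m) else 0)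
            + ?t * (if j = anc g n i m then 1 else 0) + ?t * (if j = anc g n i' m then 1 else 0) + ?t\<^sup>2)"
        by (intro sum.cong refl) (auto simp: weight_def algebra_simps power2_eq_square)
      also have "\<dots> = of_bool (anc g n i m = anc g n i' m) + ?t + ?t + 2 ^ m * ?t\<^sup>2"
        using a by (simp only: sum.distrib sum.delta finite_atLeastAtMost sum_distrib_left[symmetric]) simp
      also have "\<dots> = of_bool (anc g n i m = anc g n i' m) + (2 * theta b K n m r + (theta b K n m r)\<^sup>2) / 2 ^ m"
        by (simp add: power2_eq_square field_simps)
      finally show ?thesis .
    qed
    then show ?thesis by (subst sum.swap) (simp add: sum.distrib)
  qed
  then have "(\<Sum>m<n. \<Sum>j=1..2 ^ m. \<Sum>r<K. weight b g n i K m j r * weight b g n i' K m j r)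
     = (\<Sum>m<n. of_bool (anc g n i m = anc g n i' m) * real K) + excess b n K * real (Suc K)"
    by (simp add: sum.distrib excess_def)
  also have "(\<Sum>m<n. of_bool (anc g n i m = anc g n i' m) * real K) = real (share g n i i') * real K"
    by (simp add: sum_distrib_right[symmetric] share_def sum_of_bool_eq Int_def lessThan_def)
  finally show ?thesis by (simp add: add_divide_distrib)
qed

section \<open>Conditional law of pairs of particles\<close>

lemma generated_events_closed:
  "sigma_sets (space M) (generated_events M I X) = generated_events M I X"
  unfolding generated_events_def by (rule sigma_sets_sigma_sets_eq) auto

lemma generated_events_subset: "generated_events M I X \<subseteq> Pow (space M)"
  unfolding generated_events_def by (rule subsetI, rule PowI, erule sigma_sets_into_sp[rotated]) auto

lemma measurable_generated_events:
  fixes X :: "'i \<Rightarrow> 'w \<Rightarrow> 'b::topological_space"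
  assumes "i \<in> I" "generated_events M I X \<subseteq> F" "F \<subseteq> Pow (space M)"
  shows "X i \<in> borel_measurable (sigma (space M) F)"
proof (rule measurableI)
  fix A :: "'b set" assume "A \<in> sets borel"
  then have "X i -` A \<inter> space M \<in> generated_events M I X"
    using assms(1) unfolding generated_events_def by (intro sigma_sets.Basic) auto
  then show "X i -` A \<inter> space (sigma (space M) F) \<in> sets (sigma (space M) F)"
    using assms(2,3) by (auto simp: sets_measure_of)
qed auto

lemma past_closed: "sigma_sets (space M) (past M parent W Z n) = past M parent W Z n"
  unfolding past_def by (rule sigma_sets_sigma_sets_eq) (intro Un_least generated_events_subset)

lemma past_subset: "past M parent W Z n \<subseteq> Pow (space M)"
  unfolding past_def
  by (rule subsetI, rule PowI, erule sigma_sets_into_sp[rotated]) (intro Un_least generated_events_subset)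

lemma measurable_past_driving:
  assumes "m < n" "j \<in> {1..2 ^ m}" "t \<in> {real m..<real m + 1}"
  shows "W m j t \<in> borel_measurable (sigma (space M) (past M parent W Z n))"
proof -
  let ?I = "{(k, i, s) \<in> driving_index. k < n}"
  have "generated_events M ?I (\<lambda>(k, i, s). W k i s) \<subseteq> past M parent W Z n"
    unfolding past_def by (auto intro: sigma_sets.Basic)
  moreover have "(m, j, t) \<in> ?I" using assms by (auto simp: driving_index_def)
  ultimately show ?thesis
    using measurable_generated_events[where i="(m, j, t)" and X="\<lambda>(k, i, s). W k i s" and I="?I",
        OF _ _ past_subset] by simp
qed

text \<open>The model states independence for systems of events, while factorising expectations
  requires independent random variables. Measurability with respect to the generated sigma-algebras
  connects the two.\<close>

lemma (in prob_space) indep_vars_of_indep_sets: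
  assumes F: "indep_sets F I" and closed: "\<And>i. i \<in> I \<Longrightarrow> sigma_sets (space M) (F i) = F i"
    and X: "\<And>i. i \<in> I \<Longrightarrow> X i \<in> measurable (sigma (space M) (F i)) (N i)"
  shows "indep_vars N X I"
proof -
  have pre: "X i -` A \<inter> space M \<in> F i" if "i \<in> I" "A \<in> sets (N i)" for i A
  proof -
    have "F i \<subseteq> Pow (space M)" using F that(1) sets.sets_into_space unfolding indep_sets_def by blast
    then show ?thesis using measurable_sets[OF X[OF that(1)] that(2)] closed[OF that(1)]
      by (simp add: sets_measure_of space_measure_of)
  qed
  have "X i \<in> measurable M (N i)" if "i \<in> I" for i
  proof (rule measurableI)
    have "F i \<subseteq> Pow (space M)" using F that sets.sets_into_space unfolding indep_sets_def by blast
    then show "X i x \<in> space (N i)" if "x \<in> space M" for x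
      using measurable_space[OF X[OF \<open>i \<in> I\<close>], of x] that by (simp add: space_measure_of)
    show "X i -` A \<inter> space M \<in> sets M" if "A \<in> sets (N i)" for A
      using pre[OF \<open>i \<in> I\<close> that] F \<open>i \<in> I\<close> unfolding indep_sets_def by auto
  qed
  moreover have "indep_sets (\<lambda>i. {X i -` A \<inter> space M | A. A \<in> sets (N i)}) I"
    by (rule indep_sets_mono_sets[OF F]) (use pre in auto)
  ultimately show ?thesis unfolding indep_vars_def2 by auto
qed

section \<open>Characteristic functions of the discretised noise\<close>

context interacting_branching_diffusion
begin

text \<open>The vectors v are free coefficients. With v a combination of the \<open>weight\<close>s
  of two particles, multiplied by frequencies t and u, the total noise is the exponent in the joint
  characteristic function of their discretised positions.\<close>

abbreviation noise :: "(nat \<Rightarrow> nat \<Rightarrow> nat \<Rightarrow> real ^ 'd) \<Rightarrow> nat \<Rightarrow> nat \<Rightarrow> nat \<Rightarrow> 'w \<Rightarrow> real" where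
  "noise v K m j \<omega> \<equiv> (\<Sum>r<K. v m j r \<bullet> incr (\<lambda>m j t. W m j t \<omega>) K m j r)"

lemma grid_in:
  assumes "r \<le> K"
  shows "real m + real r / real (Suc K) \<in> {real m..<real m + 1}"
  using assms by auto

lemma W_measurable:
  "j \<in> {1..2 ^ m} \<Longrightarrow> t \<in> {real m..<real m + 1} \<Longrightarrow> W m j t \<in> borel_measurable M"
  using brownian[of j m] unfolding standard_brownian_motion_def by auto

lemma noise_measurable:
  assumes "\<And>t. t \<in> {real m..<real m + 1} \<Longrightarrow> W m j t \<in> borel_measurable F"
  shows "noise v K m j \<in> borel_measurable F"
  unfolding incr_def
  by (intro borel_measurable_sum borel_measurable_inner borel_measurable_diff borel_measurable_const assms grid_in) auto

lemma char_noise: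
  assumes j: "j \<in> {1..2 ^ m}"
  shows "(\<integral>\<omega>. iexp (noise v K m j \<omega>) \<partial>M) = exp (- (\<Sum>r<K. (norm (v m j r))\<^sup>2) / real (Suc K) / 2)"
proof -
  define \<tau> where "\<tau> r = real m + real r / real (Suc K)" for r
  have \<tau>: "strict_mono_on {..K} \<tau>" "\<tau> ` {..K} \<subseteq> {real m..<real m + 1}"
    using grid_in[of _ K m] by (auto simp: strict_mono_on_def \<tau>_def divide_strict_right_mono)
  have bm: "standard_brownian_motion (real m) (real m + 1) (W m j)" by (rule brownian[OF j])
  define D where "D r \<omega> = W m j (\<tau> (Suc r)) \<omega> - W m j (\<tau> r) \<omega>" for r \<omega>
  have ind: "indep_vars (\<lambda>_. borel) D {..<K}"
    using bm \<tau> unfolding standard_brownian_motion_def D_def[abs_def] by blast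
  have D: "(\<integral>\<omega>. iexp (u \<bullet> D r \<omega>) \<partial>M) = exp (- (1 / real (Suc K)) * (norm u)\<^sup>2 / 2)"
    if r: "r < K" for r u
  proof -
    have "real m \<le> \<tau> r" "\<tau> r < \<tau> (Suc r)" "\<tau> (Suc r) < real m + 1"
      using \<tau> r by (auto simp: strict_mono_on_def image_subset_iff)
    then have "distributed M lborel (D r) (\<lambda>x. ennreal (gaussian_density (\<tau> (Suc r) - \<tau> r) x))"
      using bm unfolding standard_brownian_motion_def D_def[abs_def] by blast
    moreover have "\<tau> (Suc r) - \<tau> r = 1 / real (Suc K)"
      by (simp add: \<tau>_def diff_divide_distrib[symmetric])
    ultimately have d: "distributed M lborel (D r) (\<lambda>x. ennreal (gauss_density (1 / real (Suc K)) x))"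
      by (simp add: gaussian_density_eq_gauss_density)
    have [measurable]: "D r \<in> borel_measurable M" using d by (simp add: distributed_def)
    have "(\<integral>\<omega>. iexp (u \<bullet> D r \<omega>) \<partial>M) = (\<integral>x. iexp (u \<bullet> x) \<partial>distr M lborel (D r))"
      by (subst integral_distr) auto
    also have "distr M lborel (D r) = gauss (1 / real (Suc K))"
      using d by (rule distributed_distr_eq_density)
    also have "(\<integral>x. iexp (u \<bullet> x) \<partial>gauss (1 / real (Suc K))) = exp (- (1 / real (Suc K)) * (norm u)\<^sup>2 / 2)"
      by (rule char_gauss) auto
    finally show ?thesis .
  qed
  have Dm: "D r \<in> borel_measurable M" if "r < K" for r
    using ind that unfolding indep_vars_def by auto
  have "(\<integral>\<omega>. iexp (noise v K m j \<omega>) \<partial>M) = (\<integral>\<omega>. (\<Prod>r<K. iexp (v m j r \<bullet> D r \<omega>)) \<partial>M)"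
    by (simp add: incr_def D_def \<tau>_def exp_sum sum_distrib_left del: of_nat_Suc)
  also have "\<dots> = (\<Prod>r<K. \<integral>\<omega>. iexp (v m j r \<bullet> D r \<omega>) \<partial>M)"
  proof (rule indep_vars_lebesgue_integral)
    show "indep_vars (\<lambda>_. borel) (\<lambda>r \<omega>. iexp (v m j r \<bullet> D r \<omega>)) {..<K}"
      by (rule indep_vars_compose2[OF ind, of "\<lambda>r x. iexp (v m j r \<bullet> x)"]) auto
    show "integrable M (\<lambda>\<omega>. iexp (v m j r \<bullet> D r \<omega>))" if "r \<in> {..<K}" for r
      using Dm[of r] that by (intro integrable_const_bound[where B=1]) auto
  qed auto
  also have "\<dots> = (\<Prod>r<K. of_real (exp (- (1 / real (Suc K)) * (norm (v m j r))\<^sup>2 / 2)))"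
    using D by (intro prod.cong) auto
  also have "\<dots> = of_real (exp (\<Sum>r<K. - (1 / real (Suc K)) * (norm (v m j r))\<^sup>2 / 2))"
    by (simp add: exp_sum)
  also have "(\<Sum>r<K. - (1 / real (Suc K)) * (norm (v m j r))\<^sup>2 / 2) = - (\<Sum>r<K. (norm (v m j r))\<^sup>2) / real (Suc K) / 2"
    by (simp add: sum_negf sum_divide_distrib del: of_nat_Suc)
  finally show ?thesis .
qed

text \<open>Induction on the slots: the noise of the slots before n is measurable with respect to
  the past up to time n, which is jointly independent of the motions on [n, n+1). The index
  \<open>None\<close> stands for the past, as in the model.\<close>

lemma char_total_noise:
  "(\<integral>\<omega>. (\<Prod>m<n. \<Prod>j=1..2 ^ m. iexp (noise v K m j \<omega>)) \<partial>M)
    = (\<Prod>m<n. \<Prod>j=1..2 ^ m. (\<integral>\<omega>. iexp (noise v K m j \<omega>) \<partial>M))"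
proof (induction n)
  case 0
  then show ?case by (simp add: prob_space)
next
  case (Suc n)
  define F where "F = case_option (past M parent W Z n) (\<lambda>i. generated_events M {real n..<real n + 1} (W n i))"
  define X where "X = case_option (\<lambda>\<omega>. \<Prod>m<n. \<Prod>j=1..2 ^ m. iexp (noise v K m j \<omega>)) (\<lambda>j \<omega>. iexp (noise v K n j \<omega>))"
  let ?I = "insert None (Some ` {1..2 ^ n :: nat})"
  have ind: "indep_vars (\<lambda>_. borel) X ?I"
  proof (rule indep_vars_of_indep_sets)
    show "indep_sets F ?I" unfolding F_def by (rule independent_of_past)
    show "sigma_sets (space M) (F i) = F i" if "i \<in> ?I" for i
      by (cases i) (simp_all add: F_def past_closed generated_events_closed)
    show "X i \<in> borel_measurable (sigma (space M) (F i))" if i: "i \<in> ?I" for i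
    proof (cases i)
      case None
      have "noise v K m j \<in> borel_measurable (sigma (space M) (past M parent W Z n))"
        if "m < n" "j \<in> {1..2 ^ m}" for m j
        using that by (intro noise_measurable measurable_past_driving) auto
      then show ?thesis unfolding None X_def F_def option.case
        by (intro borel_measurable_prod measurable_compose[of "noise v K _ _" _ borel iexp]) auto
    next
      case (Some j)
      have "noise v K n j \<in> borel_measurable (sigma (space M) (generated_events M {real n..<real n + 1} (W n j)))"
        by (intro noise_measurable measurable_generated_events[OF _ order_refl generated_events_subset]) auto
      then show ?thesis unfolding Some X_def F_def option.case
        by (intro measurable_compose[of "noise v K _ _" _ borel iexp]) auto
    qed
  qed
  have "(\<integral>\<omega>. (\<Prod>i\<in>?I. X i \<omega>) \<partial>M) = (\<Prod>i\<in>?I. \<integral>\<omega>. X i \<omega> \<partial>M)"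
  proof (rule indep_vars_lebesgue_integral[OF _ ind])
    fix i assume i: "i \<in> ?I"
    have "X i \<in> borel_measurable M" using ind i unfolding indep_vars_def by auto
    moreover have "norm (X i \<omega>) \<le> 1" for \<omega>
      by (cases i) (auto simp: X_def prod_norm[symmetric] intro!: prod_le_1)
    ultimately show "integrable M (X i)" by (intro integrable_const_bound[where B=1]) auto
  qed auto
  then have "(\<integral>\<omega>. X None \<omega> * (\<Prod>j=1..2 ^ n. X (Some j) \<omega>) \<partial>M)
      = (\<integral>\<omega>. X None \<omega> \<partial>M) * (\<Prod>j=1..2 ^ n. \<integral>\<omega>. X (Some j) \<omega> \<partial>M)"
    by (simp add: prod.reindex inj_on_def)
  then show ?case using Suc by (simp add: X_def)
qed

abbreviation parent_events :: "'w set set" where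
  "parent_events \<equiv> generated_events M parent_index (\<lambda>(m, i). parent m i)"

lemma parent_events_sets: "G \<in> parent_events \<Longrightarrow> G \<in> sets M"
  using indep_setD_ev1[OF labelling_independent] by auto

text \<open>The parent labels are independent of all driving motions together, so the indicator
  splits off. Independence of the past alone would not give this: the labels assigned at time m + 1
  do not belong to the past up to m, from which the motions on [m, m+1) are independent.\<close>

lemma char_noise_labelled:
  assumes G: "G \<in> parent_events"
  shows "(\<integral>\<omega>. indicator G \<omega> * iexp (\<Sum>m<n. \<Sum>j=1..2 ^ m. noise v K m j \<omega>) \<partial>M)
    = of_real (prob G * exp (- (\<Sum>m<n. \<Sum>j=1..2 ^ m. \<Sum>r<K. (norm (v m j r))\<^sup>2) / real (Suc K) / 2))"
proof -
  define Y where "Y \<omega> = (\<Prod>m<n. \<Prod>j=1..2 ^ m. iexp (noise v K m j \<omega>))" for \<omega>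
  define F where "F = case_bool parent_events (generated_events M driving_index (\<lambda>(m, i, t). W m i t))"
  define X where "X = case_bool (indicator G :: 'w \<Rightarrow> complex) Y"
  have ind: "indep_vars (\<lambda>_. borel) X UNIV"
  proof (rule indep_vars_of_indep_sets)
    show "indep_sets F UNIV"
      using labelling_independent unfolding F_def indep_set_def by (simp add: bool.case_distrib)
    show "sigma_sets (space M) (F i) = F i" for i
      by (cases i) (simp_all add: F_def generated_events_closed)
    show "X i \<in> borel_measurable (sigma (space M) (F i))" for i
    proof (cases i)
      case True
      have "G \<in> sets (sigma (space M) parent_events)"
        using G unfolding sets_measure_of[OF generated_events_subset] generated_events_closed .
      then show ?thesis using True unfolding X_def F_def by simp
    next
      case False
      have "W m j t \<in> borel_measurable (sigma (space M) (generated_events M driving_index (\<lambda>(m, i, t). W m i t)))"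
        if "j \<in> {1..2 ^ m}" "t \<in> {real m..<real m + 1}" for m j t
        using measurable_generated_events[of "(m, j, t)" driving_index M "\<lambda>(m, i, t). W m i t", OF _ order_refl generated_events_subset] that
        by (auto simp: driving_index_def)
      then have "noise v K m j \<in> borel_measurable (sigma (space M) (generated_events M driving_index (\<lambda>(m, i, t). W m i t)))"
        if "j \<in> {1..2 ^ m}" for m j
        using that by (intro noise_measurable) auto
      moreover have "i = False" using False by simp
      ultimately show ?thesis unfolding X_def F_def Y_def
        by (simp only: bool.case, intro borel_measurable_prod measurable_compose[of "noise v K _ _" _ borel iexp]) auto
    qed
  qed
  have norm_le: "norm (X i \<omega>) \<le> 1" for i \<omega>
    by (cases i) (auto simp: X_def Y_def indicator_def prod_norm[symmetric] intro!: prod_le_1)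
  have "(\<integral>\<omega>. (\<Prod>i\<in>UNIV. X i \<omega>) \<partial>M) = (\<Prod>i\<in>UNIV. \<integral>\<omega>. X i \<omega> \<partial>M)"
  proof (rule indep_vars_lebesgue_integral[OF _ ind])
    fix i
    have "X i \<in> borel_measurable M" using ind unfolding indep_vars_def by auto
    then show "integrable M (X i)" using norm_le by (intro integrable_const_bound[where B=1]) auto
  qed auto
  moreover have "(\<integral>\<omega>. indicator G \<omega> \<partial>M) = complex_of_real (prob G)"
  proof -
    have "(indicator G :: 'w \<Rightarrow> complex) = (\<lambda>\<omega>. complex_of_real (indicat_real G \<omega>))"
      by (auto simp: indicator_def fun_eq_iff)
    then show ?thesis using parent_events_sets[OF G] by simp
  qed
  ultimately have "(\<integral>\<omega>. indicator G \<omega> * Y \<omega> \<partial>M) = of_real (prob G) * (\<integral>\<omega>. Y \<omega> \<partial>M)"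
    by (simp add: UNIV_bool X_def mult.commute)
  also have "(\<integral>\<omega>. Y \<omega> \<partial>M) = (\<Prod>m<n. \<Prod>j=1..2 ^ m. of_real (exp (- (\<Sum>r<K. (norm (v m j r))\<^sup>2) / real (Suc K) / 2)))"
    unfolding Y_def char_total_noise by (intro prod.cong refl char_noise)
  also have "\<dots> = of_real (exp (\<Sum>m<n. \<Sum>j=1..2 ^ m. - (\<Sum>r<K. (norm (v m j r))\<^sup>2) / real (Suc K) / 2))"
    by (simp add: exp_sum)
  also have "(\<Sum>m<n. \<Sum>j=1..2 ^ m. - (\<Sum>r<K. (norm (v m j r))\<^sup>2) / real (Suc K) / 2)
      = - (\<Sum>m<n. \<Sum>j=1..2 ^ m. \<Sum>r<K. (norm (v m j r))\<^sup>2) / real (Suc K) / 2"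
    by (simp add: sum_negf sum_divide_distrib del: of_nat_Suc)
  also have "Y = (\<lambda>\<omega>. iexp (\<Sum>m<n. \<Sum>j=1..2 ^ m. noise v K m j \<omega>))"
  proof -
    have "iexp (\<Sum>m<n. \<Sum>j=1..2 ^ m. f m j) = (\<Prod>m<n. \<Prod>j=1..2 ^ m. iexp (f m j))" for f :: "nat \<Rightarrow> nat \<Rightarrow> real"
      by (simp add: exp_sum sum_distrib_left)
    then show ?thesis unfolding Y_def by presburger
  qed
  finally show ?thesis by simp
qed

end

text \<open>Under \<open>uniform_measure M G\<close> the hypothesis says that X and \<mu> have the
  same characteristic function. A null event G admits no such measure and is treated apart; both
  sides are then 0.\<close>

lemma (in prob_space) conditional_law_of_char:
  fixes X :: "'a \<Rightarrow> 'e::euclidean_space"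
  assumes G [measurable]: "G \<in> events" and X [measurable]: "X \<in> borel_measurable M"
    and \<mu>: "prob_space \<mu>" "sets \<mu> = sets borel"
    and char: "\<And>t. (\<integral>\<omega>. indicator G \<omega> * iexp (t \<bullet> X \<omega>) \<partial>M) = of_real (prob G) * (\<integral>x. iexp (t \<bullet> x) \<partial>\<mu>)"
    and A [measurable]: "A \<in> sets borel"
  shows "emeasure M (G \<inter> (X -` A \<inter> space M)) = ennreal (prob G) * emeasure \<mu> A"
proof (cases "prob G = 0")
  case True
  then have "emeasure M G = 0" by (simp add: emeasure_eq_measure)
  then have "emeasure M (G \<inter> (X -` A \<inter> space M)) = 0"
    using emeasure_mono[of "G \<inter> (X -` A \<inter> space M)" G M] by simp
  then show ?thesis using True by simp
next
  case False
  then have pos: "prob G > 0" using measure_nonneg[of M G] by linarith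
  then have em: "emeasure M G \<noteq> 0" "emeasure M G \<noteq> \<infinity>" by (auto simp: emeasure_eq_measure)
  define N where "N = uniform_measure M G"
  have [measurable_cong]: "sets N = sets M" by (simp add: N_def)
  interpret N: prob_space N unfolding N_def using em by (rule prob_space_uniform_measure)
  have N: "N = density M (\<lambda>\<omega>. ennreal (indicator G \<omega> / prob G))"
    unfolding N_def uniform_measure_def using pos divide_ennreal[of 1 "prob G"]
    by (auto intro!: density_cong simp: emeasure_eq_measure indicator_def)
  have "distr N borel X = \<mu>"
  proof (rule measure_eqI_char[OF _ _ \<mu>])
    show "prob_space (distr N borel X)" by (rule N.prob_space_distr) simp
    fix t :: 'e
    have "(\<integral>x. iexp (t \<bullet> x) \<partial>distr N borel X) = (\<integral>\<omega>. iexp (t \<bullet> X \<omega>) \<partial>N)"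
      by (subst integral_distr) auto
    also have "\<dots> = (\<integral>\<omega>. (indicator G \<omega> / prob G) *\<^sub>R iexp (t \<bullet> X \<omega>) \<partial>M)"
      unfolding N by (subst integral_density) (use pos in auto)
    also have "\<dots> = (\<integral>\<omega>. (indicator G \<omega> * iexp (t \<bullet> X \<omega>)) / of_real (prob G) \<partial>M)"
      by (intro Bochner_Integration.integral_cong refl) (auto simp: indicator_def scaleR_conv_of_real)
    also have "\<dots> = (\<integral>x. iexp (t \<bullet> x) \<partial>\<mu>)"
      using pos unfolding integral_divide_zero char by simp
    finally show "(\<integral>x. iexp (t \<bullet> x) \<partial>distr N borel X) = (\<integral>x. iexp (t \<bullet> x) \<partial>\<mu>)" .
  qed simp
  then have "emeasure \<mu> A = emeasure N (X -` A \<inter> space M)"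
    by (subst \<open>_ = \<mu>\<close>[symmetric], subst emeasure_distr) (auto simp: N_def)
  also have "\<dots> = emeasure M (G \<inter> (X -` A \<inter> space M)) / emeasure M G"
    unfolding N_def by (rule emeasure_uniform_measure) auto
  finally show ?thesis
    using em pos by (simp add: emeasure_eq_measure ennreal_mult_divide_eq[symmetric] divide_ennreal ennreal_mult[symmetric])
qed

lemma share_self: "share g n i i = n"
  by (simp add: share_def)

section \<open>Laws of one and of two particles given the genealogy\<close>

context interacting_branching_diffusion
begin

definition genealogy_event :: "nat \<Rightarrow> (nat \<Rightarrow> nat \<Rightarrow> nat) \<Rightarrow> 'w set" where
  "genealogy_event n g = {\<omega> \<in> space M. \<forall>m\<in>{..<n}. \<forall>i\<in>{1..2 ^ Suc m}. parent m i \<omega> = g m i}"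

lemma genealogy_event_in: "genealogy_event n g \<in> parent_events"
proof -
  let ?N = "sigma (space M) parent_events"
  have "{\<omega> \<in> space ?N. parent m i \<omega> = g m i} \<in> sets ?N" if "i \<in> {1..2 ^ Suc m}" for m i
  proof -
    have "parent m i \<in> borel_measurable ?N"
      using measurable_generated_events[where i="(m, i)" and X="\<lambda>(m, i). parent m i" and I=parent_index,
          OF _ order_refl generated_events_subset] that by (simp add: parent_index_def)
    from measurable_sets[OF this, of "{g m i}"] show ?thesis
      by (simp add: vimage_def Int_def conj_commute)
  qed
  then have "{\<omega> \<in> space ?N. \<forall>m\<in>{..<n}. \<forall>i\<in>{1..2 ^ Suc m}. parent m i \<omega> = g m i} \<in> sets ?N"
    by (intro sets.sets_Collect_finite_All) auto
  then have "genealogy_event n g \<in> sets ?N" by (simp add: genealogy_event_def space_measure_of_conv)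
  then show ?thesis unfolding sets_measure_of[OF generated_events_subset] generated_events_closed .
qed

lemma genealogy_event_sets [measurable]: "genealogy_event n g \<in> sets M"
  by (rule parent_events_sets[OF genealogy_event_in])

text \<open>On the event the random parents coincide with the fixed maps g, and what remains is a
  statement about single paths.\<close>

lemma AE_approx_tendsto:
  assumes b: "b + \<gamma> = 0" and g: "genealogy n g" and i: "i \<in> {1..2 ^ n}"
  shows "AE \<omega> in M. \<omega> \<in> genealogy_event n g \<longrightarrow>
    (\<lambda>K. approx b (\<lambda>m j t. W m j t \<omega>) g n i K) \<longlonglongrightarrow> Z (real n) i \<omega>"
  using start born_at_parent continuous_paths sde
proof eventually_elim
  case (elim \<omega>)
  show ?case
  proof
    assume G: "\<omega> \<in> genealogy_event n g"
    show "(\<lambda>K. approx b (\<lambda>m j t. W m j t \<omega>) g n i K) \<longlonglongrightarrow> Z (real n) i \<omega>"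
    proof (rule approx_tendsto[where z="\<lambda>t i. Z t i \<omega>", OF g _ _ _ _ i])
      show "Z 0 1 \<omega> = 0" by (rule elim(1))
      show "((\<lambda>t. Z t (g m i) \<omega>) \<longlongrightarrow> Z (real (Suc m)) i \<omega>) (at_left (real (Suc m)))"
        if "m < n" "i \<in> {1..2 ^ Suc m}" for m i
      proof -
        have "parent m i \<omega> = g m i" using G that unfolding genealogy_event_def by blast
        then show ?thesis using elim(2) that(2) by metis
      qed
      show "continuous_on {real m..<real m + 1} (\<lambda>t. Z t i \<omega>)" if "i \<in> {1..2 ^ m}" for m i
        using elim(3) that by blast
      show "Z t i \<omega> = Z (real m) i \<omega> + (W m i t \<omega> - W m i (real m) \<omega>)
          - b *\<^sub>R integral {real m..t} (\<lambda>s. mean m (\<lambda>j. Z s j \<omega>))"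
        if "i \<in> {1..2 ^ m}" "t \<in> {real m..<real m + 1}" for m i t
        using elim(4) that by (simp add: drift_eq_mean[OF b])
    qed
  qed
qed

lemma approx_measurable [measurable]:
  "(\<lambda>\<omega>. approx b (\<lambda>m j t. W m j t \<omega>) g n i K) \<in> borel_measurable M"
  unfolding approx_def incr_def
  by (intro borel_measurable_sum borel_measurable_scaleR borel_measurable_diff borel_measurable_const W_measurable grid_in) auto

lemma Z_measurable' [measurable]: "i \<in> {1..2 ^ n} \<Longrightarrow> Z (real n) i \<in> borel_measurable M"
  by (rule Z_measurable) (auto simp: labels_def)

text \<open>For each K the discretised pair has an exactly Gaussian transform. The left side
  converges along all K by dominated convergence, so on the right it is enough to follow a
  subsequence on which \<open>excess\<close> converges; the factor K / (K + 1) tends to 1.\<close>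

lemma char_pair:
  assumes b: "b + \<gamma> = 0" "b > 0" and g: "genealogy n g"
    and i: "i \<in> {1..2 ^ n}" "i' \<in> {1..2 ^ n}"
    and r: "strict_mono r" "(\<lambda>k. excess b n (r k)) \<longlonglongrightarrow> \<delta>"
  shows "(\<integral>\<omega>. indicator (genealogy_event n g) \<omega> * iexp (t \<bullet> Z (real n) i \<omega> + u \<bullet> Z (real n) i' \<omega>) \<partial>M)
    = of_real (prob (genealogy_event n g)) * of_real (exp (- ((real n + \<delta>) * ((norm t)\<^sup>2 + (norm u)\<^sup>2)
        + 2 * (real (share g n i i') + \<delta>) * (t \<bullet> u)) / 2))"
proof -
  let ?G = "genealogy_event n g"
  let ?A = "\<lambda>i K \<omega>. approx b (\<lambda>m j t. W m j t \<omega>) g n i K"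
  define c where "c s K = real s * (real K / real (Suc K)) + excess b n K" for s K
  have int: "(\<integral>\<omega>. indicator ?G \<omega> * iexp (t \<bullet> ?A i K \<omega> + u \<bullet> ?A i' K \<omega>) \<partial>M)
      = of_real (prob ?G * exp (- (c n K * ((norm t)\<^sup>2 + (norm u)\<^sup>2) + 2 * c (share g n i i') K * (t \<bullet> u)) / 2))" for K
  proof -
    define v where "v m j r = weight b g n i K m j r *\<^sub>R t + weight b g n i' K m j r *\<^sub>R u" for m j r
    have "t \<bullet> ?A i K \<omega> + u \<bullet> ?A i' K \<omega> = (\<Sum>m<n. \<Sum>j=1..2 ^ m. noise v K m j \<omega>)" for \<omega>
      by (simp add: approx_def v_def inner_sum_right inner_add_left sum.distrib)
    moreover have "(\<Sum>m<n. \<Sum>j=1..2 ^ m. \<Sum>r<K. (norm (v m j r))\<^sup>2) / real (Suc K)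
       = c n K * ((norm t)\<^sup>2 + (norm u)\<^sup>2) + 2 * c (share g n i i') K * (t \<bullet> u)"
    proof -
      have "(norm (v m j r))\<^sup>2 = weight b g n i K m j r * weight b g n i K m j r * (norm t)\<^sup>2
          + weight b g n i' K m j r * weight b g n i' K m j r * (norm u)\<^sup>2
          + weight b g n i K m j r * weight b g n i' K m j r * (2 * (t \<bullet> u))" for m j r
        unfolding v_def power2_norm_eq_inner
        by (simp add: inner_add_left inner_add_right inner_commute algebra_simps)
      then have "(\<Sum>m<n. \<Sum>j=1..2 ^ m. \<Sum>r<K. (norm (v m j r))\<^sup>2) / real (Suc K)
        = (\<Sum>m<n. \<Sum>j=1..2 ^ m. \<Sum>r<K. weight b g n i K m j r * weight b g n i K m j r) / real (Suc K) * (norm t)\<^sup>2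
        + (\<Sum>m<n. \<Sum>j=1..2 ^ m. \<Sum>r<K. weight b g n i' K m j r * weight b g n i' K m j r) / real (Suc K) * (norm u)\<^sup>2
        + (\<Sum>m<n. \<Sum>j=1..2 ^ m. \<Sum>r<K. weight b g n i K m j r * weight b g n i' K m j r) / real (Suc K) * (2 * (t \<bullet> u))"
        by (simp only: sum.distrib sum_distrib_right[symmetric] add_divide_distrib times_divide_eq_left)
      then show ?thesis
        unfolding sum_weight_product[OF g i(1) i(1)] sum_weight_product[OF g i(2) i(2)] sum_weight_product[OF g i]
          share_self c_def by (simp add: algebra_simps)
    qed
    ultimately show ?thesis
      using char_noise_labelled[OF genealogy_event_in, where v=v and K=K and n=n]
      by (simp only: minus_divide_left[symmetric])
  qed
  have "(\<lambda>K. \<integral>\<omega>. indicator ?G \<omega> * iexp (t \<bullet> ?A i K \<omega> + u \<bullet> ?A i' K \<omega>) \<partial>M)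
      \<longlonglongrightarrow> (\<integral>\<omega>. indicator ?G \<omega> * iexp (t \<bullet> Z (real n) i \<omega> + u \<bullet> Z (real n) i' \<omega>) \<partial>M)"
  proof (rule integral_dominated_convergence[where w="\<lambda>_. 1"])
    show "AE \<omega> in M. (\<lambda>K. indicator ?G \<omega> * iexp (t \<bullet> ?A i K \<omega> + u \<bullet> ?A i' K \<omega>))
        \<longlonglongrightarrow> indicator ?G \<omega> * iexp (t \<bullet> Z (real n) i \<omega> + u \<bullet> Z (real n) i' \<omega>)"
      using AE_approx_tendsto[OF b(1) g i(1)] AE_approx_tendsto[OF b(1) g i(2)]
    proof eventually_elim
      case (elim \<omega>)
      show ?case
      proof (cases "\<omega> \<in> ?G")
        case True
        then show ?thesis using elim by (intro tendsto_intros) auto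
      qed simp
    qed
    show "(\<lambda>\<omega>. indicator ?G \<omega> * iexp (t \<bullet> Z (real n) i \<omega> + u \<bullet> Z (real n) i' \<omega>)) \<in> borel_measurable M"
      using i by measurable
    show "\<And>K. AE \<omega> in M. norm (indicator ?G \<omega> * iexp (t \<bullet> ?A i K \<omega> + u \<bullet> ?A i' K \<omega>)) \<le> 1"
      by (intro AE_I2) (auto simp: norm_mult indicator_def)
  qed auto
  then have "(\<lambda>k. complex_of_real (prob ?G * exp (- (c n (r k) * ((norm t)\<^sup>2 + (norm u)\<^sup>2) + 2 * c (share g n i i') (r k) * (t \<bullet> u)) / 2)))
      \<longlonglongrightarrow> (\<integral>\<omega>. indicator ?G \<omega> * iexp (t \<bullet> Z (real n) i \<omega> + u \<bullet> Z (real n) i' \<omega>) \<partial>M)"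
    unfolding int using LIMSEQ_subseq_LIMSEQ[OF _ r(1)] by (fastforce simp: o_def)
  moreover have "(\<lambda>k. c s (r k)) \<longlonglongrightarrow> real s * 1 + \<delta>" for s
    unfolding c_def using LIMSEQ_subseq_LIMSEQ[OF LIMSEQ_n_over_Suc_n[where 'a=real] r(1)] r(2)
    by (intro tendsto_intros) (auto simp: o_def)
  then have "(\<lambda>k. complex_of_real (prob ?G * exp (- (c n (r k) * ((norm t)\<^sup>2 + (norm u)\<^sup>2) + 2 * c (share g n i i') (r k) * (t \<bullet> u)) / 2)))
      \<longlonglongrightarrow> complex_of_real (prob ?G * exp (- ((real n * 1 + \<delta>) * ((norm t)\<^sup>2 + (norm u)\<^sup>2) + 2 * (real (share g n i i') * 1 + \<delta>) * (t \<bullet> u)) / 2))"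
    by (intro tendsto_intros) auto
  ultimately show ?thesis by (simp add: LIMSEQ_unique)
qed

text \<open>The pair (i, i) with second frequency 0 reduces the joint transform to that of one
  particle.\<close>

lemma prob_single:
  assumes b: "b + \<gamma> = 0" "b > 0" and g: "genealogy n g" and i: "i \<in> {1..2 ^ n}"
    and r: "strict_mono r" "(\<lambda>k. excess b n (r k)) \<longlonglongrightarrow> \<delta>"
    and pos: "real n + \<delta> > 0" and B: "B \<in> sets borel"
  shows "prob (genealogy_event n g \<inter> (Z (real n) i -` B \<inter> space M))
    = prob (genealogy_event n g) * measure (gauss (real n + \<delta>)) B"
proof -
  define a where "a = real n + \<delta>"
  note pos = pos[folded a_def]
  interpret \<Gamma>: prob_space "gauss a :: (real ^ 'd) measure" by (rule prob_space_gauss[OF pos])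
  have "emeasure M (genealogy_event n g \<inter> (Z (real n) i -` B \<inter> space M))
      = ennreal (prob (genealogy_event n g)) * emeasure (gauss a) B"
  proof (rule conditional_law_of_char[OF _ _ \<Gamma>.prob_space_axioms _ _ B])
    show "(\<integral>\<omega>. indicator (genealogy_event n g) \<omega> * iexp (t \<bullet> Z (real n) i \<omega>) \<partial>M)
      = of_real (prob (genealogy_event n g)) * (\<integral>x. iexp (t \<bullet> x) \<partial>gauss a)" for t
      using char_pair[OF b g i i r, of t 0] unfolding a_def[symmetric] by (simp add: char_gauss[OF pos])
  qed (use i in auto)
  then show ?thesis
    by (simp add: a_def[symmetric] emeasure_eq_measure \<Gamma>.emeasure_eq_measure ennreal_mult[symmetric])
qed

text \<open>\<open>corr\<close> gives a positive variance and a correlation strictly between -1 and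
  1. The conditional law of the pair is then a \<open>gauss_pair\<close>, to which the comparison
  with the product law applies.\<close>

lemma prob_pair_le:
  assumes b: "b + \<gamma> = 0" "b > 0" and g: "genealogy n g" and i: "i \<in> {1..2 ^ n}" "i' \<in> {1..2 ^ n}"
    and r: "strict_mono r" "(\<lambda>k. excess b n (r k)) \<longlonglongrightarrow> \<delta>"
    and corr: "\<bar>real (share g n i i') + \<delta>\<bar> < real n + \<delta>"
    and B: "B \<in> sets borel" "\<And>x. x \<in> B \<Longrightarrow> norm x \<le> R"
  shows "prob (genealogy_event n g \<inter> (Z (real n) i -` B \<inter> Z (real n) i' -` B \<inter> space M))
    \<le> prob (genealogy_event n g) * (corr_factor CARD('d) R (real n + \<delta>)
         ((real (share g n i i') + \<delta>) / (real n + \<delta>)) * (measure (gauss (real n + \<delta>)) B)\<^sup>2)"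
proof -
  define a where "a = real n + \<delta>"
  define \<rho> where "\<rho> = (real (share g n i i') + \<delta>) / a"
  have pos: "a > 0" using corr unfolding a_def by linarith
  have \<rho>: "\<bar>\<rho>\<bar> < 1" using corr pos unfolding \<rho>_def a_def by (simp add: abs_divide)
  have a\<rho>: "a * \<rho> = real (share g n i i') + \<delta>" using pos by (simp add: \<rho>_def)
  interpret \<Gamma>: prob_space "gauss a :: (real ^ 'd) measure" by (rule prob_space_gauss[OF pos])
  have [measurable]: "Z (real n) i \<in> borel_measurable M" "Z (real n) i' \<in> borel_measurable M"
    using i by (auto intro: Z_measurable')
  have BB: "B \<times> B \<in> sets borel" using B by (simp add: borel_prod[symmetric])
  have "emeasure M (genealogy_event n g \<inter> ((\<lambda>\<omega>. (Z (real n) i \<omega>, Z (real n) i' \<omega>)) -` (B \<times> B) \<inter> space M))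
      = ennreal (prob (genealogy_event n g)) * emeasure (gauss_pair a \<rho>) (B \<times> B)"
  proof (rule conditional_law_of_char[OF _ _ prob_space_gauss_pair[OF pos \<rho>] _ _ BB])
    fix t :: "(real ^ 'd) \<times> (real ^ 'd)"
    show "(\<integral>\<omega>. indicator (genealogy_event n g) \<omega> * iexp (t \<bullet> (Z (real n) i \<omega>, Z (real n) i' \<omega>)) \<partial>M)
      = of_real (prob (genealogy_event n g)) * (\<integral>x. iexp (t \<bullet> x) \<partial>gauss_pair a \<rho>)"
    proof (cases t)
      case (Pair t1 t2)
      show ?thesis
        using char_pair[OF b g i r, of t1 t2]
        unfolding Pair char_gauss_pair[OF pos \<rho>] a\<rho> a_def[symmetric] by simp
    qed
  qed (auto simp: gauss_pair_def)
  also have "(\<lambda>\<omega>. (Z (real n) i \<omega>, Z (real n) i' \<omega>)) -` (B \<times> B) \<inter> space M = Z (real n) i -` B \<inter> Z (real n) i' -` B \<inter> space M"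
    by auto
  also have "ennreal (prob (genealogy_event n g)) * emeasure (gauss_pair a \<rho>) (B \<times> B)
      \<le> ennreal (prob (genealogy_event n g)) * (ennreal (corr_factor DIM(real ^ 'd) R a \<rho>) * (emeasure (gauss a) B)\<^sup>2)"
    by (intro mult_left_mono emeasure_gauss_pair_le pos \<rho> B) auto
  also have "\<dots> = ennreal (prob (genealogy_event n g) * (corr_factor CARD('d) R a \<rho> * (measure (gauss a) B)\<^sup>2))"
    by (simp add: \<Gamma>.emeasure_eq_measure ennreal_power ennreal_mult corr_factor_def)
  finally show ?thesis
    by (simp add: emeasure_eq_measure a_def \<rho>_def corr_factor_def)
qed

end

section \<open>Second moment of the particle count\<close>

lemma measure_gauss_bounds:
  fixes B :: "'e::euclidean_space set"
  assumes a: "a > 0" and B [measurable]: "B \<in> sets borel" and R: "\<And>x. x \<in> B \<Longrightarrow> norm x \<le> R"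
  shows "measure (gauss a) B \<le> (2 * pi * a) powr (- real DIM('e) / 2) * measure lborel B"
    and "(2 * pi * a) powr (- real DIM('e) / 2) * exp (- R\<^sup>2 / (2 * a)) * measure lborel B \<le> measure (gauss a) B"
proof -
  interpret \<Gamma>: prob_space "gauss a :: 'e measure" using a by (rule prob_space_gauss)
  define c where "c = (2 * pi * a) powr (- real DIM('e) / 2)"
  have c: "c \<ge> 0" by (simp add: c_def)
  have "bounded B" using R by (auto simp: bounded_iff)
  then have fin: "emeasure lborel B = ennreal (measure lborel B)"
    using emeasure_bounded_finite[of B] by (simp add: emeasure_eq_ennreal_measure)
  have eq: "ennreal (measure (gauss a) B) = (\<integral>\<^sup>+x. ennreal (gauss_density a x) * indicator B x \<partial>lborel)"
    by (simp add: \<Gamma>.emeasure_eq_measure[symmetric] emeasure_density)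
  have dens: "gauss_density a x \<le> c" "x \<in> B \<Longrightarrow> c * exp (- R\<^sup>2 / (2 * a)) \<le> gauss_density a x" for x :: 'e
  proof -
    show "gauss_density a x \<le> c"
      unfolding gauss_density_eq[OF a] c_def[symmetric] using a c by (simp add: mult_left_le)
    assume "x \<in> B"
    then have "(norm x)\<^sup>2 \<le> R\<^sup>2" using R[of x] by (intro power_mono) auto
    then have "- R\<^sup>2 / (2 * a) \<le> - (norm x)\<^sup>2 / (2 * a)"
      using a by (intro divide_right_mono) auto
    then show "c * exp (- R\<^sup>2 / (2 * a)) \<le> gauss_density a x"
      unfolding gauss_density_eq[OF a] c_def[symmetric] using c by (simp add: mult_left_mono)
  qed
  have "ennreal (measure (gauss a) B) \<le> (\<integral>\<^sup>+x. ennreal c * indicator B x \<partial>lborel)"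
    unfolding eq by (intro nn_integral_mono mult_right_mono ennreal_leI dens) auto
  also have "\<dots> = ennreal (c * measure lborel B)"
    using c by (simp add: nn_integral_cmult fin ennreal_mult)
  finally show "measure (gauss a) B \<le> (2 * pi * a) powr (- real DIM('e) / 2) * measure lborel B"
    using c unfolding c_def[symmetric] by simp
  have "ennreal (c * exp (- R\<^sup>2 / (2 * a)) * measure lborel B) = (\<integral>\<^sup>+x. ennreal (c * exp (- R\<^sup>2 / (2 * a))) * indicator B x \<partial>lborel)"
    using c by (simp add: nn_integral_cmult fin ennreal_mult)
  also have "\<dots> \<le> (\<integral>\<^sup>+x. ennreal (gauss_density a x) * indicator B x \<partial>lborel)"
    using dens(2) by (intro nn_integral_mono) (auto simp: indicator_def intro!: ennreal_leI)
  finally show "(2 * pi * a) powr (- real DIM('e) / 2) * exp (- R\<^sup>2 / (2 * a)) * measure lborel B \<le> measure (gauss a) B"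
    unfolding eq[symmetric] c_def[symmetric] by simp
qed

text \<open>Boundedness alone forces n / (n + \<delta> n) to tend to 1. The corrections are chosen
  separately for each n and may oscillate.\<close>

lemma measure_gauss_asymptotics:
  fixes B :: "'e::euclidean_space set" and \<delta> :: "nat \<Rightarrow> real"
  assumes \<delta>: "\<And>n. \<bar>\<delta> n\<bar> \<le> C" and B: "B \<in> sets borel" "\<And>x. x \<in> B \<Longrightarrow> norm x \<le> R"
  shows "(\<lambda>n. (2 * pi) powr (real DIM('e) / 2) * (real n powr (real DIM('e) / 2) * measure (gauss (real n + \<delta> n)) B))
    \<longlonglongrightarrow> measure lborel B"
proof -
  let ?d = "real DIM('e) / 2"
  define a where "a n = real n + \<delta> n" for n
  define x where "x n = (real n / a n) powr ?d" for n
  have \<delta>n: "(\<lambda>n. \<delta> n / real n) \<longlonglongrightarrow> 0"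
  proof (rule tendsto_0_le[where K=1])
    show "(\<lambda>n. C / real n) \<longlonglongrightarrow> 0" by (rule lim_const_over_n)
    have "C \<ge> 0" using \<delta>[of 0] by linarith
    then show "\<forall>\<^sub>F n in sequentially. norm (\<delta> n / real n) \<le> norm (C / real n) * 1"
      using \<delta> by (intro always_eventually) (auto simp: divide_right_mono)
  qed
  have ev: "eventually (\<lambda>n. n > 0 \<and> a n > 0) sequentially"
  proof -
    obtain N :: nat where N: "real N > C" using reals_Archimedean2 by blast
    show ?thesis
      using eventually_gt_at_top[of "max N 0"]
    proof eventually_elim
      case (elim n)
      then have "real n > C" "n > 0" using N by auto
      then show ?case using \<delta>[of n] unfolding a_def by (auto simp: abs_le_iff)
    qed
  qed
  have "(\<lambda>n. 1 + \<delta> n / real n) \<longlonglongrightarrow> 1 + 0" by (intro tendsto_intros \<delta>n)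
  then have "(\<lambda>n. 1 / (1 + \<delta> n / real n)) \<longlonglongrightarrow> 1 / 1" by (intro tendsto_intros) auto
  moreover have "eventually (\<lambda>n. 1 / (1 + \<delta> n / real n) = real n / a n) sequentially"
    using ev by eventually_elim (auto simp: a_def field_simps)
  ultimately have na: "(\<lambda>n. real n / a n) \<longlonglongrightarrow> 1"
    by (auto intro: Lim_transform_eventually)
  then have x: "x \<longlonglongrightarrow> 1"
    unfolding x_def using tendsto_powr[OF na tendsto_const[of ?d]] by simp
  have "(\<lambda>n. (real n / a n) * (1 / real n)) \<longlonglongrightarrow> 1 * 0"
    by (intro tendsto_mult na lim_const_over_n)
  moreover have "eventually (\<lambda>n. (real n / a n) * (1 / real n) = 1 / a n) sequentially"
    using ev by eventually_elim auto
  ultimately have "(\<lambda>n. 1 / a n) \<longlonglongrightarrow> 0"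
    by (auto intro: Lim_transform_eventually)
  then have "(\<lambda>n. exp (- (R\<^sup>2 / 2) * (1 / a n))) \<longlonglongrightarrow> exp (- (R\<^sup>2 / 2) * 0)"
    by (intro tendsto_intros)
  then have ex: "(\<lambda>n. exp (- R\<^sup>2 / (2 * a n))) \<longlonglongrightarrow> 1" by simp
  have pw: "(2 * pi) powr ?d * (real n powr ?d * (2 * pi * a n) powr (- real DIM('e) / 2)) = x n" if "n > 0" "a n > 0" for n
  proof -
    have "(2 * pi * a n) powr (- real DIM('e) / 2) = 1 / ((2 * pi) powr ?d * a n powr ?d)"
      using that by (simp add: powr_minus_divide powr_mult)
    then show ?thesis using that by (simp add: x_def powr_divide)
  qed
  show ?thesis
  proof (rule tendsto_sandwich)
    show "eventually (\<lambda>n. x n * exp (- R\<^sup>2 / (2 * a n)) * measure lborel B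
        \<le> (2 * pi) powr ?d * (real n powr ?d * measure (gauss (real n + \<delta> n)) B)) sequentially"
      using ev
    proof eventually_elim
      case (elim n)
      have "x n * exp (- R\<^sup>2 / (2 * a n)) * measure lborel B
          = (2 * pi) powr ?d * (real n powr ?d * ((2 * pi * a n) powr (- real DIM('e) / 2) * exp (- R\<^sup>2 / (2 * a n)) * measure lborel B))"
        using pw[of n, symmetric] elim by simp
      also have "\<dots> \<le> (2 * pi) powr ?d * (real n powr ?d * measure (gauss (a n)) B)"
        using elim by (intro mult_left_mono measure_gauss_bounds(2) B) auto
      finally show ?case by (simp add: a_def)
    qed
    show "eventually (\<lambda>n. (2 * pi) powr ?d * (real n powr ?d * measure (gauss (real n + \<delta> n)) B) \<le> x n * measure lborel B) sequentially"
      using ev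
    proof eventually_elim
      case (elim n)
      have "(2 * pi) powr ?d * (real n powr ?d * measure (gauss (a n)) B)
          \<le> (2 * pi) powr ?d * (real n powr ?d * ((2 * pi * a n) powr (- real DIM('e) / 2) * measure lborel B))"
        using elim by (intro mult_left_mono measure_gauss_bounds(1)[where R=R] B) auto
      also have "\<dots> = x n * measure lborel B"
        using pw[of n, symmetric] elim by simp
      finally show ?case by (simp add: a_def)
    qed
    show "(\<lambda>n. x n * exp (- R\<^sup>2 / (2 * a n)) * measure lborel B) \<longlonglongrightarrow> measure lborel B"
      using tendsto_mult[OF tendsto_mult[OF x ex] tendsto_const[of "measure lborel B"]] by simp
    show "(\<lambda>n. x n * measure lborel B) \<longlonglongrightarrow> measure lborel B"
      using tendsto_mult[OF x tendsto_const[of "measure lborel B"]] by simp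
  qed
qed

text \<open>Turns the relative error of the pair probability into an absolute one: the square of the
  scaled mean is bounded uniformly in n.\<close>

lemma power_times_gauss_square_le:
  fixes B :: "'e::euclidean_space set"
  assumes n: "n > 0" and a: "a \<ge> real n / 2" and B: "B \<in> sets borel" "\<And>x. x \<in> B \<Longrightarrow> norm x \<le> R"
  shows "real n ^ DIM('e) * (measure (gauss a) B)\<^sup>2 \<le> (measure lborel B)\<^sup>2"
proof -
  let ?d = "real DIM('e) / 2"
  have a0: "a > 0" using n a by linarith
  have "1 * a \<le> pi * a" using a0 pi_gt3 by (intro mult_right_mono) auto
  then have na: "real n \<le> 2 * pi * a" using a by linarith
  have "real n powr ?d * measure (gauss a) B \<le> (2 * pi * a) powr ?d * ((2 * pi * a) powr (- real DIM('e) / 2) * measure lborel B)"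
    using na n a0 by (intro mult_mono powr_mono2 measure_gauss_bounds(1)[where R=R] B) auto
  also have "\<dots> = measure lborel B"
    using a0 by (simp add: powr_minus_divide)
  finally have "(real n powr ?d * measure (gauss a) B)\<^sup>2 \<le> (measure lborel B)\<^sup>2"
    by (intro power_mono) auto
  moreover have "(real n powr ?d)\<^sup>2 = real n ^ DIM('e)"
    using n by (simp add: powr_realpow[symmetric] powr_powr flip: powr_numeral)
  ultimately show ?thesis by (simp add: power_mult_distrib)
qed

lemma summable_poly_geometric: "summable (\<lambda>k. real (Suc k) ^ p / 2 ^ k)"
proof -
  have "(\<lambda>k. (1 + 1 / real (Suc k)) ^ p) \<longlonglongrightarrow> (1 + 0) ^ p"
    using LIMSEQ_inverse_real_of_nat by (intro tendsto_intros) (simp add: inverse_eq_divide)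
  \<comment> \<open>Halved, the threshold 3/2 bounds the ratio of consecutive terms by 3/4.\<close>
  then have "eventually (\<lambda>k. (1 + 1 / real (Suc k)) ^ p < 3 / 2) sequentially"
    by (rule order_tendstoD) simp
  then obtain N where N: "\<And>k. k \<ge> N \<Longrightarrow> (1 + 1 / real (Suc k)) ^ p < 3 / 2"
    unfolding eventually_sequentially by blast
  show ?thesis
  proof (rule summable_ratio_test[of "3 / 4" N])
    fix k assume k: "k \<ge> N"
    have "real (Suc (Suc k)) = (1 + 1 / real (Suc k)) * real (Suc k)" by (simp add: field_simps)
    then have "real (Suc (Suc k)) ^ p / 2 ^ Suc k = (1 + 1 / real (Suc k)) ^ p / 2 * (real (Suc k) ^ p / 2 ^ k)"
      by (simp add: power_mult_distrib del: of_nat_Suc)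
    also have "\<dots> \<le> 3 / 4 * (real (Suc k) ^ p / 2 ^ k)"
      using N[OF k] by (intro mult_right_mono) auto
    finally show "norm (real (Suc (Suc k)) ^ p / 2 ^ Suc k) \<le> 3 / 4 * norm (real (Suc k) ^ p / 2 ^ k)"
      by (simp del: of_nat_Suc)
  qed simp
qed

section \<open>Square deviation on one genealogy\<close>

context interacting_branching_diffusion
begin

definition scaled_count :: "(real ^ 'd) set \<Rightarrow> nat \<Rightarrow> 'w \<Rightarrow> real" where
  "scaled_count B n \<omega> = real n powr (real CARD('d) / 2) / 2 ^ n * (\<Sum>i=1..2 ^ n. indicator B (Z (real n) i \<omega>))"

lemma measure_particle_measure:
  assumes "B \<in> sets borel"
  shows "measure (particle_measure Z (real n) \<omega>) B = (\<Sum>i=1..2 ^ n. indicator B (Z (real n) i \<omega>))"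
proof -
  have "emeasure (particle_measure Z (real n) \<omega>) B = (\<Sum>i=1..2 ^ n. ennreal (indicator B (Z (real n) i \<omega>)))"
    using emeasure_particle_measure[OF assms, of Z "real n" \<omega>] assms by (simp add: labels_def ennreal_indicator)
  also have "\<dots> = ennreal (\<Sum>i=1..2 ^ n. indicator B (Z (real n) i \<omega>))"
    by (rule sum_ennreal) auto
  finally show ?thesis by (simp add: measure_def sum_nonneg)
qed

lemma scaled_count_measurable [measurable]:
  "B \<in> sets borel \<Longrightarrow> scaled_count B n \<in> borel_measurable M"
  unfolding scaled_count_def
  by (intro borel_measurable_times borel_measurable_const borel_measurable_sum measurable_compose[OF Z_measurable'])
    auto

text \<open>Expand the square into pairs. The two summands of \<kappa> belong to two kinds of pairs:
  recently separated ones, with 2 s > n, are bounded trivially, the others by the correlation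
  factor. Summing over pairs by share then leaves a convergent series times 1 / n^2.\<close>

lemma square_deviation_on_genealogy:
  fixes B :: "(real ^ 'd) set" and C R :: real
  assumes b: "b + \<gamma> = 0" "b > 0" and g: "genealogy n g"
    and r: "strict_mono r" "(\<lambda>k. excess b n (r k)) \<longlonglongrightarrow> \<delta>"
    and \<delta>: "\<bar>\<delta>\<bar> \<le> C" and C: "C \<ge> 0" and n: "real n \<ge> 8 * (C + 1)"
    and B: "B \<in> sets borel" "\<And>x. x \<in> B \<Longrightarrow> norm x \<le> R"
  defines "A \<equiv> 8 * real CARD('d) * (1 + C)\<^sup>2 + 16 * (1 + C) * R\<^sup>2"
  defines "\<kappa> \<equiv> A * exp A * (measure lborel B)\<^sup>2 + 2 ^ (CARD('d) + 2)"
  defines "L \<equiv> real n powr (real CARD('d) / 2) * measure (gauss (real n + \<delta>)) B"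
  shows "(\<integral>\<omega>. indicator (genealogy_event n g) \<omega> * (scaled_count B n \<omega> - L)\<^sup>2 \<partial>M)
    \<le> prob (genealogy_event n g) * (\<kappa> / (real n)\<^sup>2 * (\<Sum>k<n. real (Suc k) ^ (CARD('d) + 2) / 2 ^ k))"
proof -
  let ?G = "genealogy_event n g" and ?d = "CARD('d)" and ?L = "{1..2 ^ n :: nat}"
  define a where "a = real n + \<delta>"
  define \<Gamma> where "\<Gamma> = measure (gauss a) B"
  define q where "q = real n powr (real ?d / 2)"
  define H where "H i = Z (real n) i -` B \<inter> space M" for i
  have n8: "8 * C + 8 \<le> real n" using n by (simp add: algebra_simps)
  have n0: "n > 0" using n8 C by (cases n) auto
  have a: "a \<ge> real n / 2" "a > 0" unfolding a_def using n8 \<delta> C by linarith+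
  have q: "q\<^sup>2 = real n ^ ?d"
    unfolding q_def using n0 by (simp add: powr_realpow[symmetric] powr_powr flip: powr_numeral)
  have L: "L = q * \<Gamma>" by (simp add: L_def q_def \<Gamma>_def a_def)
  have A: "A \<ge> 0" unfolding A_def using C by auto
  have H [measurable]: "H i \<in> sets M" if "i \<in> ?L" for i
    unfolding H_def using measurable_sets[OF Z_measurable'[OF that] B(1)] .
  have single: "prob (?G \<inter> H i) = prob ?G * \<Gamma>" if "i \<in> ?L" for i
    unfolding H_def \<Gamma>_def a_def by (rule prob_single[OF b g that r _ B(1)]) (use a in \<open>simp add: a_def\<close>)
  have pair: "real n ^ ?d * prob (?G \<inter> (H i \<inter> H j))
      \<le> prob ?G * (L\<^sup>2 + \<kappa> / (real n)\<^sup>2 * real (share g n i j) ^ (?d + 2))" if ij: "i \<in> ?L" "j \<in> ?L" for i j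
  proof -
    define s where "s = share g n i j"
    have s: "s \<ge> 1" unfolding s_def by (rule share_pos[OF g ij n0])
    have Hij: "H i \<inter> H j = Z (real n) i -` B \<inter> Z (real n) j -` B \<inter> space M" by (auto simp: H_def)
    have L2: "L\<^sup>2 = real n ^ ?d * \<Gamma>\<^sup>2" unfolding L power_mult_distrib q ..
    show ?thesis
    proof (cases "2 * s \<le> n")
      case True
      note c = corr_factor_asymptotics[OF C n s True \<delta>]
      have "real n ^ ?d * prob (?G \<inter> (H i \<inter> H j))
          \<le> real n ^ ?d * (prob ?G * (corr_factor ?d R a ((real s + \<delta>) / a) * \<Gamma>\<^sup>2))"
        unfolding Hij \<Gamma>_def a_def s_def
        using c(1) by (intro mult_left_mono prob_pair_le[OF b g ij r _ B]) (auto simp: s_def)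
      also have "\<dots> \<le> real n ^ ?d * (prob ?G * ((1 + A * exp A * (real s)\<^sup>2 / (real n)\<^sup>2) * \<Gamma>\<^sup>2))"
        unfolding A_def a_def using c(2) by (intro mult_left_mono mult_right_mono) auto
      also have "\<dots> = prob ?G * (L\<^sup>2 + A * exp A * (real n ^ ?d * \<Gamma>\<^sup>2) / (real n)\<^sup>2 * (real s)\<^sup>2)"
        unfolding L2 by (simp add: algebra_simps)
      also have "\<dots> \<le> prob ?G * (L\<^sup>2 + \<kappa> / (real n)\<^sup>2 * real s ^ (?d + 2))"
      proof (intro mult_left_mono add_left_mono mult_mono divide_right_mono)
        have "real n ^ ?d * \<Gamma>\<^sup>2 \<le> (measure lborel B)\<^sup>2"
          using power_times_gauss_square_le[OF n0 a(1) B] by (simp add: \<Gamma>_def)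
        then have "A * exp A * (real n ^ ?d * \<Gamma>\<^sup>2) \<le> A * exp A * (measure lborel B)\<^sup>2"
          using A by (intro mult_left_mono) auto
        also have "\<dots> \<le> \<kappa>" by (simp add: \<kappa>_def)
        finally show "A * exp A * (real n ^ ?d * \<Gamma>\<^sup>2) \<le> \<kappa>" .
        show "(real s)\<^sup>2 \<le> real s ^ (?d + 2)" using s by (intro power_increasing) auto
      qed (use A in \<open>auto simp: \<kappa>_def\<close>)
      finally show ?thesis by (simp add: s_def)
    next
      case False
      \<comment> \<open>Origin of the exponent d + 2: raising n <= 2 s to this power pays for the
        scaling n^d and leaves the required 1 / n^2. The large power of s is harmless, since pairs
        with share s are exponentially rare.\<close>
      then have "real n \<le> 2 * real s" by linarith
      then have "real n ^ (?d + 2) \<le> (2 * real s) ^ (?d + 2)" by (intro power_mono) auto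
      also have "\<dots> = 2 ^ (?d + 2) * real s ^ (?d + 2)" by (rule power_mult_distrib)
      also have "\<dots> \<le> \<kappa> * real s ^ (?d + 2)" using A by (intro mult_right_mono) (auto simp: \<kappa>_def)
      finally have "real n ^ ?d * (real n)\<^sup>2 \<le> \<kappa> * real s ^ (?d + 2)" by (simp only: power_add)
      then have nd: "real n ^ ?d \<le> \<kappa> / (real n)\<^sup>2 * real s ^ (?d + 2)"
        using n0 by (simp add: field_simps)
      have "real n ^ ?d * prob (?G \<inter> (H i \<inter> H j)) \<le> real n ^ ?d * prob ?G"
        by (intro mult_left_mono finite_measure_mono) auto
      also have "\<dots> \<le> (\<kappa> / (real n)\<^sup>2 * real s ^ (?d + 2)) * prob ?G"
        using nd by (intro mult_right_mono) auto
      also have "\<dots> \<le> prob ?G * (L\<^sup>2 + \<kappa> / (real n)\<^sup>2 * real s ^ (?d + 2))"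
        by (simp add: algebra_simps)
      finally show ?thesis by (simp add: s_def)
    qed
  qed
  have count: "scaled_count B n \<omega> = q / 2 ^ n * (\<Sum>i\<in>?L. indicator (H i) \<omega>)" if "\<omega> \<in> space M" for \<omega>
    unfolding scaled_count_def q_def H_def using that by (auto simp: indicator_def)
  have expand: "indicator ?G \<omega> * (scaled_count B n \<omega> - L)\<^sup>2
      = (q / 2 ^ n)\<^sup>2 * (\<Sum>i\<in>?L. \<Sum>j\<in>?L. indicator (?G \<inter> (H i \<inter> H j)) \<omega>)
        - 2 * L * (q / 2 ^ n) * (\<Sum>i\<in>?L. indicator (?G \<inter> H i) \<omega>) + L\<^sup>2 * indicator ?G \<omega>"
    if "\<omega> \<in> space M" for \<omega>
  proof -
    define I where "I = indicat_real ?G \<omega>"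
    define S where "S = (\<Sum>i\<in>?L. indicat_real (H i) \<omega>)"
    have "(\<Sum>i\<in>?L. \<Sum>j\<in>?L. indicator (?G \<inter> (H i \<inter> H j)) \<omega>) = I * (S * S)"
      unfolding I_def S_def sum_product by (simp only: indicator_inter_arith sum_distrib_left)
    moreover have "(\<Sum>i\<in>?L. indicator (?G \<inter> H i) \<omega>) = I * S"
      unfolding I_def S_def by (simp only: indicator_inter_arith sum_distrib_left)
    ultimately show ?thesis
      unfolding count[OF that] S_def[symmetric] I_def[symmetric]
      by (simp add: power2_diff power_mult_distrib power2_eq_square algebra_simps)
  qed
  have "(\<integral>\<omega>. indicator ?G \<omega> * (scaled_count B n \<omega> - L)\<^sup>2 \<partial>M)
      = (\<integral>\<omega>. (q / 2 ^ n)\<^sup>2 * (\<Sum>i\<in>?L. \<Sum>j\<in>?L. indicator (?G \<inter> (H i \<inter> H j)) \<omega>)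
        - 2 * L * (q / 2 ^ n) * (\<Sum>i\<in>?L. indicator (?G \<inter> H i) \<omega>) + L\<^sup>2 * indicator ?G \<omega> \<partial>M)"
    by (intro Bochner_Integration.integral_cong refl expand)
  also have "\<dots> = (q / 2 ^ n)\<^sup>2 * (\<Sum>i\<in>?L. \<Sum>j\<in>?L. prob (?G \<inter> (H i \<inter> H j)))
        - 2 * L * (q / 2 ^ n) * (\<Sum>i\<in>?L. prob (?G \<inter> H i)) + L\<^sup>2 * prob ?G"
  proof -
    have i2: "has_bochner_integral M (\<lambda>\<omega>. \<Sum>i\<in>?L. \<Sum>j\<in>?L. indicator (?G \<inter> (H i \<inter> H j)) \<omega>) (\<Sum>i\<in>?L. \<Sum>j\<in>?L. prob (?G \<inter> (H i \<inter> H j)))"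
      by (intro has_bochner_integral_sum has_bochner_integral_real_indicator) (auto simp: emeasure_eq_measure)
    have i1: "has_bochner_integral M (\<lambda>\<omega>. \<Sum>i\<in>?L. indicator (?G \<inter> H i) \<omega>) (\<Sum>i\<in>?L. prob (?G \<inter> H i))"
      by (intro has_bochner_integral_sum has_bochner_integral_real_indicator) (auto simp: emeasure_eq_measure)
    have i0: "has_bochner_integral M (\<lambda>\<omega>. indicator ?G \<omega>) (prob ?G)"
      by (intro has_bochner_integral_real_indicator) (auto simp: emeasure_eq_measure)
    show ?thesis
      by (rule has_bochner_integral_integral_eq)
        (intro has_bochner_integral_add has_bochner_integral_diff has_bochner_integral_mult_right i0 i1 i2)
  qed
  also have "(\<Sum>i\<in>?L. prob (?G \<inter> H i)) = 2 ^ n * (prob ?G * \<Gamma>)"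
    using single by simp
  \<comment> \<open>Given the genealogy, L is the exact mean of the scaled count, so the cross term
    is - 2 L^2 times the probability, and the whole is a second moment minus L^2 times the
    probability.\<close>
  also have "(q / 2 ^ n)\<^sup>2 * (\<Sum>i\<in>?L. \<Sum>j\<in>?L. prob (?G \<inter> (H i \<inter> H j)))
        - 2 * L * (q / 2 ^ n) * (2 ^ n * (prob ?G * \<Gamma>)) + L\<^sup>2 * prob ?G
      = (1 / 4 ^ n) * (\<Sum>i\<in>?L. \<Sum>j\<in>?L. real n ^ ?d * prob (?G \<inter> (H i \<inter> H j))) - L\<^sup>2 * prob ?G"
    unfolding power_divide q
    by (simp add: L power2_eq_square sum_distrib_left[symmetric] power_mult_distrib[symmetric])
  also have "\<dots> \<le> (1 / 4 ^ n) * (\<Sum>i\<in>?L. \<Sum>j\<in>?L. prob ?G * (L\<^sup>2 + \<kappa> / (real n)\<^sup>2 * real (share g n i j) ^ (?d + 2))) - L\<^sup>2 * prob ?G"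
    by (intro diff_right_mono mult_left_mono sum_mono pair) auto
  also have "(\<Sum>i\<in>?L. \<Sum>j\<in>?L. prob ?G * (L\<^sup>2 + \<kappa> / (real n)\<^sup>2 * real (share g n i j) ^ (?d + 2)))
      = prob ?G * (4 ^ n * L\<^sup>2 + \<kappa> / (real n)\<^sup>2 * (\<Sum>i\<in>?L. \<Sum>j\<in>?L. real (share g n i j) ^ (?d + 2)))"
    by (simp only: sum_distrib_left[symmetric] sum.distrib sum_constant card_atLeastAtMost)
      (simp add: power_mult_distrib[symmetric] mult.assoc[symmetric])
  also have "(1 / 4 ^ n) * (prob ?G * (4 ^ n * L\<^sup>2 + \<kappa> / (real n)\<^sup>2 * (\<Sum>i\<in>?L. \<Sum>j\<in>?L. real (share g n i j) ^ (?d + 2)))) - L\<^sup>2 * prob ?G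
      = prob ?G * (\<kappa> / (real n)\<^sup>2 * ((\<Sum>i\<in>?L. \<Sum>j\<in>?L. real (share g n i j) ^ (?d + 2)) / 4 ^ n))"
    by (simp add: field_simps)
  also have "\<dots> \<le> prob ?G * (\<kappa> / (real n)\<^sup>2 * (\<Sum>k<n. real (Suc k) ^ (?d + 2) / 2 ^ k))"
  proof -
    have "(\<Sum>i\<in>?L. \<Sum>j\<in>?L. real (share g n i j) ^ (?d + 2)) / 4 ^ n \<le> (\<Sum>k<n. real (Suc k) ^ (?d + 2) / 2 ^ k)"
      using sum_share_le[OF g n0, of "\<lambda>s. real s ^ (?d + 2)"] by (simp add: field_simps)
    then show ?thesis using A by (intro mult_left_mono) (auto simp: \<kappa>_def)
  qed
  finally show ?thesis .
qed

section \<open>Averaging over genealogies\<close>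

definition genealogies :: "nat \<Rightarrow> (nat \<Rightarrow> nat \<Rightarrow> nat) set" where
  "genealogies n = {g \<in> PiE {..<n} (\<lambda>m. PiE {1..2 ^ Suc m} (\<lambda>_. {1..2 ^ m})). genealogy n g}"

lemma finite_genealogies: "finite (genealogies n)"
  unfolding genealogies_def
  by (rule finite_subset[of _ "PiE {..<n} (\<lambda>m. PiE {1..2 ^ Suc m} (\<lambda>_. {1..2 ^ m}))"])
    (auto intro!: finite_PiE)

text \<open>An event fixes the parent maps only on labels and generations that exist before time n.
  Extensional functions give one representative for each such choice, which makes the family finite
  and its events disjoint.\<close>

lemma disjoint_genealogy_events: "disjoint_family_on (genealogy_event n) (genealogies n)"
unfolding disjoint_family_on_def
proof (intro ballI impI)
  fix g g' assume g: "g \<in> genealogies n" "g' \<in> genealogies n" "g \<noteq> g'"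
  show "genealogy_event n g \<inter> genealogy_event n g' = {}"
  proof (rule ccontr)
    assume "\<not> ?thesis"
    then obtain \<omega> where \<omega>: "\<omega> \<in> genealogy_event n g" "\<omega> \<in> genealogy_event n g'" by auto
    have P: "g \<in> PiE {..<n} (\<lambda>m. PiE {1..2 ^ Suc m} (\<lambda>_. {1..2 ^ m}))"
        "g' \<in> PiE {..<n} (\<lambda>m. PiE {1..2 ^ Suc m} (\<lambda>_. {1..2 ^ m}))"
      using g by (auto simp: genealogies_def)
    have "g = g'"
    proof (rule PiE_ext[OF P])
      fix m assume m: "m \<in> {..<n}"
      show "g m = g' m"
      proof (rule PiE_ext[OF PiE_mem[OF P(1) m] PiE_mem[OF P(2) m]])
        fix i :: nat assume "i \<in> {1..2 ^ Suc m}"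
        then show "g m i = g' m i" using \<omega> m unfolding genealogy_event_def by fastforce
      qed
    qed
    then show False using g by simp
  qed
qed

lemma AE_genealogy: "AE \<omega> in M. \<exists>g\<in>genealogies n. \<omega> \<in> genealogy_event n g"
  using two_offspring AE_space
proof eventually_elim
  case (elim \<omega>)
  define g where "g = (\<lambda>m\<in>{..<n}. \<lambda>i\<in>{1..2 ^ Suc m}. parent m i \<omega>)"
  have g: "g m i = parent m i \<omega>" if "m < n" "i \<in> {1..2 ^ Suc m}" for m i
    using that by (simp add: g_def)
  have "genealogy n g"
    unfolding genealogy_def
  proof (intro allI impI conjI ballI)
    fix m assume m: "m < n"
    show "g m i \<in> {1..2 ^ m}" if "i \<in> {1..2 ^ Suc m}" for i
      unfolding g[OF m that] using elim(1) that by blast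
    show "card {i \<in> {1..2 ^ Suc m}. g m i = j} = 2" if "j \<in> {1..2 ^ m}" for j
    proof -
      have "{i \<in> {1..2 ^ Suc m}. g m i = j} = {i \<in> {1..2 ^ Suc m}. parent m i \<omega> = j}"
        using g[OF m] by auto
      then show ?thesis using elim(1) that by metis
    qed
  qed
  moreover have "g \<in> PiE {..<n} (\<lambda>m. PiE {1..2 ^ Suc m} (\<lambda>_. {1..2 ^ m}))"
  proof (rule PiE_I)
    fix m assume "m \<in> {..<n}"
    then show "g m \<in> PiE {1..2 ^ Suc m} (\<lambda>_. {1..2 ^ m})"
      unfolding g_def using elim(1) by (simp only: restrict_apply') (intro restrict_PiE_iff[THEN iffD2] ballI, blast)
  qed (simp add: g_def)
  moreover have "\<omega> \<in> genealogy_event n g"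
    using elim(2) g unfolding genealogy_event_def by auto
  ultimately show ?case by (auto simp: genealogies_def)
qed

lemma scaled_count_bounds: "0 \<le> scaled_count B n \<omega>" "scaled_count B n \<omega> \<le> real n powr (real CARD('d) / 2)"
proof -
  show "0 \<le> scaled_count B n \<omega>"
    unfolding scaled_count_def by (intro mult_nonneg_nonneg sum_nonneg) auto
  have "(\<Sum>i=1..2 ^ n. indicator B (Z (real n) i \<omega>)) \<le> (\<Sum>i=1..2 ^ n :: nat. 1 :: real)"
    by (intro sum_mono) (auto simp: indicator_def)
  then have "(\<Sum>i=1..2 ^ n. indicator B (Z (real n) i \<omega>)) \<le> (2 ^ n :: real)" by simp
  from mult_left_mono[OF this, of "real n powr (real CARD('d) / 2) / 2 ^ n"]
  show "scaled_count B n \<omega> \<le> real n powr (real CARD('d) / 2)"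
    unfolding scaled_count_def by simp
qed

text \<open>The centre L is common to all genealogies, so their bounds are simply added, with
  weights of total at most 1. Replacing partial sums by the full series makes the constant
  independent of n.\<close>

lemma square_deviation:
  fixes B :: "(real ^ 'd) set" and C R :: real
  assumes b: "b + \<gamma> = 0" "b > 0"
    and r: "strict_mono r" "(\<lambda>k. excess b n (r k)) \<longlonglongrightarrow> \<delta>"
    and \<delta>: "\<bar>\<delta>\<bar> \<le> C" and C: "C \<ge> 0" and n: "real n \<ge> 8 * (C + 1)"
    and B: "B \<in> sets borel" "\<And>x. x \<in> B \<Longrightarrow> norm x \<le> R"
  defines "A \<equiv> 8 * real CARD('d) * (1 + C)\<^sup>2 + 16 * (1 + C) * R\<^sup>2"
  defines "\<kappa> \<equiv> A * exp A * (measure lborel B)\<^sup>2 + 2 ^ (CARD('d) + 2)"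
  defines "L \<equiv> real n powr (real CARD('d) / 2) * measure (gauss (real n + \<delta>)) B"
  shows "(\<integral>\<^sup>+\<omega>. ennreal ((scaled_count B n \<omega> - L)\<^sup>2) \<partial>M)
    \<le> ennreal (\<kappa> * (\<Sum>k. real (Suc k) ^ (CARD('d) + 2) / 2 ^ k) / (real n)\<^sup>2)"
proof -
  define D where "D \<omega> = (scaled_count B n \<omega> - L)\<^sup>2" for \<omega>
  define S where "S = (\<Sum>k. real (Suc k) ^ (CARD('d) + 2) / 2 ^ k)"
  let ?G = "genealogy_event n"
  have D [measurable]: "D \<in> borel_measurable M" unfolding D_def using B(1) by measurable
  have \<kappa>: "\<kappa> \<ge> 0" unfolding \<kappa>_def A_def using C by (auto intro!: add_nonneg_nonneg mult_nonneg_nonneg)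
  have int: "integrable M (\<lambda>\<omega>. indicator (?G g) \<omega> * D \<omega>)" for g
  proof (rule integrable_const_bound)
    let ?q = "real n powr (real CARD('d) / 2)"
    show "AE \<omega> in M. norm (indicator (?G g) \<omega> * D \<omega>) \<le> (?q + \<bar>L\<bar>)\<^sup>2"
    proof (intro AE_I2)
      fix \<omega>
      have "\<bar>scaled_count B n \<omega> - L\<bar> \<le> ?q + \<bar>L\<bar>"
        using scaled_count_bounds[of B n \<omega>] by linarith
      then have "D \<omega> \<le> (?q + \<bar>L\<bar>)\<^sup>2"
        unfolding D_def using power_mono[of "\<bar>scaled_count B n \<omega> - L\<bar>" "?q + \<bar>L\<bar>" 2] by simp
      then show "norm (indicator (?G g) \<omega> * D \<omega>) \<le> (?q + \<bar>L\<bar>)\<^sup>2"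
        by (auto simp: indicator_def D_def)
    qed
  qed measurable
  have each: "(\<integral>\<^sup>+\<omega>. ennreal (indicator (?G g) \<omega> * D \<omega>) \<partial>M) \<le> ennreal (prob (?G g) * (\<kappa> / (real n)\<^sup>2 * S))"
    if g: "g \<in> genealogies n" for g
  proof -
    have "(\<integral>\<^sup>+\<omega>. ennreal (indicator (?G g) \<omega> * D \<omega>) \<partial>M) = ennreal (\<integral>\<omega>. indicator (?G g) \<omega> * D \<omega> \<partial>M)"
      by (rule nn_integral_eq_integral[OF int]) (auto simp: D_def)
    also have "(\<integral>\<omega>. indicator (?G g) \<omega> * D \<omega> \<partial>M)
        \<le> prob (?G g) * (\<kappa> / (real n)\<^sup>2 * (\<Sum>k<n. real (Suc k) ^ (CARD('d) + 2) / 2 ^ k))"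
      unfolding D_def \<kappa>_def A_def L_def
      by (rule square_deviation_on_genealogy[OF b _ r \<delta> C n B]) (use g in \<open>auto simp: genealogies_def\<close>)
    also have "\<dots> \<le> prob (?G g) * (\<kappa> / (real n)\<^sup>2 * S)"
      unfolding S_def using \<kappa>
      by (intro mult_left_mono sum_le_suminf summable_poly_geometric) auto
    finally show ?thesis by (simp add: ennreal_leI)
  qed
  have "(\<integral>\<^sup>+\<omega>. ennreal (D \<omega>) \<partial>M) \<le> (\<integral>\<^sup>+\<omega>. (\<Sum>g\<in>genealogies n. ennreal (indicator (?G g) \<omega> * D \<omega>)) \<partial>M)"
  proof (rule nn_integral_mono_AE)
    show "AE \<omega> in M. ennreal (D \<omega>) \<le> (\<Sum>g\<in>genealogies n. ennreal (indicator (?G g) \<omega> * D \<omega>))"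
      using AE_genealogy[of n]
    proof eventually_elim
      case (elim \<omega>)
      then obtain g where g: "g \<in> genealogies n" "\<omega> \<in> ?G g" by auto
      then have "ennreal (D \<omega>) = ennreal (indicator (?G g) \<omega> * D \<omega>)" by simp
      also have "\<dots> \<le> (\<Sum>g\<in>genealogies n. ennreal (indicator (?G g) \<omega> * D \<omega>))"
        by (rule member_le_sum[OF g(1) _ finite_genealogies]) auto
      finally show ?case .
    qed
  qed
  also have "\<dots> = (\<Sum>g\<in>genealogies n. (\<integral>\<^sup>+\<omega>. ennreal (indicator (?G g) \<omega> * D \<omega>) \<partial>M))"
    by (rule nn_integral_sum) measurable
  also have "\<dots> \<le> (\<Sum>g\<in>genealogies n. ennreal (prob (?G g) * (\<kappa> / (real n)\<^sup>2 * S)))"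
    by (intro sum_mono each)
  also have "\<dots> = ennreal (\<Sum>g\<in>genealogies n. prob (?G g) * (\<kappa> / (real n)\<^sup>2 * S))"
    unfolding S_def using \<kappa> by (intro sum_ennreal mult_nonneg_nonneg suminf_nonneg summable_poly_geometric) auto
  also have "\<dots> \<le> ennreal (\<kappa> * S / (real n)\<^sup>2)"
  proof (rule ennreal_leI)
    have "(\<Sum>g\<in>genealogies n. prob (?G g)) = prob (\<Union>g\<in>genealogies n. ?G g)"
      by (rule finite_measure_finite_Union[symmetric, OF finite_genealogies _ disjoint_genealogy_events]) auto
    then have "(\<Sum>g\<in>genealogies n. prob (?G g)) \<le> 1" by simp
    moreover have "\<kappa> / (real n)\<^sup>2 * S \<ge> 0"
      unfolding S_def using \<kappa> by (intro mult_nonneg_nonneg suminf_nonneg summable_poly_geometric) auto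
    ultimately have "(\<Sum>g\<in>genealogies n. prob (?G g)) * (\<kappa> / (real n)\<^sup>2 * S) \<le> 1 * (\<kappa> / (real n)\<^sup>2 * S)"
      by (intro mult_right_mono)
    then show "(\<Sum>g\<in>genealogies n. prob (?G g) * (\<kappa> / (real n)\<^sup>2 * S)) \<le> \<kappa> * S / (real n)\<^sup>2"
      unfolding sum_distrib_right[symmetric] by simp
  qed
  finally show ?thesis unfolding D_def S_def .
qed

text \<open>The square deviations have summable expectations, so their sum is almost surely finite
  and its terms tend to 0. What remains is the deterministic limit of L n.\<close>

lemma AE_scaled_count_tendsto:
  fixes B :: "(real ^ 'd) set"
  assumes b: "b + \<gamma> = 0" "b > 0" and B: "B \<in> sets borel" "bounded B"
  shows "AE \<omega> in M. (\<lambda>n. (2 * pi) powr (real CARD('d) / 2) * scaled_count B n \<omega>) \<longlonglongrightarrow> measure lborel B"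
proof -
  obtain R where R: "\<And>x. x \<in> B \<Longrightarrow> norm x \<le> R" using B(2) by (auto simp: bounded_iff)
  define C where "C = 2 * (2 * (2 + b) + (2 + b)\<^sup>2)"
  have C: "C \<ge> 0" using b by (simp add: C_def)
  \<comment> \<open>For fixed n the discretised corrections stay in a compact interval that does not
    depend on n, so a convergent subsequence in K exists.\<close>
  have "\<exists>\<delta> r. \<bar>\<delta>\<bar> \<le> C \<and> strict_mono r \<and> (\<lambda>k. excess b n (r k)) \<longlonglongrightarrow> \<delta>" for n
  proof -
    have "compact {- C..C}" by simp
    moreover have "\<forall>K. excess b n K \<in> {- C..C}"
    proof
      fix K
      have "\<bar>excess b n K\<bar> \<le> C" unfolding C_def by (rule excess_bound[OF b(2)])
      then show "excess b n K \<in> {- C..C}" by (simp add: abs_le_iff minus_le_iff)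
    qed
    ultimately obtain \<delta> r where "\<delta> \<in> {- C..C}" "strict_mono r" "(excess b n \<circ> r) \<longlonglongrightarrow> \<delta>"
      unfolding compact_eq_seq_compact_metric seq_compact_def by blast
    then show ?thesis by (intro exI[of _ \<delta>] exI[of _ r]) (auto simp: o_def)
  qed
  then obtain \<delta> r where \<delta>: "\<And>n. \<bar>\<delta> n\<bar> \<le> C" and r: "\<And>n. strict_mono (r n)" "\<And>n. (\<lambda>k. excess b n (r n k)) \<longlonglongrightarrow> \<delta> n"
    by metis
  define L where "L n = real n powr (real CARD('d) / 2) * measure (gauss (real n + \<delta> n)) B" for n
  define A where "A = 8 * real CARD('d) * (1 + C)\<^sup>2 + 16 * (1 + C) * R\<^sup>2"
  define c where "c = (A * exp A * (measure lborel B)\<^sup>2 + 2 ^ (CARD('d) + 2)) * (\<Sum>k. real (Suc k) ^ (CARD('d) + 2) / 2 ^ k)"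
  have A: "A \<ge> 0" unfolding A_def using C by auto
  have c: "c \<ge> 0"
    unfolding c_def using A by (intro mult_nonneg_nonneg suminf_nonneg summable_poly_geometric add_nonneg_nonneg) auto
  obtain N :: nat where N: "real N \<ge> 8 * (C + 1)" using real_arch_simple by blast
  \<comment> \<open>The variance bound holds from n >= 8 (C + 1) on; the shift by N discards the
    earlier terms.\<close>
  have dev: "(\<integral>\<^sup>+\<omega>. ennreal ((scaled_count B (n + N) \<omega> - L (n + N))\<^sup>2) \<partial>M) \<le> ennreal (c / (real (n + N))\<^sup>2)" for n
    unfolding L_def c_def A_def
    by (rule square_deviation[OF b r \<delta> C _ B(1) R]) (use N in auto)
  have sc [measurable]: "scaled_count B n \<in> borel_measurable M" for n
    by (rule scaled_count_measurable[OF B(1)])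
  have sum: "summable (\<lambda>n. c / (real (n + N))\<^sup>2)"
  proof -
    have "summable (\<lambda>n. inverse (real n ^ 2))" by (rule inverse_power_summable) simp
    then have "summable (\<lambda>n. c * inverse (real (n + N) ^ 2))"
      by (intro summable_mult) (rule summable_iff_shift[THEN iffD2])
    then show ?thesis by (simp add: divide_inverse)
  qed
  have "(\<integral>\<^sup>+\<omega>. (\<Sum>n. ennreal ((scaled_count B (n + N) \<omega> - L (n + N))\<^sup>2)) \<partial>M)
      = (\<Sum>n. \<integral>\<^sup>+\<omega>. ennreal ((scaled_count B (n + N) \<omega> - L (n + N))\<^sup>2) \<partial>M)"
    by (rule nn_integral_suminf) measurable
  also have "\<dots> \<le> (\<Sum>n. ennreal (c / (real (n + N))\<^sup>2))"
    by (intro suminf_le dev) auto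
  also have "\<dots> = ennreal (\<Sum>n. c / (real (n + N))\<^sup>2)"
    using c sum by (intro suminf_ennreal2) auto
  also have "\<dots> < \<infinity>" by simp
  finally have "AE \<omega> in M. (\<Sum>n. ennreal ((scaled_count B (n + N) \<omega> - L (n + N))\<^sup>2)) \<noteq> \<infinity>"
    by (intro nn_integral_PInf_AE) auto
  then show ?thesis
  proof eventually_elim
    case (elim \<omega>)
    have "summable (\<lambda>n. (scaled_count B (n + N) \<omega> - L (n + N))\<^sup>2)"
      using elim by (intro summable_suminf_not_top) auto
    then have "(\<lambda>n. (scaled_count B (n + N) \<omega> - L (n + N))\<^sup>2) \<longlonglongrightarrow> 0" by (rule summable_LIMSEQ_zero)
    from tendsto_real_sqrt[OF this] have "(\<lambda>n. \<bar>scaled_count B (n + N) \<omega> - L (n + N)\<bar>) \<longlonglongrightarrow> 0" by simp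
    then have "(\<lambda>n. scaled_count B (n + N) \<omega> - L (n + N)) \<longlonglongrightarrow> 0" by (rule tendsto_rabs_zero_cancel)
    then have "(\<lambda>n. scaled_count B n \<omega> - L n) \<longlonglongrightarrow> 0" by (rule LIMSEQ_offset)
    then have "(\<lambda>n. (2 * pi) powr (real CARD('d) / 2) * (scaled_count B n \<omega> - L n)) \<longlonglongrightarrow> (2 * pi) powr (real CARD('d) / 2) * 0"
      by (intro tendsto_intros)
    moreover have "(\<lambda>n. (2 * pi) powr (real CARD('d) / 2) * L n) \<longlonglongrightarrow> measure lborel B"
      unfolding L_def using measure_gauss_asymptotics[where 'e="real ^ 'd", OF \<delta> B(1) R] by simp
    ultimately have "(\<lambda>n. (2 * pi) powr (real CARD('d) / 2) * (scaled_count B n \<omega> - L n) + (2 * pi) powr (real CARD('d) / 2) * L n)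
        \<longlonglongrightarrow> (2 * pi) powr (real CARD('d) / 2) * 0 + measure lborel B"
      by (rule tendsto_add)
    then show ?case by (simp add: algebra_simps)
  qed
qed

end

theorem theorem7p2:
  fixes M :: "'w measure"
    and b \<gamma> :: real
    and parent :: "nat \<Rightarrow> nat \<Rightarrow> 'w \<Rightarrow> nat"
    and W :: "nat \<Rightarrow> nat \<Rightarrow> real \<Rightarrow> 'w \<Rightarrow> real ^ 'd"
    and Z :: "real \<Rightarrow> nat \<Rightarrow> 'w \<Rightarrow> real ^ 'd"
    and B :: "(real ^ 'd) set"
  assumes "interacting_branching_diffusion M b \<gamma> parent W Z"
    and "\<gamma> \<noteq> 0"
    and "b > 0"
    and "b + \<gamma> = 0"
    and "B \<in> sets borel"
    and "bounded B"
  shows "AE \<omega> in M.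
    (\<lambda>n. (2 * pi) powr (real CARD('d) / 2) * real n powr (real CARD('d) / 2) * 2 powr (- real n)
           * measure (particle_measure Z (real n) \<omega>) B)
      \<longlonglongrightarrow> measure lborel B"
proof -
  interpret interacting_branching_diffusion M b \<gamma> parent W Z by fact
  have eq: "(2 * pi) powr (real CARD('d) / 2) * real n powr (real CARD('d) / 2) * 2 powr (- real n)
      * measure (particle_measure Z (real n) \<omega>) B = (2 * pi) powr (real CARD('d) / 2) * scaled_count B n \<omega>" for n \<omega>
    unfolding measure_particle_measure[OF assms(5)] scaled_count_def
    by (simp add: powr_minus_divide powr_realpow)
  show ?thesis unfolding eq by (rule AE_scaled_count_tendsto[OF assms(4,3,5,6)])
qed

end
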